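(* Let $A$ be a ring, let $\mathfrak{C}$ be an $A$-coring, and let $\Sigma$ be a right $\mathfrak{C}$-comodule with coaction $\rho_\Sigma:\Sigma\to\Sigma\otimes_A\mathfrak{C}$ such that $\Sigma_A$ is finitely generated and projective. Let $T=\mathrm{End}(\Sigma_{\mathfrak{C}})$. Then the map $\mathrm{can}:\Sigma^*\otimes_T\Sigma\to\mathfrak{C}$ defined as the composition $$\Sigma^*\otimes_T\Sigma\xrightarrow{\ \Sigma^*\otimes_T\rho_\Sigma\ }\Sigma^*\otimes_T\Sigma\otimes_A\mathfrak{C}\xrightarrow{\ \epsilon\otimes_A\mathfrak{C}\ }A\otimes_A\mathfrak{C}\cong\mathfrak{C}$$ is a homomorphism of $A$-corings, where $\epsilon$ is the counit of the comatrix $A$-coring $\Sigma^*\otimes_T\Sigma$.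
   Context: All rings are associative unital algebras over a fixed commutative ring $K$; all bimodules centralize $K$. An object's name also denotes its identity map. An $A$-coring is an $A$-bimodule $\mathfrak{C}$ with $A$-bimodule maps $\Delta:\mathfrak{C}\to\mathfrak{C}\otimes_A\mathfrak{C}$ and $\epsilon:\mathfrak{C}\to A$ satisfying coassociativity and the counit axioms. A homomorphism of $A$-corings is an $A$-bimodule map commuting with comultiplications and counits. A right $\mathfrak{C}$-comodule is a right $A$-module $M$ with a right $A$-linear map $\rho_M:M\to M\otimes_A\mathfrak{C}$ with $(M\otimes_A\Delta)\rho_M=(\rho_M\otimes_A\mathfrak{C})\rho_M$ and $(M\otimes_A\epsilon)\rho_M=M$; a morphism $f:M\to N$ is a right $A$-linear map with $(f\otimes_A\mathfrak{C})\rho_M=\rho_Nf$. $\mathrm{End}(\Sigma_{\mathfrak{C}})$ is the ring of comodule endomorphisms of $\Sigma$ under composition; it makes $\Sigma$ a $T$-$A$-bimodule. Comatrix coring: for a $B$-$A$-bimodule $\Sigma$ with $\Sigma_A$ finitely generated projective, $\Sigma^*=\mathrm{Hom}_A(\Sigma,A)$ is an $A$-$B$-bimodule via $(a\varphi b)(u)=a\varphi(bu)$. With a finite dual basis $\{e_i^*,e_i\}\subseteq\Sigma^*\times\Sigma$ (so $u=\sum_i e_ie_i^*(u)$ for all $u\in\Sigma$), $\Sigma^*\otimes_B\Sigma$ is an $A$-coring with $\Delta(\varphi\otimes_B u)=\sum_i\varphi\otimes_B e_i\otimes_A e_i^*\otimes_B u$ and $\epsilon(\varphi\otimes_B u)=\varphi(u)$.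 Here it is used with $B=T$. *)

theory Defs
  imports "HOL-Algebra.Module" "HOL-Algebra.Free_Abelian_Groups"
begin

section \<open>Algebras and bimodules\<close>

text \<open>HOL-Algebra's locale algebra requires a commutative ring on top; here \<open>A\<close> is an arbitrary
  associative unital \<open>K\<close>-algebra.\<close>

locale assoc_algebra = module K A + A?: ring A
  for K (structure) and A (structure) +
  assumes smult_mult_left:
      "\<lbrakk>k \<in> carrier K; a \<in> carrier A; b \<in> carrier A\<rbrakk>
        \<Longrightarrow> (k \<odot>\<^bsub>A\<^esub> a) \<otimes>\<^bsub>A\<^esub> b = k \<odot>\<^bsub>A\<^esub> (a \<otimes>\<^bsub>A\<^esub> b)"
    and smult_mult_right:
      "\<lbrakk>k \<in> carrier K; a \<in> carrier A; b \<in> carrier A\<rbrakk>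
        \<Longrightarrow> a \<otimes>\<^bsub>A\<^esub> (k \<odot>\<^bsub>A\<^esub> b) = k \<odot>\<^bsub>A\<^esub> (a \<otimes>\<^bsub>A\<^esub> b)"

text \<open>As in HOL-Algebra's record for modules, modules extend the ring record only to reuse the
  additive notation; the multiplicative fields of a module carry no meaning.\<close>

record ('a, 'm) right_module = "'m ring" +
  rsmult :: "'m \<Rightarrow> 'a \<Rightarrow> 'm" (infixl \<open>\<triangleleft>\<index>\<close> 70)

record ('b, 'a, 'm) bimodule = "('a, 'm) right_module" +
  lsmult :: "'b \<Rightarrow> 'm \<Rightarrow> 'm" (infixr \<open>\<triangleright>\<index>\<close> 70)

locale right_module = A?: ring A + M?: abelian_group M
  for A (structure) and M (structure) +
  assumes rsmult_closed: "\<lbrakk>m \<in> carrier M; a \<in> carrier A\<rbrakk> \<Longrightarrow> m \<triangleleft>\<^bsub>M\<^esub> a \<in> carrier M"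
    and rsmult_l_distr: "\<lbrakk>m \<in> carrier M; n \<in> carrier M; a \<in> carrier A\<rbrakk>
      \<Longrightarrow> (m \<oplus>\<^bsub>M\<^esub> n) \<triangleleft>\<^bsub>M\<^esub> a = m \<triangleleft>\<^bsub>M\<^esub> a \<oplus>\<^bsub>M\<^esub> n \<triangleleft>\<^bsub>M\<^esub> a"
    and rsmult_r_distr: "\<lbrakk>m \<in> carrier M; a \<in> carrier A; b \<in> carrier A\<rbrakk>
      \<Longrightarrow> m \<triangleleft>\<^bsub>M\<^esub> (a \<oplus>\<^bsub>A\<^esub> b) = m \<triangleleft>\<^bsub>M\<^esub> a \<oplus>\<^bsub>M\<^esub> m \<triangleleft>\<^bsub>M\<^esub> b"
    and rsmult_assoc: "\<lbrakk>m \<in> carrier M; a \<in> carrier A; b \<in> carrier A\<rbrakk>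
      \<Longrightarrow> m \<triangleleft>\<^bsub>M\<^esub> (a \<otimes>\<^bsub>A\<^esub> b) = (m \<triangleleft>\<^bsub>M\<^esub> a) \<triangleleft>\<^bsub>M\<^esub> b"
    and rsmult_one: "m \<in> carrier M \<Longrightarrow> m \<triangleleft>\<^bsub>M\<^esub> \<one>\<^bsub>A\<^esub> = m"

text \<open>\<open>B\<close>-\<open>A\<close>-bimodules centralizing \<open>K\<close>, where \<open>K\<close> acts on either side through \<open>k \<mapsto> k \<odot> \<one>\<close>.\<close>

locale bimodule = assoc_algebra K B + assoc_algebra K A + right_module A M
  for K (structure) and B (structure) and A (structure) and M (structure) +
  assumes lsmult_closed: "\<lbrakk>b \<in> carrier B; m \<in> carrier M\<rbrakk> \<Longrightarrow> b \<triangleright>\<^bsub>M\<^esub> m \<in> carrier M"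
    and lsmult_r_distr: "\<lbrakk>b \<in> carrier B; m \<in> carrier M; n \<in> carrier M\<rbrakk>
      \<Longrightarrow> b \<triangleright>\<^bsub>M\<^esub> (m \<oplus>\<^bsub>M\<^esub> n) = (b \<triangleright>\<^bsub>M\<^esub> m) \<oplus>\<^bsub>M\<^esub> (b \<triangleright>\<^bsub>M\<^esub> n)"
    and lsmult_l_distr: "\<lbrakk>b \<in> carrier B; c \<in> carrier B; m \<in> carrier M\<rbrakk>
      \<Longrightarrow> (b \<oplus>\<^bsub>B\<^esub> c) \<triangleright>\<^bsub>M\<^esub> m = (b \<triangleright>\<^bsub>M\<^esub> m) \<oplus>\<^bsub>M\<^esub> (c \<triangleright>\<^bsub>M\<^esub> m)"
    and lsmult_assoc: "\<lbrakk>b \<in> carrier B; c \<in> carrier B; m \<in> carrier M\<rbrakk>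
      \<Longrightarrow> (b \<otimes>\<^bsub>B\<^esub> c) \<triangleright>\<^bsub>M\<^esub> m = b \<triangleright>\<^bsub>M\<^esub> (c \<triangleright>\<^bsub>M\<^esub> m)"
    and lsmult_one: "m \<in> carrier M \<Longrightarrow> \<one>\<^bsub>B\<^esub> \<triangleright>\<^bsub>M\<^esub> m = m"
    and lsmult_rsmult: "\<lbrakk>b \<in> carrier B; m \<in> carrier M; a \<in> carrier A\<rbrakk>
      \<Longrightarrow> (b \<triangleright>\<^bsub>M\<^esub> m) \<triangleleft>\<^bsub>M\<^esub> a = b \<triangleright>\<^bsub>M\<^esub> (m \<triangleleft>\<^bsub>M\<^esub> a)"
    and centralizes: "\<lbrakk>k \<in> carrier K; m \<in> carrier M\<rbrakk>
      \<Longrightarrow> (k \<odot>\<^bsub>B\<^esub> \<one>\<^bsub>B\<^esub>) \<triangleright>\<^bsub>M\<^esub> m = m \<triangleleft>\<^bsub>M\<^esub> (k \<odot>\<^bsub>A\<^esub> \<one>\<^bsub>A\<^esub>)"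

definition right_hom ::
  "('a, 'ax) ring_scheme \<Rightarrow> ('a, 'm, 'mx) right_module_scheme \<Rightarrow> ('a, 'n, 'nx) right_module_scheme
    \<Rightarrow> ('m \<Rightarrow> 'n) set" where
  "right_hom A M N = {f \<in> carrier M \<rightarrow> carrier N.
     (\<forall>x\<in>carrier M. \<forall>y\<in>carrier M. f (x \<oplus>\<^bsub>M\<^esub> y) = f x \<oplus>\<^bsub>N\<^esub> f y) \<and>
     (\<forall>x\<in>carrier M. \<forall>a\<in>carrier A. f (x \<triangleleft>\<^bsub>M\<^esub> a) = f x \<triangleleft>\<^bsub>N\<^esub> a)}"

definition bimodule_hom ::
  "('b, 'bx) ring_scheme \<Rightarrow> ('a, 'ax) ring_scheme \<Rightarrow> ('b, 'a, 'm, 'mx) bimodule_scheme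
    \<Rightarrow> ('b, 'a, 'n, 'nx) bimodule_scheme \<Rightarrow> ('m \<Rightarrow> 'n) set" where
  "bimodule_hom B A M N = {f \<in> right_hom A M N.
     \<forall>b\<in>carrier B. \<forall>x\<in>carrier M. f (b \<triangleright>\<^bsub>M\<^esub> x) = b \<triangleright>\<^bsub>N\<^esub> f x}"

definition regular_bimodule :: "('a, 'ax) ring_scheme \<Rightarrow> ('a, 'a, 'a) bimodule" where
  "regular_bimodule A = \<lparr>carrier = carrier A, monoid.mult = monoid.mult A, one = monoid.one A,
     ring.zero = ring.zero A, ring.add = ring.add A, rsmult = monoid.mult A, lsmult = monoid.mult A\<rparr>"

definition finitely_generated ::
  "('a, 'ax) ring_scheme \<Rightarrow> ('a, 'm, 'mx) right_module_scheme \<Rightarrow> bool" where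
  "finitely_generated A M \<longleftrightarrow> (\<exists>G. finite G \<and> G \<subseteq> carrier M \<and>
     (\<forall>u\<in>carrier M. \<exists>c \<in> G \<rightarrow> carrier A. u = (\<Oplus>\<^bsub>M\<^esub>g\<in>G. g \<triangleleft>\<^bsub>M\<^esub> c g)))"

text \<open>The lifting property. A definition cannot quantify over types, so the test modules \<open>N\<close> and
  \<open>P\<close> live on fixed types. These are large enough for the usual notion: the type of \<open>N\<close> hosts the
  free module on the elements of \<open>M\<close>, and \<open>P\<close> may be \<open>M\<close> itself.\<close>

definition projective ::
  "('a, 'ax) ring_scheme \<Rightarrow> ('a, 'm, 'mx) right_module_scheme \<Rightarrow> bool" where
  "projective A M \<longleftrightarrow>
     (\<forall>(N :: ('a, 'm \<Rightarrow> 'a) right_module) (P :: ('a, 'm) right_module).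
        right_module A N \<longrightarrow> right_module A P \<longrightarrow>
        (\<forall>g \<in> right_hom A N P. \<forall>f \<in> right_hom A M P. g ` carrier N = carrier P \<longrightarrow>
           (\<exists>h \<in> right_hom A M N. \<forall>u\<in>carrier M. g (h u) = f u)))"


section \<open>Tensor products\<close>

text \<open>\<open>M \<otimes>\<^sub>R N\<close> is the free abelian group on \<open>M \<times> N\<close> modulo the bilinearity relations, so its
  elements are cosets.\<close>

type_synonym ('m, 'n) tensor = "('m \<times> 'n \<Rightarrow>\<^sub>0 int) set"

definition tensor_relations ::
  "('r, 'rx) ring_scheme \<Rightarrow> ('r, 'm, 'mx) right_module_scheme \<Rightarrow> ('r, 'a, 'n, 'nx) bimodule_scheme
    \<Rightarrow> ('m \<times> 'n \<Rightarrow>\<^sub>0 int) set" where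
  "tensor_relations R M N =
     {frag_of (m \<oplus>\<^bsub>M\<^esub> m', n) - frag_of (m, n) - frag_of (m', n) | m m' n.
        m \<in> carrier M \<and> m' \<in> carrier M \<and> n \<in> carrier N} \<union>
     {frag_of (m, n \<oplus>\<^bsub>N\<^esub> n') - frag_of (m, n) - frag_of (m, n') | m n n'.
        m \<in> carrier M \<and> n \<in> carrier N \<and> n' \<in> carrier N} \<union>
     {frag_of (m \<triangleleft>\<^bsub>M\<^esub> r, n) - frag_of (m, r \<triangleright>\<^bsub>N\<^esub> n) | m r n.
        m \<in> carrier M \<and> r \<in> carrier R \<and> n \<in> carrier N}"

definition tensor_null ::
  "('r, 'rx) ring_scheme \<Rightarrow> ('r, 'm, 'mx) right_module_scheme \<Rightarrow> ('r, 'a, 'n, 'nx) bimodule_scheme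
    \<Rightarrow> ('m, 'n) tensor" where
  "tensor_null R M N =
     generate (free_Abelian_group (carrier M \<times> carrier N)) (tensor_relations R M N)"

definition tens ::
  "('r, 'rx) ring_scheme \<Rightarrow> ('r, 'm, 'mx) right_module_scheme \<Rightarrow> ('r, 'a, 'n, 'nx) bimodule_scheme
    \<Rightarrow> 'm \<Rightarrow> 'n \<Rightarrow> ('m, 'n) tensor" where
  "tens R M N m n =
     tensor_null R M N #>\<^bsub>free_Abelian_group (carrier M \<times> carrier N)\<^esub> frag_of (m, n)"

definition tensor_group ::
  "('r, 'rx) ring_scheme \<Rightarrow> ('r, 'm, 'mx) right_module_scheme \<Rightarrow> ('r, 'a, 'n, 'nx) bimodule_scheme
    \<Rightarrow> ('m, 'n) tensor ring" where
  "tensor_group R M N =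
     (let Q = free_Abelian_group (carrier M \<times> carrier N) Mod tensor_null R M N
      in \<lparr>carrier = carrier Q, monoid.mult = undefined, one = undefined,
          ring.zero = one Q, ring.add = monoid.mult Q\<rparr>)"

text \<open>The additive map \<open>m \<otimes> n \<mapsto> \<beta> (m, n)\<close> into \<open>P\<close>, for a balanced biadditive map \<open>\<beta>\<close>: such a
  \<open>\<beta>\<close> extends to a map on the free abelian group that is constant on each coset, and that constant
  is the value.\<close>

definition tensor_lift ::
  "('p, 'px) ring_scheme \<Rightarrow> ('m \<times> 'n \<Rightarrow> 'p) \<Rightarrow> ('m, 'n) tensor \<Rightarrow> 'p" where
  "tensor_lift P \<beta> X =
     the_elem ((\<lambda>c. \<Oplus>\<^bsub>P\<^esub>p\<in>Poly_Mapping.keys c. [Poly_Mapping.lookup c p] \<cdot>\<^bsub>P\<^esub> \<beta> p) ` X)"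

text \<open>\<open>f \<otimes>\<^sub>R g\<close>, with target \<open>M \<otimes>\<^sub>R N\<close>\<close>

definition tensor_map ::
  "('r, 'rx) ring_scheme \<Rightarrow> ('r, 'm, 'mx) right_module_scheme \<Rightarrow> ('r, 'a, 'n, 'nx) bimodule_scheme
    \<Rightarrow> ('m0 \<Rightarrow> 'm) \<Rightarrow> ('n0 \<Rightarrow> 'n) \<Rightarrow> ('m0, 'n0) tensor \<Rightarrow> ('m, 'n) tensor" where
  "tensor_map R M N f g = tensor_lift (tensor_group R M N) (\<lambda>(m, n). tens R M N (f m) (g n))"

definition tensor_right ::
  "('r, 'rx) ring_scheme \<Rightarrow> ('r, 'm, 'mx) right_module_scheme \<Rightarrow> ('r, 'a, 'n, 'nx) bimodule_scheme
    \<Rightarrow> ('a, ('m, 'n) tensor) right_module" where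
  "tensor_right R M N = ring.extend (tensor_group R M N)
     (right_module.fields (\<lambda>X a. tensor_map R M N (\<lambda>m. m) (\<lambda>n. n \<triangleleft>\<^bsub>N\<^esub> a) X))"

definition tensor ::
  "('r, 'rx) ring_scheme \<Rightarrow> ('b, 'r, 'm, 'mx) bimodule_scheme \<Rightarrow> ('r, 'a, 'n, 'nx) bimodule_scheme
    \<Rightarrow> ('b, 'a, ('m, 'n) tensor) bimodule" where
  "tensor R M N = right_module.extend (tensor_right R M N)
     (bimodule.fields (\<lambda>b. tensor_map R M N (\<lambda>m. b \<triangleright>\<^bsub>M\<^esub> m) (\<lambda>n. n)))"

text \<open>\<open>L \<otimes>\<^sub>R (M \<otimes>\<^sub>S N) \<rightarrow> (L \<otimes>\<^sub>R M) \<otimes>\<^sub>S N\<close>\<close>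

definition tensor_assoc ::
  "('r, 'rx) ring_scheme \<Rightarrow> ('s, 'sx) ring_scheme \<Rightarrow> ('r, 'l, 'lx) right_module_scheme
    \<Rightarrow> ('r, 's, 'm, 'mx) bimodule_scheme \<Rightarrow> ('s, 'a, 'n, 'nx) bimodule_scheme
    \<Rightarrow> ('l, ('m, 'n) tensor) tensor \<Rightarrow> (('l, 'm) tensor, 'n) tensor" where
  "tensor_assoc R S L M N =
     (let LM = tensor_right R L M; P = tensor_group S LM N
      in tensor_lift P (\<lambda>(l, Y). tensor_lift P (\<lambda>(m, n). tens S LM N (tens R L M l m) n) Y))"

text \<open>\<open>A \<otimes>\<^sub>A M \<rightarrow> M\<close> and \<open>M \<otimes>\<^sub>A A \<rightarrow> M\<close>\<close>

definition left_unit :: "('a, 'b, 'm, 'mx) bimodule_scheme \<Rightarrow> ('a, 'm) tensor \<Rightarrow> 'm" where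
  "left_unit M = tensor_lift M (\<lambda>(a, m). a \<triangleright>\<^bsub>M\<^esub> m)"

definition right_unit :: "('a, 'm, 'mx) right_module_scheme \<Rightarrow> ('m, 'a) tensor \<Rightarrow> 'm" where
  "right_unit M = tensor_lift M (\<lambda>(m, a). m \<triangleleft>\<^bsub>M\<^esub> a)"


section \<open>Corings and comodules\<close>

record ('a, 'c) coring = "('a, 'a, 'c) bimodule" +
  comult :: "'c \<Rightarrow> ('c, 'c) tensor"
  counit :: "'c \<Rightarrow> 'a"

locale coring = bimodule K A A C
  for K (structure) and A (structure) and C (structure) +
  assumes comult_hom: "comult C \<in> bimodule_hom A A C (tensor A C C)"
    and counit_hom: "counit C \<in> bimodule_hom A A C (regular_bimodule A)"
    and coassoc: "c \<in> carrier C \<Longrightarrow>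
      tensor_map A (tensor A C C) C (comult C) (\<lambda>x. x) (comult C c) =
      tensor_assoc A A C C C (tensor_map A C (tensor A C C) (\<lambda>x. x) (comult C) (comult C c))"
    and counit_left: "c \<in> carrier C \<Longrightarrow>
      left_unit C (tensor_map A (regular_bimodule A) C (counit C) (\<lambda>x. x) (comult C c)) = c"
    and counit_right: "c \<in> carrier C \<Longrightarrow>
      right_unit C (tensor_map A C (regular_bimodule A) (\<lambda>x. x) (counit C) (comult C c)) = c"

locale coring_hom = C?: coring K A C + D?: coring K A D
  for K (structure) and A (structure) and C (structure) and D (structure) +
  fixes h
  assumes hom: "h \<in> bimodule_hom A A C D"
    and comult_comp: "c \<in> carrier C \<Longrightarrow> comult D (h c) = tensor_map A D D h h (comult C c)"
    and counit_comp: "c \<in> carrier C \<Longrightarrow> counit D (h c) = counit C c"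

record ('a, 'c, 'm) comodule = "('a, 'm) right_module" +
  coaction :: "'m \<Rightarrow> ('m, 'c) tensor"

locale right_comodule = C?: coring K A C + right_module A M
  for K (structure) and A (structure) and C (structure) and M (structure) +
  assumes coaction_hom: "coaction M \<in> right_hom A M (tensor_right A M C)"
    and coaction_coassoc: "m \<in> carrier M \<Longrightarrow>
      tensor_assoc A A M C C (tensor_map A M (tensor A C C) (\<lambda>x. x) (comult C) (coaction M m)) =
      tensor_map A (tensor_right A M C) C (coaction M) (\<lambda>x. x) (coaction M m)"
    and coaction_counit: "m \<in> carrier M \<Longrightarrow>
      right_unit M (tensor_map A M (regular_bimodule A) (\<lambda>x. x) (counit C) (coaction M m)) = m"

definition comodule_hom ::
  "('a, 'ax) ring_scheme \<Rightarrow> ('a, 'c, 'cx) coring_scheme \<Rightarrow> ('a, 'c, 'm, 'mx) comodule_scheme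
    \<Rightarrow> ('a, 'c, 'n, 'nx) comodule_scheme \<Rightarrow> ('m \<Rightarrow> 'n) set" where
  "comodule_hom A C M N = {f \<in> right_hom A M N.
     \<forall>m\<in>carrier M. tensor_map A N C f (\<lambda>x. x) (coaction M m) = coaction N (f m)}"

text \<open>Functions are normalized outside the carrier (by \<^const>\<open>extensional\<close>), so that equality of
  endomorphisms is equality of functions. The scalar \<open>k\<close> acts as right multiplication by
  \<open>k \<odot> \<one>\<close>, which is how \<open>K\<close> acts on a right \<open>A\<close>-module.\<close>

definition comodule_End ::
  "('k, 'a, 'ax) module_scheme \<Rightarrow> ('a, 'c, 'cx) coring_scheme \<Rightarrow> ('a, 'c, 'm, 'mx) comodule_scheme
    \<Rightarrow> ('k, 'm \<Rightarrow> 'm) module" where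
  "comodule_End A C M =
     \<lparr>carrier = comodule_hom A C M M \<inter> extensional (carrier M),
      monoid.mult = compose (carrier M),
      one = (\<lambda>u\<in>carrier M. u),
      ring.zero = (\<lambda>u\<in>carrier M. \<zero>\<^bsub>M\<^esub>),
      ring.add = (\<lambda>f g. \<lambda>u\<in>carrier M. f u \<oplus>\<^bsub>M\<^esub> g u),
      smult = (\<lambda>k f. \<lambda>u\<in>carrier M. f u \<triangleleft>\<^bsub>M\<^esub> (k \<odot>\<^bsub>A\<^esub> \<one>\<^bsub>A\<^esub>))\<rparr>"

text \<open>\<open>M\<close> as a bimodule over its endomorphisms, which act by evaluation\<close>

definition End_bimodule ::
  "('a, 'm, 'mx) right_module_scheme \<Rightarrow> ('m \<Rightarrow> 'm, 'a, 'm) bimodule" where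
  "End_bimodule M =
     right_module.extend (right_module.truncate M) (bimodule.fields (\<lambda>f u. f u))"


section \<open>The comatrix coring and the canonical map\<close>

definition dual_bimodule ::
  "('a, 'ax) ring_scheme \<Rightarrow> ('b, 'a, 'm, 'mx) bimodule_scheme \<Rightarrow> ('a, 'b, 'm \<Rightarrow> 'a) bimodule" where
  "dual_bimodule A M =
     \<lparr>carrier = right_hom A M (regular_bimodule A) \<inter> extensional (carrier M),
      monoid.mult = undefined, one = undefined,
      ring.zero = (\<lambda>u\<in>carrier M. \<zero>\<^bsub>A\<^esub>),
      ring.add = (\<lambda>\<phi> \<psi>. \<lambda>u\<in>carrier M. \<phi> u \<oplus>\<^bsub>A\<^esub> \<psi> u),
      rsmult = (\<lambda>\<phi> b. \<lambda>u\<in>carrier M. \<phi> (b \<triangleright>\<^bsub>M\<^esub> u)),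
      lsmult = (\<lambda>a \<phi>. \<lambda>u\<in>carrier M. a \<otimes>\<^bsub>A\<^esub> \<phi> u)\<rparr>"

definition dual_basis ::
  "('a, 'ax) ring_scheme \<Rightarrow> ('b, 'a, 'm, 'mx) bimodule_scheme
    \<Rightarrow> nat \<Rightarrow> (nat \<Rightarrow> 'm \<Rightarrow> 'a) \<Rightarrow> (nat \<Rightarrow> 'm) \<Rightarrow> bool" where
  "dual_basis A M n e' e \<longleftrightarrow>
     (\<forall>i<n. e' i \<in> carrier (dual_bimodule A M) \<and> e i \<in> carrier M) \<and>
     (\<forall>u\<in>carrier M. u = (\<Oplus>\<^bsub>M\<^esub>i\<in>{..<n}. e i \<triangleleft>\<^bsub>M\<^esub> e' i u))"

text \<open>The comatrix coring \<open>M\<^sup>* \<otimes>\<^sub>B M\<close>, with \<open>\<epsilon> (\<phi> \<otimes> u) = \<phi> u\<close> and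
  \<open>\<Delta> (\<phi> \<otimes> u) = \<Sum>\<^sub>i (\<phi> \<otimes> e i) \<otimes> (e' i \<otimes> u)\<close>\<close>

definition comatrix_counit ::
  "('a, 'ax) ring_scheme \<Rightarrow> ('m \<Rightarrow> 'a, 'm) tensor \<Rightarrow> 'a" where
  "comatrix_counit A = tensor_lift A (\<lambda>(\<phi>, u). \<phi> u)"

definition comatrix_comult ::
  "('b, 'bx) ring_scheme \<Rightarrow> ('a, 'ax) ring_scheme \<Rightarrow> ('b, 'a, 'm, 'mx) bimodule_scheme
    \<Rightarrow> nat \<Rightarrow> (nat \<Rightarrow> 'm \<Rightarrow> 'a) \<Rightarrow> (nat \<Rightarrow> 'm) \<Rightarrow> ('m \<Rightarrow> 'a, 'm) tensor
    \<Rightarrow> (('m \<Rightarrow> 'a, 'm) tensor, ('m \<Rightarrow> 'a, 'm) tensor) tensor" where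
  "comatrix_comult B A M n e' e =
     (let M' = dual_bimodule A M; D = tensor B M' M; P = tensor_group A D D
      in tensor_lift P (\<lambda>(\<phi>, u).
           \<Oplus>\<^bsub>P\<^esub>i\<in>{..<n}. tens A D D (tens B M' M \<phi> (e i)) (tens B M' M (e' i) u)))"

definition comatrix_coring ::
  "('b, 'bx) ring_scheme \<Rightarrow> ('a, 'ax) ring_scheme \<Rightarrow> ('b, 'a, 'm, 'mx) bimodule_scheme
    \<Rightarrow> nat \<Rightarrow> (nat \<Rightarrow> 'm \<Rightarrow> 'a) \<Rightarrow> (nat \<Rightarrow> 'm) \<Rightarrow> ('a, ('m \<Rightarrow> 'a, 'm) tensor) coring" where
  "comatrix_coring B A M n e' e = bimodule.extend (tensor B (dual_bimodule A M) M)
     (coring.fields (comatrix_comult B A M n e' e) (comatrix_counit A))"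

definition can ::
  "('k, 'a, 'ax) module_scheme \<Rightarrow> ('a, 'c, 'cx) coring_scheme \<Rightarrow> ('a, 'c, 'm, 'mx) comodule_scheme
    \<Rightarrow> ('m \<Rightarrow> 'a, 'm) tensor \<Rightarrow> 'c" where
  "can A C M =
     (let T = comodule_End A C M; M\<^sub>T = End_bimodule M; M' = dual_bimodule A M\<^sub>T
      in left_unit C
         \<circ> tensor_map A (regular_bimodule A) C (comatrix_counit A) (\<lambda>x. x)
         \<circ> tensor_assoc T A M' M\<^sub>T C
         \<circ> tensor_map T M' (tensor A M\<^sub>T C) (\<lambda>x. x) (coaction M))"

end

theory Submission
  imports Defs
begin

text \<open>For \<open>\<phi> \<in> \<Sigma>\<^sup>*\<close> let \<open>slice \<phi> : \<Sigma> \<otimes>\<^sub>A C \<rightarrow> C\<close> be the map \<open>m \<otimes> c \<mapsto> \<phi> m \<triangleright> c\<close>. Then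
  \<open>can (\<phi> \<otimes> u) = slice \<phi> (\<rho> u)\<close>. Compatibility with the counits is the counit axiom of \<open>\<Sigma>\<close> with \<open>\<phi>\<close>
  applied to it. For the comultiplications, left linearity of \<open>\<Delta>\<close> and coassociativity of \<open>\<rho>\<close> give
  \<open>\<Delta> (slice \<phi> (\<rho> u)) = (slice \<phi> \<rho> \<otimes> C) (\<rho> u)\<close>, and inserting the dual basis expansion
  \<open>m = \<Sum>\<^sub>i e i \<triangleleft> e' i m\<close> into \<open>slice \<phi> (\<rho> m) \<otimes> c\<close> and moving the scalars \<open>e' i m\<close> to the right
  turns this into \<open>\<Sum>\<^sub>i slice \<phi> (\<rho> (e i)) \<otimes> slice (e' i) (\<rho> u)\<close>. Throughout, additive maps on a tensor
  product are compared on pure tensors. The dual basis itself comes from lifting the identity of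
  \<open>\<Sigma>\<close> along a surjection from a finite free module.\<close>

text \<open>Every map in the statement is a \<open>tensor_lift\<close>, that is,
  \<open>the_elem\<close> of the image of a coset, and it carries no information until the map
  underneath is known to be balanced. So each map is first shown to be balanced; afterwards only its
  additivity and its values on pure tensors are used. The conclusion \<open>coring_hom\<close> also
  demands that its source be a coring, hence \<open>T\<close> must be a \<open>K\<close>-algebra,
  \<open>\<Sigma>\<close> and its dual must be bimodules over it, and the comatrix axioms must be
  verified. Two balance conditions carry mathematical content. The comultiplication is balanced over
  the base ring because the dual basis expands both \<open>b e i\<close> and \<open>e' j b\<close>
  with the same coefficients. The map
  \<open>\<phi> \<otimes> u \<mapsto> \<phi> \<otimes> \<rho> u\<close> is well defined over
  \<open>T\<close> because elements of \<open>T\<close> commute with the coaction. As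
  \<open>\<rho> u\<close> is in general not a pure tensor, identities about it are proved for an
  arbitrary \<open>Y\<close> in \<open>\<Sigma> \<otimes> C\<close> and specialized to
  \<open>\<rho> u\<close> at the end.\<close>

definition additive :: "('m, 'mx) ring_scheme \<Rightarrow> ('n, 'nx) ring_scheme \<Rightarrow> ('m \<Rightarrow> 'n) set" where
  "additive M N = {f \<in> carrier M \<rightarrow> carrier N.
     \<forall>x\<in>carrier M. \<forall>y\<in>carrier M. f (x \<oplus>\<^bsub>M\<^esub> y) = f x \<oplus>\<^bsub>N\<^esub> f y}"

lemma additiveI:
  assumes "\<And>x. x \<in> carrier M \<Longrightarrow> f x \<in> carrier N"
    and "\<And>x y. \<lbrakk>x \<in> carrier M; y \<in> carrier M\<rbrakk> \<Longrightarrow> f (x \<oplus>\<^bsub>M\<^esub> y) = f x \<oplus>\<^bsub>N\<^esub> f y"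
  shows "f \<in> additive M N"
  using assms by (auto simp: additive_def)

lemma additive_closed: "\<lbrakk>f \<in> additive M N; x \<in> carrier M\<rbrakk> \<Longrightarrow> f x \<in> carrier N"
  by (auto simp: additive_def)

lemma additive_add:
  "\<lbrakk>f \<in> additive M N; x \<in> carrier M; y \<in> carrier M\<rbrakk> \<Longrightarrow> f (x \<oplus>\<^bsub>M\<^esub> y) = f x \<oplus>\<^bsub>N\<^esub> f y"
  by (auto simp: additive_def)

lemma additive_id: "(\<lambda>x. x) \<in> additive M M"
  by (auto simp: additive_def)

lemma additive_compose: "\<lbrakk>f \<in> additive M N; g \<in> additive N P\<rbrakk> \<Longrightarrow> (\<lambda>x. g (f x)) \<in> additive M P"
  by (auto simp: additive_def Pi_iff)

lemma additive_zero:
  assumes "abelian_group M" "abelian_group N" "f \<in> additive M N"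
  shows "f \<zero>\<^bsub>M\<^esub> = \<zero>\<^bsub>N\<^esub>"
proof -
  interpret M: abelian_group M by fact
  interpret N: abelian_group N by fact
  have c: "f \<zero>\<^bsub>M\<^esub> \<in> carrier N" using assms by (auto simp: additive_def)
  have "f (\<zero>\<^bsub>M\<^esub> \<oplus>\<^bsub>M\<^esub> \<zero>\<^bsub>M\<^esub>) = f \<zero>\<^bsub>M\<^esub> \<oplus>\<^bsub>N\<^esub> f \<zero>\<^bsub>M\<^esub>"
    using assms(3) by (rule additive_add) auto
  with c show ?thesis by simp
qed

lemma additive_finsum:
  assumes "abelian_group M" "abelian_group N" "f \<in> additive M N" "finite I"
    and "\<And>i. i \<in> I \<Longrightarrow> x i \<in> carrier M"
  shows "f (\<Oplus>\<^bsub>M\<^esub>i\<in>I. x i) = (\<Oplus>\<^bsub>N\<^esub>i\<in>I. f (x i))"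
proof -
  interpret M: abelian_group M by fact
  interpret N: abelian_group N by fact
  show ?thesis
    using assms(4,5)
  proof (induction I rule: finite_induct)
    case empty
    then show ?case by (simp add: additive_zero[OF assms(1-3)])
  next
    case (insert i I)
    have c: "finsum M x I \<in> carrier M" "x i \<in> carrier M"
      using insert by (auto intro!: M.finsum_closed)
    have "finsum M x (insert i I) = x i \<oplus>\<^bsub>M\<^esub> finsum M x I"
      using insert by (intro M.finsum_insert) auto
    then have "f (finsum M x (insert i I)) = f (x i) \<oplus>\<^bsub>N\<^esub> f (finsum M x I)"
      using additive_add[OF assms(3) c(2,1)] by simp
    also have "f (finsum M x I) = (\<Oplus>\<^bsub>N\<^esub>i\<in>I. f (x i))"
      using insert by blast
    also have "f (x i) \<oplus>\<^bsub>N\<^esub> (\<Oplus>\<^bsub>N\<^esub>i\<in>I. f (x i)) = (\<Oplus>\<^bsub>N\<^esub>i\<in>insert i I. f (x i))"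
      using insert by (subst N.finsum_insert) (auto intro: additive_closed[OF assms(3)])
    finally show ?case .
  qed
qed

section \<open>One-sided modules, linear maps and balanced maps\<close>

locale left_module = R?: ring R + N?: abelian_group N
  for R (structure) and N :: "('r, 'a, 'n, 'nx) bimodule_scheme" (structure) +
  assumes lsmult_closed: "\<lbrakk>b \<in> carrier R; m \<in> carrier N\<rbrakk> \<Longrightarrow> b \<triangleright>\<^bsub>N\<^esub> m \<in> carrier N"
    and lsmult_r_distr: "\<lbrakk>b \<in> carrier R; m \<in> carrier N; n \<in> carrier N\<rbrakk>
      \<Longrightarrow> b \<triangleright>\<^bsub>N\<^esub> (m \<oplus>\<^bsub>N\<^esub> n) = (b \<triangleright>\<^bsub>N\<^esub> m) \<oplus>\<^bsub>N\<^esub> (b \<triangleright>\<^bsub>N\<^esub> n)"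
    and lsmult_l_distr: "\<lbrakk>b \<in> carrier R; c \<in> carrier R; m \<in> carrier N\<rbrakk>
      \<Longrightarrow> (b \<oplus>\<^bsub>R\<^esub> c) \<triangleright>\<^bsub>N\<^esub> m = (b \<triangleright>\<^bsub>N\<^esub> m) \<oplus>\<^bsub>N\<^esub> (c \<triangleright>\<^bsub>N\<^esub> m)"
    and lsmult_assoc: "\<lbrakk>b \<in> carrier R; c \<in> carrier R; m \<in> carrier N\<rbrakk>
      \<Longrightarrow> (b \<otimes>\<^bsub>R\<^esub> c) \<triangleright>\<^bsub>N\<^esub> m = b \<triangleright>\<^bsub>N\<^esub> (c \<triangleright>\<^bsub>N\<^esub> m)"
    and lsmult_one: "m \<in> carrier N \<Longrightarrow> \<one>\<^bsub>R\<^esub> \<triangleright>\<^bsub>N\<^esub> m = m"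

lemma bimodule_left_module: "bimodule K B A M \<Longrightarrow> left_module B M"
  by (simp add: bimodule_def bimodule_axioms_def left_module_def left_module_axioms_def
      assoc_algebra_def right_module_def)

lemma bimodule_right_module: "bimodule K B A M \<Longrightarrow> right_module A M"
  by (simp add: bimodule_def)

definition left_hom ::
  "('b, 'bx) ring_scheme \<Rightarrow> ('b, 'a, 'm, 'mx) bimodule_scheme \<Rightarrow> ('b, 'a2, 'n, 'nx) bimodule_scheme
    \<Rightarrow> ('m \<Rightarrow> 'n) set" where
  "left_hom B M N = {f \<in> additive M N. \<forall>b\<in>carrier B. \<forall>x\<in>carrier M. f (b \<triangleright>\<^bsub>M\<^esub> x) = b \<triangleright>\<^bsub>N\<^esub> f x}"

lemma right_hom_eq:
  "right_hom A M N = {f \<in> additive M N. \<forall>x\<in>carrier M. \<forall>a\<in>carrier A. f (x \<triangleleft>\<^bsub>M\<^esub> a) = f x \<triangleleft>\<^bsub>N\<^esub> a}"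
  by (auto simp: right_hom_def additive_def)

lemma bimodule_hom_eq: "bimodule_hom B A M N = right_hom A M N \<inter> left_hom B M N"
  by (auto simp: bimodule_hom_def left_hom_def right_hom_eq)

lemma right_hom_id: "(\<lambda>x. x) \<in> right_hom A M M"
  by (auto simp: right_hom_def)

lemma left_hom_id: "(\<lambda>x. x) \<in> left_hom A M M"
  by (auto simp: left_hom_def additive_def)

lemma right_hom_additive: "f \<in> right_hom A M N \<Longrightarrow> f \<in> additive M N"
  by (auto simp: right_hom_eq)

lemma left_hom_additive: "f \<in> left_hom A M N \<Longrightarrow> f \<in> additive M N"
  by (auto simp: left_hom_def)

lemma right_hom_smult: "\<lbrakk>f \<in> right_hom A M N; x \<in> carrier M; a \<in> carrier A\<rbrakk> \<Longrightarrow> f (x \<triangleleft>\<^bsub>M\<^esub> a) = f x \<triangleleft>\<^bsub>N\<^esub> a"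
  by (auto simp: right_hom_eq)

lemma left_hom_smult: "\<lbrakk>f \<in> left_hom B M N; x \<in> carrier M; b \<in> carrier B\<rbrakk> \<Longrightarrow> f (b \<triangleright>\<^bsub>M\<^esub> x) = b \<triangleright>\<^bsub>N\<^esub> f x"
  by (auto simp: left_hom_def)

definition balanced ::
  "('r, 'rx) ring_scheme \<Rightarrow> ('r, 'm, 'mx) right_module_scheme \<Rightarrow> ('r, 'a, 'n, 'nx) bimodule_scheme
    \<Rightarrow> ('p, 'px) ring_scheme \<Rightarrow> ('m \<times> 'n \<Rightarrow> 'p) \<Rightarrow> bool" where
  "balanced R M N P \<beta> \<longleftrightarrow>
     (\<forall>n\<in>carrier N. (\<lambda>m. \<beta> (m, n)) \<in> additive M P) \<and>
     (\<forall>m\<in>carrier M. (\<lambda>n. \<beta> (m, n)) \<in> additive N P) \<and>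
     (\<forall>m\<in>carrier M. \<forall>r\<in>carrier R. \<forall>n\<in>carrier N. \<beta> (m \<triangleleft>\<^bsub>M\<^esub> r, n) = \<beta> (m, r \<triangleright>\<^bsub>N\<^esub> n))"

lemma balancedI:
  assumes "\<And>m n. \<lbrakk>m \<in> carrier M; n \<in> carrier N\<rbrakk> \<Longrightarrow> \<beta> (m, n) \<in> carrier P"
    and "\<And>m m' n. \<lbrakk>m \<in> carrier M; m' \<in> carrier M; n \<in> carrier N\<rbrakk> \<Longrightarrow> \<beta> (m \<oplus>\<^bsub>M\<^esub> m', n) = \<beta> (m, n) \<oplus>\<^bsub>P\<^esub> \<beta> (m', n)"
    and "\<And>m n n'. \<lbrakk>m \<in> carrier M; n \<in> carrier N; n' \<in> carrier N\<rbrakk> \<Longrightarrow> \<beta> (m, n \<oplus>\<^bsub>N\<^esub> n') = \<beta> (m, n) \<oplus>\<^bsub>P\<^esub> \<beta> (m, n')"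
    and "\<And>m r n. \<lbrakk>m \<in> carrier M; r \<in> carrier R; n \<in> carrier N\<rbrakk> \<Longrightarrow> \<beta> (m \<triangleleft>\<^bsub>M\<^esub> r, n) = \<beta> (m, r \<triangleright>\<^bsub>N\<^esub> n)"
  shows "balanced R M N P \<beta>"
  using assms by (auto simp: balanced_def additive_def)

section \<open>Tensor products\<close>

text \<open>The extension of \<open>\<beta>\<close> to the free abelian group.
  \<open>tensor_lift\<close> is its common value on a coset; naming it allows reasoning about single
  representatives.\<close>

definition frag_eval :: "('p, 'px) ring_scheme \<Rightarrow> ('i \<Rightarrow> 'p) \<Rightarrow> ('i \<Rightarrow>\<^sub>0 int) \<Rightarrow> 'p" where
  "frag_eval P \<beta> c = (\<Oplus>\<^bsub>P\<^esub>p\<in>Poly_Mapping.keys c. [Poly_Mapping.lookup c p] \<cdot>\<^bsub>P\<^esub> \<beta> p)"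

context abelian_group
begin

text \<open>Coefficients outside the support vanish, so any larger finite index set serves. This
  lets elements with different supports be summed over one set, even when their sum has a smaller
  support through cancellation.\<close>

lemma frag_eval_superset:
  assumes "finite S" "Poly_Mapping.keys c \<subseteq> S" "\<beta> \<in> S \<rightarrow> carrier G"
  shows "frag_eval G \<beta> c = (\<Oplus>\<^bsub>G\<^esub>p\<in>S. [Poly_Mapping.lookup c p] \<cdot>\<^bsub>G\<^esub> \<beta> p)"
  unfolding frag_eval_def using assms
  by (intro add.finprod_mono_neutral_cong_left) (auto simp: in_keys_iff add_pow_def intro: add.int_pow_closed[unfolded add_pow_def])

lemma frag_eval_add:
  assumes "Poly_Mapping.keys c \<subseteq> S" "Poly_Mapping.keys d \<subseteq> S" "\<beta> \<in> S \<rightarrow> carrier G"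
  shows "frag_eval G \<beta> (c + d) = frag_eval G \<beta> c \<oplus> frag_eval G \<beta> d"
proof -
  let ?K = "Poly_Mapping.keys c \<union> Poly_Mapping.keys d"
  have K: "finite ?K" "\<beta> \<in> ?K \<rightarrow> carrier G" using assms by auto
  have "frag_eval G \<beta> (c + d) = (\<Oplus>\<^bsub>G\<^esub>p\<in>?K. [Poly_Mapping.lookup (c + d) p] \<cdot>\<^bsub>G\<^esub> \<beta> p)"
    by (rule frag_eval_superset[OF K(1) keys_add K(2)])
  also have "\<dots> = (\<Oplus>\<^bsub>G\<^esub>p\<in>?K. [Poly_Mapping.lookup c p] \<cdot>\<^bsub>G\<^esub> \<beta> p \<oplus> [Poly_Mapping.lookup d p] \<cdot>\<^bsub>G\<^esub> \<beta> p)"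
    using K(2) by (intro finsum_cong') (auto simp: lookup_add add.int_pow_mult Pi_iff)
  also have "\<dots> = frag_eval G \<beta> c \<oplus> frag_eval G \<beta> d"
    using K by (subst finsum_addf) (auto simp: frag_eval_superset[of ?K] Pi_iff)
  finally show ?thesis .
qed

lemma frag_eval_hom:
  assumes "\<beta> \<in> S \<rightarrow> carrier G"
  shows "frag_eval G \<beta> \<in> hom (free_Abelian_group S) (add_monoid G)"
proof (rule homI)
  fix c assume "c \<in> carrier (free_Abelian_group S)"
  then show "frag_eval G \<beta> c \<in> carrier (add_monoid G)"
    using assms by (auto simp: frag_eval_def Pi_iff subset_iff intro!: finsum_closed)
next
  fix c d assume "c \<in> carrier (free_Abelian_group S)" "d \<in> carrier (free_Abelian_group S)"
  then show "frag_eval G \<beta> (c \<otimes>\<^bsub>free_Abelian_group S\<^esub> d)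
    = frag_eval G \<beta> c \<otimes>\<^bsub>add_monoid G\<^esub> frag_eval G \<beta> d"
    using assms by (simp add: frag_eval_add)
qed

lemma frag_eval_of: "\<beta> p \<in> carrier G \<Longrightarrow> frag_eval G \<beta> (frag_of p) = \<beta> p"
  by (simp add: frag_eval_def keys_frag_of Pi_iff)

end

text \<open>The least structure on which the tensor product depends: a right action on the left
  factor and a left action on the right factor. Bimodules enter by forgetting the outer
  actions.\<close>

locale tensor_pair = right_module R M + left_module R N
  for R (structure) and M (structure) and N (structure)
begin

abbreviation "F \<equiv> free_Abelian_group (carrier M \<times> carrier N)"
abbreviation "Z \<equiv> tensor_null R M N"

lemma tensor_relations_closed: "tensor_relations R M N \<subseteq> carrier F"
  unfolding tensor_relations_def
  by (auto simp: rsmult_closed lsmult_closed keys_frag_of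
      dest!: subsetD[OF keys_diff])

lemma normal_tensor_null: "Z \<lhd> F"
  using comm_group.subgroup_imp_normal[OF abelian_free_Abelian_group]
    group.generate_is_subgroup[OF group_free_Abelian_group tensor_relations_closed]
  by (simp add: tensor_null_def)

sublocale null: normal Z F by (rule normal_tensor_null)

lemma abelian_group_tensor: "abelian_group (tensor_group R M N)"
proof -
  have *: "comm_group (F Mod Z)"
    using comm_group.abelian_FactGroup[OF abelian_free_Abelian_group normal_imp_subgroup[OF normal_tensor_null]] .
  interpret Q: comm_group "F Mod Z" by (rule *)
  show ?thesis
    unfolding tensor_group_def Let_def
    by (rule abelian_groupI)
      (simp_all add: Q.m_assoc Q.l_inv_ex Q.m_comm Q.m_lcomm del: mult_FactGroup one_FactGroup)
qed

lemma carrier_tensor: "carrier (tensor_group R M N) = {Z #>\<^bsub>F\<^esub> c | c. c \<in> carrier F}"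
  by (auto simp: tensor_group_def carrier_FactGroup)

lemma add_tensor:
  assumes "c \<in> carrier F" "d \<in> carrier F"
  shows "(Z #>\<^bsub>F\<^esub> c) \<oplus>\<^bsub>tensor_group R M N\<^esub> (Z #>\<^bsub>F\<^esub> d) = Z #>\<^bsub>F\<^esub> (c + d)"
  using null.rcos_sum[OF assms] by (simp add: tensor_group_def)

lemma coset_eq:
  assumes "c \<in> carrier F" "d \<in> carrier F" "c - d \<in> Z"
  shows "Z #>\<^bsub>F\<^esub> c = Z #>\<^bsub>F\<^esub> d"
proof -
  have "c = (c - d) \<otimes>\<^bsub>F\<^esub> d" by simp
  then have "c \<in> Z #>\<^bsub>F\<^esub> d" using assms(3) unfolding r_coset_def by blast
  with assms show ?thesis
    using group.repr_independence[OF group_free_Abelian_group _ _ null.subgroup_axioms] by metis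
qed

lemma tens_closed:
  "\<lbrakk>m \<in> carrier M; n \<in> carrier N\<rbrakk> \<Longrightarrow> tens R M N m n \<in> carrier (tensor_group R M N)"
  unfolding carrier_tensor tens_def by (auto simp: keys_frag_of intro!: exI[of _ "frag_of (m, n)"])

lemma relation_null: "x \<in> tensor_relations R M N \<Longrightarrow> x \<in> Z"
  unfolding tensor_null_def by (rule generate.incl)

lemma tens_add_left:
  assumes "m \<in> carrier M" "m' \<in> carrier M" "n \<in> carrier N"
  shows "tens R M N (m \<oplus>\<^bsub>M\<^esub> m') n = tens R M N m n \<oplus>\<^bsub>tensor_group R M N\<^esub> tens R M N m' n"
proof -
  have "frag_of (m \<oplus>\<^bsub>M\<^esub> m', n) - (frag_of (m, n) + frag_of (m', n)) \<in> Z"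
    by (rule relation_null) (use assms in \<open>auto simp: tensor_relations_def diff_diff_eq[symmetric]\<close>)
  then show ?thesis
    using assms keys_add[of "frag_of (m, n)" "frag_of (m', n)"]
    unfolding tens_def by (subst add_tensor) (simp_all add: keys_frag_of, intro coset_eq, auto simp: keys_frag_of)
qed

lemma tens_add_right:
  assumes "m \<in> carrier M" "n \<in> carrier N" "n' \<in> carrier N"
  shows "tens R M N m (n \<oplus>\<^bsub>N\<^esub> n') = tens R M N m n \<oplus>\<^bsub>tensor_group R M N\<^esub> tens R M N m n'"
proof -
  have "frag_of (m, n \<oplus>\<^bsub>N\<^esub> n') - (frag_of (m, n) + frag_of (m, n')) \<in> Z"
    by (rule relation_null) (use assms in \<open>auto simp: tensor_relations_def diff_diff_eq[symmetric]\<close>)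
  then show ?thesis
    using assms keys_add[of "frag_of (m, n)" "frag_of (m, n')"]
    unfolding tens_def by (subst add_tensor) (simp_all add: keys_frag_of, intro coset_eq, auto simp: keys_frag_of)
qed

lemma tens_smult:
  assumes "m \<in> carrier M" "r \<in> carrier R" "n \<in> carrier N"
  shows "tens R M N (m \<triangleleft>\<^bsub>M\<^esub> r) n = tens R M N m (r \<triangleright>\<^bsub>N\<^esub> n)"
proof -
  have "frag_of (m \<triangleleft>\<^bsub>M\<^esub> r, n) - frag_of (m, r \<triangleright>\<^bsub>N\<^esub> n) \<in> Z"
    by (rule relation_null) (use assms in \<open>auto simp: tensor_relations_def\<close>)
  then show ?thesis
    using assms rsmult_closed lsmult_closed
    unfolding tens_def by (intro coset_eq) (auto simp: keys_frag_of)
qed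

text \<open>The use of \<open>the_elem\<close> is legitimate because the image of a coset is a
  singleton: the homomorphism \<open>frag_eval P \<beta>\<close> kills the defining relations by
  balance, so its kernel contains the subgroup they generate.\<close>

lemma tensor_lift_coset:
  assumes P: "abelian_group P" and \<beta>: "balanced R M N P \<beta>" and c: "c \<in> carrier F"
  shows "tensor_lift P \<beta> (Z #>\<^bsub>F\<^esub> c) = frag_eval P \<beta> c"
proof -
  interpret P: abelian_group P by fact
  have \<beta>S: "\<beta> \<in> carrier M \<times> carrier N \<rightarrow> carrier P"
    using \<beta> by (auto simp: balanced_def additive_def Pi_iff)
  interpret h: group_hom F "add_monoid P" "frag_eval P \<beta>"
    using P.frag_eval_hom[OF \<beta>S] P.a_group by (simp add: group_hom_def group_hom_axioms_def)
  have ev: "frag_eval P \<beta> (frag_of (m, n)) = \<beta> (m, n)" if "m \<in> carrier M" "n \<in> carrier N" for m n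
    by (rule P.frag_eval_of) (use \<beta>S that in auto)
  have diff: "frag_eval P \<beta> (a - b) = frag_eval P \<beta> a \<ominus>\<^bsub>P\<^esub> frag_eval P \<beta> b"
    if "a \<in> carrier F" "b \<in> carrier F" for a b
  proof -
    have ab: "a \<in> carrier F" "inv\<^bsub>F\<^esub> b \<in> carrier F" using that by auto
    have "a - b = a \<otimes>\<^bsub>F\<^esub> inv\<^bsub>F\<^esub> b" using that by simp
    then have "frag_eval P \<beta> (a - b) = frag_eval P \<beta> (a \<otimes>\<^bsub>F\<^esub> inv\<^bsub>F\<^esub> b)" by (rule arg_cong)
    also have "\<dots> = frag_eval P \<beta> a \<oplus>\<^bsub>P\<^esub> frag_eval P \<beta> (inv\<^bsub>F\<^esub> b)"
      using h.hom_mult[OF ab] unfolding monoid.simps .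
    also have "frag_eval P \<beta> (inv\<^bsub>F\<^esub> b) = \<ominus>\<^bsub>P\<^esub> frag_eval P \<beta> b"
      unfolding a_inv_def by (rule h.hom_inv[OF that(2)])
    finally show ?thesis unfolding a_minus_def .
  qed
  have rel: "frag_eval P \<beta> x = \<zero>\<^bsub>P\<^esub>" if "x \<in> tensor_relations R M N" for x
  proof -
    have cl: "\<beta> (m, n) \<in> carrier P" if "m \<in> carrier M" "n \<in> carrier N" for m n
      using \<beta>S that by auto
    have d3: "frag_eval P \<beta> (frag_of p - frag_of q - frag_of r) = (\<beta> p \<ominus>\<^bsub>P\<^esub> \<beta> q) \<ominus>\<^bsub>P\<^esub> \<beta> r"
      if "p \<in> carrier M \<times> carrier N" "q \<in> carrier M \<times> carrier N" "r \<in> carrier M \<times> carrier N" for p q r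
    proof -
      have "frag_of p - frag_of q \<in> carrier F"
        using that keys_diff[of "frag_of p" "frag_of q"] by (auto simp: keys_frag_of)
      then show ?thesis using that by (auto simp: diff keys_frag_of ev)
    qed
    have cancel: "((x \<oplus>\<^bsub>P\<^esub> y) \<ominus>\<^bsub>P\<^esub> x) \<ominus>\<^bsub>P\<^esub> y = \<zero>\<^bsub>P\<^esub>" if "x \<in> carrier P" "y \<in> carrier P" for x y
    proof -
      have "(x \<oplus>\<^bsub>P\<^esub> y) \<ominus>\<^bsub>P\<^esub> x = y"
        using that by (metis P.a_comm P.add.inv_solve_right' P.a_closed P.minus_eq)
      then show ?thesis using that by (simp add: P.minus_eq P.r_neg)
    qed
    from that consider
        (l) m m' n where "x = frag_of (m \<oplus>\<^bsub>M\<^esub> m', n) - frag_of (m, n) - frag_of (m', n)"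
          "m \<in> carrier M" "m' \<in> carrier M" "n \<in> carrier N"
      | (r) m n n' where "x = frag_of (m, n \<oplus>\<^bsub>N\<^esub> n') - frag_of (m, n) - frag_of (m, n')"
          "m \<in> carrier M" "n \<in> carrier N" "n' \<in> carrier N"
      | (b) m r n where "x = frag_of (m \<triangleleft>\<^bsub>M\<^esub> r, n) - frag_of (m, r \<triangleright>\<^bsub>N\<^esub> n)"
          "m \<in> carrier M" "r \<in> carrier R" "n \<in> carrier N"
      unfolding tensor_relations_def by blast
    then show ?thesis
    proof cases
      case l
      then have "\<beta> (m \<oplus>\<^bsub>M\<^esub> m', n) = \<beta> (m, n) \<oplus>\<^bsub>P\<^esub> \<beta> (m', n)"
        using \<beta> by (auto simp: balanced_def additive_def)
      with l show ?thesis by (simp add: d3 cancel cl)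
    next
      case r
      then have "\<beta> (m, n \<oplus>\<^bsub>N\<^esub> n') = \<beta> (m, n) \<oplus>\<^bsub>P\<^esub> \<beta> (m, n')"
        using \<beta> by (auto simp: balanced_def additive_def)
      with r show ?thesis by (simp add: d3 cancel cl)
    next
      case b
      then have "\<beta> (m \<triangleleft>\<^bsub>M\<^esub> r, n) = \<beta> (m, r \<triangleright>\<^bsub>N\<^esub> n)"
        using \<beta> by (auto simp: balanced_def)
      with b show ?thesis
        by (simp add: diff keys_frag_of ev rsmult_closed lsmult_closed cl P.minus_eq P.r_neg)
    qed
  qed
  have vanish: "frag_eval P \<beta> z = \<zero>\<^bsub>P\<^esub>" if "z \<in> Z" for z
  proof -
    have "tensor_relations R M N \<subseteq> kernel F (add_monoid P) (frag_eval P \<beta>)"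
    proof
      fix x assume x: "x \<in> tensor_relations R M N"
      show "x \<in> kernel F (add_monoid P) (frag_eval P \<beta>)"
        using subsetD[OF tensor_relations_closed x] rel[OF x] unfolding kernel_def by simp
    qed
    then have "Z \<subseteq> kernel F (add_monoid P) (frag_eval P \<beta>)"
      unfolding tensor_null_def
      by (rule group.generate_subgroup_incl[OF group_free_Abelian_group _ h.subgroup_kernel])
    from subsetD[OF this that] show ?thesis by (simp add: kernel_def)
  qed
  have "frag_eval P \<beta> x = frag_eval P \<beta> c" if "x \<in> Z #>\<^bsub>F\<^esub> c" for x
  proof -
    from that obtain z where z: "z \<in> Z" "x = z \<otimes>\<^bsub>F\<^esub> c" unfolding r_coset_def by auto
    from z(1) have "z \<in> carrier F" by (rule null.mem_carrier)
    then show ?thesis using z c h.hom_mult[of z c] h.hom_closed[of c] vanish[of z]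
      by simp
  qed
  \<comment> \<open>Constancy alone would allow an empty image; a member of the coset makes it
    exactly a singleton.\<close>
  moreover have "c \<in> Z #>\<^bsub>F\<^esub> c" using c group.rcos_self[OF group_free_Abelian_group _ null.subgroup_axioms] by metis
  ultimately have "frag_eval P \<beta> ` (Z #>\<^bsub>F\<^esub> c) = {frag_eval P \<beta> c}" by blast
  then show ?thesis unfolding tensor_lift_def frag_eval_def[symmetric] by (simp add: frag_eval_def)
qed

lemma tensor_lift_tens:
  assumes "abelian_group P" "balanced R M N P \<beta>" "m \<in> carrier M" "n \<in> carrier N"
  shows "tensor_lift P \<beta> (tens R M N m n) = \<beta> (m, n)"
proof -
  have "\<beta> (m, n) \<in> carrier P" using assms by (auto simp: balanced_def additive_def Pi_iff)
  then show ?thesis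
    unfolding tens_def using assms
    by (subst tensor_lift_coset) (auto simp: keys_frag_of abelian_group.frag_eval_of)
qed

lemma tensor_lift_additive:
  assumes "abelian_group P" "balanced R M N P \<beta>"
  shows "tensor_lift P \<beta> \<in> additive (tensor_group R M N) P"
proof -
  interpret P: abelian_group P by fact
  have "\<beta> \<in> carrier M \<times> carrier N \<rightarrow> carrier P"
    using assms by (auto simp: balanced_def additive_def Pi_iff)
  from P.frag_eval_hom[OF this] have h: "frag_eval P \<beta> c \<in> carrier P"
    "frag_eval P \<beta> (c + d) = frag_eval P \<beta> c \<oplus>\<^bsub>P\<^esub> frag_eval P \<beta> d"
    if "c \<in> carrier F" "d \<in> carrier F" for c d
    using that unfolding hom_def by auto
  show ?thesis
  proof (rule additiveI)
    fix x assume "x \<in> carrier (tensor_group R M N)"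
    then show "tensor_lift P \<beta> x \<in> carrier P"
      using h unfolding carrier_tensor by (auto simp: tensor_lift_coset[OF assms])
  next
    fix x y assume "x \<in> carrier (tensor_group R M N)" "y \<in> carrier (tensor_group R M N)"
    then obtain c d where cd: "c \<in> carrier F" "x = Z #>\<^bsub>F\<^esub> c" "d \<in> carrier F" "y = Z #>\<^bsub>F\<^esub> d"
      unfolding carrier_tensor by blast
    moreover from this have "c + d \<in> carrier F" using keys_add[of c d] by auto
    ultimately show "tensor_lift P \<beta> (x \<oplus>\<^bsub>tensor_group R M N\<^esub> y) = tensor_lift P \<beta> x \<oplus>\<^bsub>P\<^esub> tensor_lift P \<beta> y"
      using h by (simp only: add_tensor tensor_lift_coset[OF assms])
  qed
qed

text \<open>Uniqueness in the universal property, since pure tensors generate. Only additivity of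
  the two maps is asked for, so composites of tensor maps, actions and sums can be compared without
  checking any linearity.\<close>

lemma tensor_eqI:
  assumes P: "abelian_group P" and f: "f \<in> additive (tensor_group R M N) P"
    and g: "g \<in> additive (tensor_group R M N) P"
    and eq: "\<And>m n. \<lbrakk>m \<in> carrier M; n \<in> carrier N\<rbrakk> \<Longrightarrow> f (tens R M N m n) = g (tens R M N m n)"
    and X: "X \<in> carrier (tensor_group R M N)"
  shows "f X = g X"
proof -
  interpret P: abelian_group P by fact
  interpret T: abelian_group "tensor_group R M N" by (rule abelian_group_tensor)
  let ?q = "\<lambda>c. Z #>\<^bsub>F\<^esub> c"
  have main: "f (?q c) = g (?q c)" if c: "Poly_Mapping.keys c \<subseteq> carrier M \<times> carrier N" for c
  proof (rule free_Abelian_group_induct[OF c])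
    have "?q 0 = \<zero>\<^bsub>tensor_group R M N\<^esub>"
      using group.coset_mult_one[OF group_free_Abelian_group null.subset]
      by (simp add: tensor_group_def)
    then show "f (?q 0) = g (?q 0)"
      by (simp add: additive_zero[OF abelian_group_tensor P f] additive_zero[OF abelian_group_tensor P g])
  next
    fix x y
    assume 2: "Poly_Mapping.keys x \<subseteq> carrier M \<times> carrier N" "Poly_Mapping.keys y \<subseteq> carrier M \<times> carrier N"
      "f (?q x) = g (?q x)" "f (?q y) = g (?q y)"
    have c: "?q x \<in> carrier (tensor_group R M N)" "?q y \<in> carrier (tensor_group R M N)"
      "?q (x - y) \<in> carrier (tensor_group R M N)" "x - y \<in> carrier F"
      unfolding carrier_tensor using 2 keys_diff[of x y] by auto
    \<comment> \<open>The induction principle builds elements from differences, whereas additive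
      maps are known to preserve sums. Writing \<open>x\<close> as \<open>(x - y) + y\<close> lets
      the value at \<open>y\<close> be cancelled in \<open>P\<close>.\<close>
    have "?q x = ?q (x - y) \<oplus>\<^bsub>tensor_group R M N\<^esub> ?q y"
      using c 2 by (subst add_tensor) auto
    then have "f (?q (x - y)) \<oplus>\<^bsub>P\<^esub> f (?q y) = g (?q (x - y)) \<oplus>\<^bsub>P\<^esub> g (?q y)"
      using additive_add[OF f c(3,2)] additive_add[OF g c(3,2)] 2 by simp
    then show "f (?q (x - y)) = g (?q (x - y))" using 2 c additive_closed[OF f] additive_closed[OF g] by simp
  next
    fix a assume "a \<in> carrier M \<times> carrier N"
    then show "f (?q (frag_of a)) = g (?q (frag_of a))" using eq[of "fst a" "snd a"] by (auto simp: tens_def)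
  qed
  show ?thesis using X main unfolding carrier_tensor by auto
qed

end

lemma tensor_pairI: "\<lbrakk>right_module R M; left_module R N\<rbrakk> \<Longrightarrow> tensor_pair R M N"
  by (rule tensor_pair.intro)

section \<open>Change of record, and functoriality of the tensor product\<close>

lemma abelian_group_cong:
  assumes "abelian_group M" "carrier M' = carrier M" "ring.zero M' = ring.zero M" "ring.add M' = ring.add M"
  shows "abelian_group M'"
  using abelian_groupE[OF assms(1)] by (intro abelian_groupI) (auto simp: assms(2-4))

lemma right_module_cong:
  assumes "right_module A M" "carrier M' = carrier M" "ring.zero M' = ring.zero M"
    "ring.add M' = ring.add M" "rsmult M' = rsmult M"
  shows "right_module A M'"
  using assms abelian_group_cong[of M M']
  by (simp add: right_module_def right_module_axioms_def)

lemma bimodule_cong: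
  assumes "bimodule K B A M" "carrier M' = carrier M" "ring.zero M' = ring.zero M"
    "ring.add M' = ring.add M" "rsmult M' = rsmult M" "lsmult M' = lsmult M"
  shows "bimodule K B A M'"
  using assms right_module_cong[of A M M']
  by (simp add: bimodule_def bimodule_axioms_def)

lemma tensor_right_simps [simp]:
  "carrier (tensor_right R M N) = carrier (tensor_group R M N)"
  "ring.zero (tensor_right R M N) = ring.zero (tensor_group R M N)"
  "ring.add (tensor_right R M N) = ring.add (tensor_group R M N)"
  "X \<triangleleft>\<^bsub>tensor_right R M N\<^esub> a = tensor_map R M N (\<lambda>m. m) (\<lambda>n. n \<triangleleft>\<^bsub>N\<^esub> a) X"
  by (simp_all add: tensor_right_def ring.extend_def right_module.fields_def)

lemma tensor_simps [simp]:
  "carrier (tensor R M N) = carrier (tensor_group R M N)"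
  "ring.zero (tensor R M N) = ring.zero (tensor_group R M N)"
  "ring.add (tensor R M N) = ring.add (tensor_group R M N)"
  "X \<triangleleft>\<^bsub>tensor R M N\<^esub> a = tensor_map R M N (\<lambda>m. m) (\<lambda>n. n \<triangleleft>\<^bsub>N\<^esub> a) X"
  "b \<triangleright>\<^bsub>tensor R M N\<^esub> X = tensor_map R M N (\<lambda>m. b \<triangleright>\<^bsub>M\<^esub> m) (\<lambda>n. n) X"
  by (simp_all add: tensor_def right_module.extend_def bimodule.fields_def)

text \<open>The defining relations mention only the carriers, the additions and the two inner
  actions. Hence replacing \<open>tensor\<close> by \<open>tensor_right\<close>, or attaching coring
  fields, leaves the cosets literally equal.\<close>

lemma tens_cong:
  assumes "carrier M' = carrier M" "ring.add M' = ring.add M" "rsmult M' = rsmult M"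
    and "carrier N' = carrier N" "ring.add N' = ring.add N" "lsmult N' = lsmult N"
  shows "tens R M' N' = tens R M N" "tensor_group R M' N' = tensor_group R M N"
proof -
  have "tensor_relations R M' N' = tensor_relations R M N"
    unfolding tensor_relations_def by (simp add: assms)
  then have "tensor_null R M' N' = tensor_null R M N"
    unfolding tensor_null_def by (simp add: assms)
  then show "tens R M' N' = tens R M N" "tensor_group R M' N' = tensor_group R M N"
    by (simp_all add: tens_def tensor_group_def assms fun_eq_iff)
qed

lemma tens_tensor_left [simp]:
  "tens S (tensor R L M) N = tens S (tensor_right R L M) N"
  "tensor_group S (tensor R L M) N = tensor_group S (tensor_right R L M) N"
  by (rule tens_cong; simp add: fun_eq_iff)+

lemma additive_cong:
  assumes "carrier M' = carrier M" "ring.add M' = ring.add M" "carrier P' = carrier P" "ring.add P' = ring.add P"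
  shows "additive M' P' = additive M P"
  by (simp add: additive_def assms)

lemma additive_tensor [simp]:
  "additive (tensor R M N) P = additive (tensor_group R M N) P"
  "additive P (tensor R M N) = additive P (tensor_group R M N)"
  by (rule additive_cong; simp)+

lemma additive_tensor_right [simp]:
  "additive (tensor_right R M N) P = additive (tensor_group R M N) P"
  "additive P (tensor_right R M N) = additive P (tensor_group R M N)"
  by (rule additive_cong; simp)+

lemma additive_plus:
  assumes "abelian_group P" "f \<in> additive M P" "g \<in> additive M P"
  shows "(\<lambda>x. f x \<oplus>\<^bsub>P\<^esub> g x) \<in> additive M P"
proof -
  interpret P: abelian_group P by fact
  show ?thesis
    using additive_closed[OF assms(2)] additive_closed[OF assms(3)]
    by (intro additiveI) (auto simp: additive_add[OF assms(2)] additive_add[OF assms(3)] P.a_ac)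
qed

lemma additive_finsum_pointwise:
  assumes "abelian_group P" "finite I" "\<And>i. i \<in> I \<Longrightarrow> f i \<in> additive M P"
  shows "(\<lambda>x. \<Oplus>\<^bsub>P\<^esub>i\<in>I. f i x) \<in> additive M P"
proof -
  interpret P: abelian_group P by fact
  show ?thesis
  proof (rule additiveI)
    fix x assume "x \<in> carrier M"
    then show "(\<Oplus>\<^bsub>P\<^esub>i\<in>I. f i x) \<in> carrier P"
      using additive_closed[OF assms(3)] by (auto intro!: P.finsum_closed)
  next
    fix x y assume xy: "x \<in> carrier M" "y \<in> carrier M"
    have "(\<Oplus>\<^bsub>P\<^esub>i\<in>I. f i (x \<oplus>\<^bsub>M\<^esub> y)) = (\<Oplus>\<^bsub>P\<^esub>i\<in>I. f i x \<oplus>\<^bsub>P\<^esub> f i y)"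
      using xy additive_closed[OF assms(3)]
      by (intro P.finsum_cong') (auto simp: additive_add[OF assms(3)])
    also have "\<dots> = (\<Oplus>\<^bsub>P\<^esub>i\<in>I. f i x) \<oplus>\<^bsub>P\<^esub> (\<Oplus>\<^bsub>P\<^esub>i\<in>I. f i y)"
      using xy additive_closed[OF assms(3)] by (intro P.finsum_addf) auto
    finally show "(\<Oplus>\<^bsub>P\<^esub>i\<in>I. f i (x \<oplus>\<^bsub>M\<^esub> y)) = \<dots>" .
  qed
qed

lemma (in right_module) rsmult_additive: "a \<in> carrier A \<Longrightarrow> (\<lambda>m. m \<triangleleft>\<^bsub>M\<^esub> a) \<in> additive M M"
  by (intro additiveI) (auto simp: rsmult_closed rsmult_l_distr)

lemma (in left_module) lsmult_additive: "a \<in> carrier R \<Longrightarrow> (\<lambda>m. a \<triangleright>\<^bsub>N\<^esub> m) \<in> additive N N"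
  by (intro additiveI) (auto simp: lsmult_closed lsmult_r_distr)

lemma (in tensor_pair) additive_tens_left: "n \<in> carrier N \<Longrightarrow> (\<lambda>m. tens R M N m n) \<in> additive M (tensor_group R M N)"
  by (intro additiveI) (auto simp: tens_closed tens_add_left)

lemma (in tensor_pair) additive_tens_right: "m \<in> carrier M \<Longrightarrow> tens R M N m \<in> additive N (tensor_group R M N)"
  by (intro additiveI) (auto simp: tens_closed tens_add_right)

lemma (in tensor_pair) tensor_map_balanced:
  assumes "tensor_pair R M' N'" "f \<in> right_hom R M M'" "g \<in> left_hom R N N'"
  shows "balanced R M N (tensor_group R M' N') (\<lambda>(m, n). tens R M' N' (f m) (g n))"
proof -
  interpret T: tensor_pair R M' N' by fact
  note f = right_hom_additive[OF assms(2)] and g = left_hom_additive[OF assms(3)]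
  note cl = additive_closed[OF f] additive_closed[OF g]
  show ?thesis
    by (rule balancedI)
      (simp_all add: cl T.tens_closed additive_add[OF f] additive_add[OF g] T.tens_add_left T.tens_add_right
        right_hom_smult[OF assms(2)] left_hom_smult[OF assms(3)] T.tens_smult)
qed

lemma (in tensor_pair) tensor_map_tens:
  assumes "tensor_pair R M' N'" "f \<in> right_hom R M M'" "g \<in> left_hom R N N'" "m \<in> carrier M" "n \<in> carrier N"
  shows "tensor_map R M' N' f g (tens R M N m n) = tens R M' N' (f m) (g n)"
  unfolding tensor_map_def
  using tensor_lift_tens[OF tensor_pair.abelian_group_tensor[OF assms(1)] tensor_map_balanced[OF assms(1-3)] assms(4,5)]
  by simp

lemma (in tensor_pair) tensor_map_additive:
  assumes "tensor_pair R M' N'" "f \<in> right_hom R M M'" "g \<in> left_hom R N N'"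
  shows "tensor_map R M' N' f g \<in> additive (tensor_group R M N) (tensor_group R M' N')"
  unfolding tensor_map_def
  by (rule tensor_lift_additive[OF tensor_pair.abelian_group_tensor[OF assms(1)] tensor_map_balanced[OF assms]])

text \<open>Because the two actions commute, acting on the second tensor factor from the right is a
  legitimate tensor map. This is what makes the right action on \<open>M \<otimes> N\<close> well
  defined; the next lemma does the same for the left action.\<close>

lemma bimodule_rsmult_left_hom:
  assumes "bimodule K B A M" "a \<in> carrier A"
  shows "(\<lambda>m. m \<triangleleft>\<^bsub>M\<^esub> a) \<in> left_hom B M M"
  using right_module.rsmult_additive[OF bimodule_right_module] assms
  by (auto simp: left_hom_def bimodule.lsmult_rsmult)

lemma bimodule_lsmult_right_hom:
  assumes "bimodule K B A M" "b \<in> carrier B"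
  shows "(\<lambda>m. b \<triangleright>\<^bsub>M\<^esub> m) \<in> right_hom A M M"
  using left_module.lsmult_additive[OF bimodule_left_module] assms
  by (auto simp: right_hom_eq bimodule.lsmult_rsmult)

section \<open>Module structures on tensor products\<close>

lemma tens_rsmult:
  assumes "right_module R M" "bimodule K R A N" "m \<in> carrier M" "n \<in> carrier N" "a \<in> carrier A"
  shows "tens R M N m n \<triangleleft>\<^bsub>tensor_right R M N\<^esub> a = tens R M N m (n \<triangleleft>\<^bsub>N\<^esub> a)"
  using tensor_pair.tensor_map_tens[OF _ _ right_hom_id bimodule_rsmult_left_hom[OF assms(2,5)]]
    tensor_pairI[OF assms(1) bimodule_left_module[OF assms(2)]] assms
  by simp

lemma tens_lsmult:
  assumes "bimodule K B R M" "left_module R N" "m \<in> carrier M" "n \<in> carrier N" "b \<in> carrier B"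
  shows "b \<triangleright>\<^bsub>tensor R M N\<^esub> tens R M N m n = tens R M N (b \<triangleright>\<^bsub>M\<^esub> m) n"
  using tensor_pair.tensor_map_tens[OF _ _ bimodule_lsmult_right_hom[OF assms(1,5)] left_hom_id]
    tensor_pairI[OF bimodule_right_module[OF assms(1)] assms(2)] assms
  by simp

text \<open>The left factor is asked to be a right module only, because in
  \<open>\<Sigma> \<otimes> C\<close> the comodule \<open>\<Sigma>\<close> comes without a left
  action.\<close>

lemma right_module_tensor_right:
  assumes "right_module R M" "bimodule K R A N"
  shows "right_module A (tensor_right R M N)"
proof -
  interpret N: bimodule K R A N by fact
  interpret T: tensor_pair R M N
    by (rule tensor_pairI[OF assms(1) bimodule_left_module[OF assms(2)]])
  let ?T = "tensor_right R M N"
  have ab: "abelian_group (tensor_group R M N)" by (rule T.abelian_group_tensor)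
  interpret G: abelian_group "tensor_group R M N" by (rule ab)
  have add: "(\<lambda>X. X \<triangleleft>\<^bsub>?T\<^esub> a) \<in> additive (tensor_group R M N) (tensor_group R M N)" if "a \<in> carrier A" for a
    using T.tensor_map_additive[OF T.tensor_pair_axioms right_hom_id bimodule_rsmult_left_hom[OF assms(2) that]]
    by simp
  note val = tens_rsmult[OF assms]
  show ?thesis
  proof (intro right_module.intro right_module_axioms.intro)
    show "ring A" by (rule N.A.ring_axioms)
    show "abelian_group ?T" by (rule abelian_group_cong[OF ab]) simp_all
  next
    fix X a assume "X \<in> carrier ?T" "a \<in> carrier A"
    then show "X \<triangleleft>\<^bsub>?T\<^esub> a \<in> carrier ?T" using additive_closed[OF add] by simp
  next
    fix X Y a assume "X \<in> carrier ?T" "Y \<in> carrier ?T" "a \<in> carrier A"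
    then show "(X \<oplus>\<^bsub>?T\<^esub> Y) \<triangleleft>\<^bsub>?T\<^esub> a = X \<triangleleft>\<^bsub>?T\<^esub> a \<oplus>\<^bsub>?T\<^esub> Y \<triangleleft>\<^bsub>?T\<^esub> a"
      using additive_add[OF add] by simp
  next
    fix X a b assume X: "X \<in> carrier ?T" and a: "a \<in> carrier A" "b \<in> carrier A"
    show "X \<triangleleft>\<^bsub>?T\<^esub> (a \<oplus>\<^bsub>A\<^esub> b) = X \<triangleleft>\<^bsub>?T\<^esub> a \<oplus>\<^bsub>?T\<^esub> X \<triangleleft>\<^bsub>?T\<^esub> b"
      unfolding tensor_right_simps(1,3)
      by (rule T.tensor_eqI[OF ab add additive_plus[OF ab add add]])
        (use a X in \<open>simp_all add: tensor_right_simps(1) val N.rsmult_r_distr T.tens_add_right N.rsmult_closed del: tensor_right_simps(2-)\<close>)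
    show "X \<triangleleft>\<^bsub>?T\<^esub> (a \<otimes>\<^bsub>A\<^esub> b) = (X \<triangleleft>\<^bsub>?T\<^esub> a) \<triangleleft>\<^bsub>?T\<^esub> b"
      unfolding tensor_right_simps(1,3)
      by (rule T.tensor_eqI[OF ab add additive_compose[OF add add]])
        (use a X in \<open>simp_all add: tensor_right_simps(1) val N.rsmult_assoc N.rsmult_closed del: tensor_right_simps(2-)\<close>)
  next
    fix X assume X: "X \<in> carrier ?T"
    show "X \<triangleleft>\<^bsub>?T\<^esub> \<one>\<^bsub>A\<^esub> = X"
      unfolding tensor_right_simps(1,3)
      by (rule T.tensor_eqI[OF ab add additive_id])
        (use X in \<open>simp_all add: tensor_right_simps(1) val N.rsmult_one del: tensor_right_simps(2-)\<close>)
  qed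
qed

lemma assoc_algebra_scalar_closed:
  assumes "assoc_algebra K A" "k \<in> carrier K"
  shows "k \<odot>\<^bsub>A\<^esub> \<one>\<^bsub>A\<^esub> \<in> carrier A"
proof -
  interpret assoc_algebra K A by fact
  show ?thesis using assms(2) by (intro smult_closed) auto
qed

lemma bimodule_tensor:
  assumes "bimodule K B R M" "bimodule K R A N"
  shows "bimodule K B A (tensor R M N)"
proof -
  interpret M: bimodule K B R M by fact
  interpret N: bimodule K R A N by fact
  interpret T: tensor_pair R M N
    by (rule tensor_pairI[OF bimodule_right_module[OF assms(1)] bimodule_left_module[OF assms(2)]])
  let ?T = "tensor R M N"
  have ab: "abelian_group (tensor_group R M N)" by (rule T.abelian_group_tensor)
  have radd: "(\<lambda>X. X \<triangleleft>\<^bsub>?T\<^esub> a) \<in> additive (tensor_group R M N) (tensor_group R M N)" if "a \<in> carrier A" for a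
    using T.tensor_map_additive[OF T.tensor_pair_axioms right_hom_id bimodule_rsmult_left_hom[OF assms(2) that]]
    by simp
  have add: "(\<lambda>X. b \<triangleright>\<^bsub>?T\<^esub> X) \<in> additive (tensor_group R M N) (tensor_group R M N)" if "b \<in> carrier B" for b
    using T.tensor_map_additive[OF T.tensor_pair_axioms bimodule_lsmult_right_hom[OF assms(1) that] left_hom_id]
    by simp
  note val = tens_lsmult[OF assms(1) bimodule_left_module[OF assms(2)]]
  have rval: "tens R M N m n \<triangleleft>\<^bsub>?T\<^esub> a = tens R M N m (n \<triangleleft>\<^bsub>N\<^esub> a)"
    if "m \<in> carrier M" "n \<in> carrier N" "a \<in> carrier A" for m n a
    using tens_rsmult[OF bimodule_right_module[OF assms(1)] assms(2) that] by simp
  show ?thesis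
  proof (intro bimodule.intro bimodule_axioms.intro)
    show "assoc_algebra K B" "assoc_algebra K A" using assms by (simp_all add: bimodule_def)
    show "right_module A ?T"
      by (rule right_module_cong[OF right_module_tensor_right[OF bimodule_right_module[OF assms(1)] assms(2)]])
        (simp_all add: fun_eq_iff)
  next
    fix X b assume "b \<in> carrier B" "X \<in> carrier ?T"
    then show "b \<triangleright>\<^bsub>?T\<^esub> X \<in> carrier ?T" using additive_closed[OF add] by simp
  next
    fix X Y b assume "b \<in> carrier B" "X \<in> carrier ?T" "Y \<in> carrier ?T"
    then show "b \<triangleright>\<^bsub>?T\<^esub> (X \<oplus>\<^bsub>?T\<^esub> Y) = b \<triangleright>\<^bsub>?T\<^esub> X \<oplus>\<^bsub>?T\<^esub> b \<triangleright>\<^bsub>?T\<^esub> Y"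
      using additive_add[OF add] by simp
  next
    fix X b c assume b: "b \<in> carrier B" "c \<in> carrier B" and X: "X \<in> carrier ?T"
    show "(b \<oplus>\<^bsub>B\<^esub> c) \<triangleright>\<^bsub>?T\<^esub> X = b \<triangleright>\<^bsub>?T\<^esub> X \<oplus>\<^bsub>?T\<^esub> c \<triangleright>\<^bsub>?T\<^esub> X"
      unfolding tensor_simps(1,3)
      by (rule T.tensor_eqI[OF ab add additive_plus[OF ab add add]])
        (use b X in \<open>simp_all add: tensor_simps(1) val M.lsmult_l_distr T.tens_add_left M.lsmult_closed del: tensor_simps(2-)\<close>)
    show "(b \<otimes>\<^bsub>B\<^esub> c) \<triangleright>\<^bsub>?T\<^esub> X = b \<triangleright>\<^bsub>?T\<^esub> (c \<triangleright>\<^bsub>?T\<^esub> X)"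
      unfolding tensor_simps(1,3)
      by (rule T.tensor_eqI[OF ab add additive_compose[OF add add]])
        (use b X in \<open>simp_all add: tensor_simps(1) val M.lsmult_assoc M.lsmult_closed del: tensor_simps(2-)\<close>)
  next
    fix X assume X: "X \<in> carrier ?T"
    show "\<one>\<^bsub>B\<^esub> \<triangleright>\<^bsub>?T\<^esub> X = X"
      unfolding tensor_simps(1,3)
      by (rule T.tensor_eqI[OF ab add additive_id])
        (use X in \<open>simp_all add: tensor_simps(1) val M.lsmult_one del: tensor_simps(2-)\<close>)
  next
    fix X b a assume b: "b \<in> carrier B" "a \<in> carrier A" and X: "X \<in> carrier ?T"
    show "(b \<triangleright>\<^bsub>?T\<^esub> X) \<triangleleft>\<^bsub>?T\<^esub> a = b \<triangleright>\<^bsub>?T\<^esub> (X \<triangleleft>\<^bsub>?T\<^esub> a)"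
      unfolding tensor_simps(1,3)
      by (rule T.tensor_eqI[OF ab additive_compose[OF add radd] additive_compose[OF radd add]])
        (use b X in \<open>simp_all add: tensor_simps(1) val rval M.lsmult_closed N.rsmult_closed del: tensor_simps(2-)\<close>)
  next
    \<comment> \<open>The scalar \<open>k\<close> passes from the left of \<open>M\<close> to its
      right, then across the tensor sign as \<open>k \<odot> \<one>\<close> in \<open>R\<close>,
      then from the left of \<open>N\<close> to its right.\<close>
    fix X k assume k: "k \<in> carrier K" and X: "X \<in> carrier ?T"
    have kc: "k \<odot>\<^bsub>B\<^esub> \<one>\<^bsub>B\<^esub> \<in> carrier B" "k \<odot>\<^bsub>A\<^esub> \<one>\<^bsub>A\<^esub> \<in> carrier A" "k \<odot>\<^bsub>R\<^esub> \<one>\<^bsub>R\<^esub> \<in> carrier R"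
      using assms k by (auto simp: bimodule_def intro!: assoc_algebra_scalar_closed)
    show "(k \<odot>\<^bsub>B\<^esub> \<one>\<^bsub>B\<^esub>) \<triangleright>\<^bsub>?T\<^esub> X = X \<triangleleft>\<^bsub>?T\<^esub> (k \<odot>\<^bsub>A\<^esub> \<one>\<^bsub>A\<^esub>)"
      unfolding tensor_simps(1,3)
      by (rule T.tensor_eqI[OF ab add radd])
        (use kc k X in \<open>simp_all add: tensor_simps(1) val rval M.centralizes N.centralizes[symmetric] T.tens_smult del: tensor_simps(2-)\<close>)
  qed
qed

text \<open>Needed where two dual basis expansions meet: in the balance of the comultiplication and
  in coassociativity.\<close>

lemma (in abelian_monoid) finsum_swap:
  assumes "finite I" "finite J" "\<And>i j. \<lbrakk>i \<in> I; j \<in> J\<rbrakk> \<Longrightarrow> f i j \<in> carrier G"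
  shows "(\<Oplus>i\<in>I. \<Oplus>j\<in>J. f i j) = (\<Oplus>j\<in>J. \<Oplus>i\<in>I. f i j)"
  using assms(1,3)
proof (induction I rule: finite_induct)
  case empty
  then show ?case by (simp add: finsum_zero)
next
  case (insert i I)
  have "(\<Oplus>i\<in>insert i I. \<Oplus>j\<in>J. f i j) = (\<Oplus>j\<in>J. f i j) \<oplus> (\<Oplus>j\<in>J. \<Oplus>i\<in>I. f i j)"
    using insert by (subst finsum_insert) (auto intro!: finsum_closed)
  also have "\<dots> = (\<Oplus>j\<in>J. f i j \<oplus> (\<Oplus>i\<in>I. f i j))"
    using insert by (intro finsum_addf[symmetric]) (auto intro!: finsum_closed)
  also have "\<dots> = (\<Oplus>j\<in>J. \<Oplus>i\<in>insert i I. f i j)"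
    using insert by (intro finsum_cong') (auto simp: finsum_insert intro!: finsum_closed)
  finally show ?case .
qed

section \<open>The unit and associativity maps of the tensor product\<close>

lemma regular_bimodule_simps [simp]:
  "carrier (regular_bimodule A) = carrier A" "ring.zero (regular_bimodule A) = ring.zero A"
  "ring.add (regular_bimodule A) = ring.add A" "rsmult (regular_bimodule A) = monoid.mult A"
  "lsmult (regular_bimodule A) = monoid.mult A"
  by (simp_all add: regular_bimodule_def)

lemma right_module_regular:
  assumes "ring A"
  shows "right_module A (regular_bimodule A)"
proof -
  interpret ring A by fact
  have "abelian_group (regular_bimodule A)"
    by (rule abelian_group_cong[OF abelian_group_axioms]) simp_all
  then show ?thesis
    by (intro right_module.intro right_module_axioms.intro)
      (simp_all add: ring_axioms l_distr r_distr m_assoc)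
qed

lemma additive_regular [simp]:
  "additive (regular_bimodule A) P = additive A P" "additive P (regular_bimodule A) = additive P A"
  by (rule additive_cong; simp)+

context left_module
begin

lemma left_unit_pair: "tensor_pair R (regular_bimodule R) N"
  by (rule tensor_pairI[OF right_module_regular[OF R.ring_axioms] left_module_axioms])

lemma left_unit_balanced: "balanced R (regular_bimodule R) N N (\<lambda>(a, m). a \<triangleright>\<^bsub>N\<^esub> m)"
  by (rule balancedI) (simp_all add: lsmult_closed lsmult_l_distr lsmult_r_distr lsmult_assoc)

lemma left_unit_tens:
  "\<lbrakk>a \<in> carrier R; m \<in> carrier N\<rbrakk> \<Longrightarrow> left_unit N (tens R (regular_bimodule R) N a m) = a \<triangleright>\<^bsub>N\<^esub> m"
  unfolding left_unit_def
  by (subst tensor_pair.tensor_lift_tens[OF left_unit_pair N.abelian_group_axioms left_unit_balanced]) simp_all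

lemma left_unit_additive: "left_unit N \<in> additive (tensor_group R (regular_bimodule R) N) N"
  unfolding left_unit_def
  by (rule tensor_pair.tensor_lift_additive[OF left_unit_pair N.abelian_group_axioms left_unit_balanced])

end

lemma left_module_regular: "ring A \<Longrightarrow> left_module A (regular_bimodule A)"
  using right_module_regular[of A]
  by (simp add: left_module_def left_module_axioms_def right_module_def ring.ring_simprules monoid.l_one
      ring.is_monoid)

context right_module
begin

lemma right_unit_pair: "tensor_pair A M (regular_bimodule A)"
  by (rule tensor_pairI[OF right_module_axioms left_module_regular[OF A.ring_axioms]])

lemma right_unit_balanced: "balanced A M (regular_bimodule A) M (\<lambda>(m, a). m \<triangleleft>\<^bsub>M\<^esub> a)"
  by (rule balancedI) (simp_all add: rsmult_closed rsmult_l_distr rsmult_r_distr rsmult_assoc)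

lemma right_unit_tens:
  "\<lbrakk>m \<in> carrier M; a \<in> carrier A\<rbrakk> \<Longrightarrow> right_unit M (tens A M (regular_bimodule A) m a) = m \<triangleleft>\<^bsub>M\<^esub> a"
  unfolding right_unit_def
  by (subst tensor_pair.tensor_lift_tens[OF right_unit_pair M.abelian_group_axioms right_unit_balanced]) simp_all

lemma right_unit_additive: "right_unit M \<in> additive (tensor_group A M (regular_bimodule A)) M"
  unfolding right_unit_def
  by (rule tensor_pair.tensor_lift_additive[OF right_unit_pair M.abelian_group_axioms right_unit_balanced])

end

text \<open>\<open>L\<close> is only a right module so that a comodule may stand there, as the
  coassociativity of a coaction demands. The other instances put the comatrix coring or the dual of
  \<open>\<Sigma>\<close> in this place.\<close>

locale tensor_triple = L?: right_module R L + M?: bimodule K R S M + N?: bimodule K S A N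
  for K (structure) and R (structure) and S (structure) and A (structure)
    and L (structure) and M (structure) and N (structure)
begin

lemma pair_LM: "tensor_pair R L M"
  by (rule tensor_pairI[OF L.right_module_axioms bimodule_left_module[OF M.bimodule_axioms]])

lemma pair_MN: "tensor_pair S M N"
  by (rule tensor_pairI[OF M.right_module_axioms bimodule_left_module[OF N.bimodule_axioms]])

lemma bimodule_MN: "bimodule K R A (tensor S M N)"
  by (rule bimodule_tensor[OF M.bimodule_axioms N.bimodule_axioms])

lemma pair_L_MN: "tensor_pair R L (tensor S M N)"
  by (rule tensor_pairI[OF L.right_module_axioms bimodule_left_module[OF bimodule_MN]])

lemma right_module_LM: "right_module S (tensor_right R L M)"
  by (rule right_module_tensor_right[OF L.right_module_axioms M.bimodule_axioms])

lemma pair_LM_N: "tensor_pair S (tensor_right R L M) N"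
  by (rule tensor_pairI[OF right_module_LM bimodule_left_module[OF N.bimodule_axioms]])

interpretation LM: tensor_pair R L M by (rule pair_LM)
interpretation MN: tensor_pair S M N by (rule pair_MN)
interpretation L_MN: tensor_pair R L "tensor S M N" by (rule pair_L_MN)
interpretation LM_N: tensor_pair S "tensor_right R L M" N by (rule pair_LM_N)

abbreviation "P \<equiv> tensor_group S (tensor_right R L M) N"
abbreviation "inner l \<equiv> tensor_lift P (\<lambda>(m, n). tens S (tensor_right R L M) N (tens R L M l m) n)"

text \<open>Balance over \<open>S\<close> rests on
  \<open>l \<otimes> m r = (l \<otimes> m) r\<close>, the right action on
  \<open>L \<otimes> M\<close>, after which \<open>r\<close> crosses the outer tensor sign.\<close>

lemma inner_balanced:
  assumes "l \<in> carrier L"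
  shows "balanced S M N P (\<lambda>(m, n). tens S (tensor_right R L M) N (tens R L M l m) n)"
proof (rule balancedI, unfold case_prod_conv)
  fix m m' n assume "m \<in> carrier M" "m' \<in> carrier M" "n \<in> carrier N"
  then show "tens S (tensor_right R L M) N (tens R L M l (m \<oplus>\<^bsub>M\<^esub> m')) n =
       tens S (tensor_right R L M) N (tens R L M l m) n \<oplus>\<^bsub>P\<^esub> tens S (tensor_right R L M) N (tens R L M l m') n"
    using assms LM_N.tens_add_left by (simp add: LM.tens_add_right LM.tens_closed)
next
  fix m r n assume m: "m \<in> carrier M" "r \<in> carrier S" "n \<in> carrier N"
  show "tens S (tensor_right R L M) N (tens R L M l (m \<triangleleft>\<^bsub>M\<^esub> r)) n =
       tens S (tensor_right R L M) N (tens R L M l m) (r \<triangleright>\<^bsub>N\<^esub> n)"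
    using LM_N.tens_smult[OF _ m(2,3), of "tens R L M l m"] assms m
      tens_rsmult[OF L.right_module_axioms M.bimodule_axioms assms m(1,2)]
    by (simp add: LM.tens_closed del: tensor_right_simps(2-))
qed (use assms in \<open>simp_all add: LM.tens_closed LM_N.tens_closed LM_N.tens_add_right\<close>)

lemma inner_tens:
  "\<lbrakk>l \<in> carrier L; m \<in> carrier M; n \<in> carrier N\<rbrakk>
    \<Longrightarrow> inner l (tens S M N m n) = tens S (tensor_right R L M) N (tens R L M l m) n"
  by (subst MN.tensor_lift_tens[OF LM_N.abelian_group_tensor inner_balanced]) simp_all

lemma inner_additive: "l \<in> carrier L \<Longrightarrow> inner l \<in> additive (tensor_group S M N) P"
  by (rule MN.tensor_lift_additive[OF LM_N.abelian_group_tensor inner_balanced])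

text \<open>The associator is a lift whose bilinear map is itself a lift. Additivity and balance in
  \<open>l\<close> concern the inner lift at an arbitrary \<open>Y\<close>, so both sides are viewed
  as additive maps in \<open>Y\<close> and compared on pure tensors.\<close>

lemma outer_balanced: "balanced R L (tensor S M N) P (\<lambda>(l, Y). inner l Y)"
proof (rule balancedI, unfold case_prod_conv tensor_simps(1,3))
  fix l Y assume "l \<in> carrier L" "Y \<in> carrier (tensor_group S M N)"
  then show "inner l Y \<in> carrier P" by (rule additive_closed[OF inner_additive])
next
  fix l Y Y' assume "l \<in> carrier L" "Y \<in> carrier (tensor_group S M N)" "Y' \<in> carrier (tensor_group S M N)"
  then show "inner l (Y \<oplus>\<^bsub>tensor_group S M N\<^esub> Y') = inner l Y \<oplus>\<^bsub>P\<^esub> inner l Y'"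
    by (rule additive_add[OF inner_additive])
next
  fix l l' Y assume l: "l \<in> carrier L" "l' \<in> carrier L" and Y: "Y \<in> carrier (tensor_group S M N)"
  have ll: "l \<oplus>\<^bsub>L\<^esub> l' \<in> carrier L" using l by simp
  show "inner (l \<oplus>\<^bsub>L\<^esub> l') Y = inner l Y \<oplus>\<^bsub>P\<^esub> inner l' Y"
    by (rule MN.tensor_eqI[OF LM_N.abelian_group_tensor inner_additive[OF ll]
          additive_plus[OF LM_N.abelian_group_tensor inner_additive[OF l(1)] inner_additive[OF l(2)]] _ Y])
      (use l ll in \<open>simp only: inner_tens LM.tens_add_left LM_N.tens_add_left[unfolded tensor_right_simps] LM.tens_closed\<close>)
next
  fix l r Y assume l: "l \<in> carrier L" "r \<in> carrier R" and Y: "Y \<in> carrier (tensor_group S M N)"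
  have lr: "l \<triangleleft>\<^bsub>L\<^esub> r \<in> carrier L" using l by (simp add: L.rsmult_closed)
  have a: "(\<lambda>Y. r \<triangleright>\<^bsub>tensor S M N\<^esub> Y) \<in> additive (tensor_group S M N) (tensor_group S M N)"
    using left_module.lsmult_additive[OF bimodule_left_module[OF bimodule_MN] l(2)]
    by (simp del: tensor_simps)
  show "inner (l \<triangleleft>\<^bsub>L\<^esub> r) Y = inner l (r \<triangleright>\<^bsub>tensor S M N\<^esub> Y)"
    by (rule MN.tensor_eqI[OF LM_N.abelian_group_tensor inner_additive[OF lr]
          additive_compose[OF a inner_additive[OF l(1)]] _ Y])
      (use l lr in \<open>simp only: inner_tens LM.tens_smult M.lsmult_closed
         tens_lsmult[OF M.bimodule_axioms bimodule_left_module[OF N.bimodule_axioms]]\<close>)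
qed

lemma tensor_assoc_additive:
  "tensor_assoc R S L M N \<in> additive (tensor_group R L (tensor S M N)) P"
  unfolding tensor_assoc_def Let_def
  by (rule L_MN.tensor_lift_additive[OF LM_N.abelian_group_tensor outer_balanced])

lemma tensor_assoc_tens:
  assumes "l \<in> carrier L" "m \<in> carrier M" "n \<in> carrier N"
  shows "tensor_assoc R S L M N (tens R L (tensor S M N) l (tens S M N m n)) =
    tens S (tensor_right R L M) N (tens R L M l m) n"
  unfolding tensor_assoc_def Let_def
  using assms
  by (subst L_MN.tensor_lift_tens[OF LM_N.abelian_group_tensor outer_balanced])
    (simp_all add: MN.tens_closed inner_tens)

end

section \<open>Dual bimodules\<close>

lemma dual_bimodule_simps [simp]:
  "carrier (dual_bimodule A M) = right_hom A M (regular_bimodule A) \<inter> extensional (carrier M)"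
  "ring.zero (dual_bimodule A M) = (\<lambda>u\<in>carrier M. \<zero>\<^bsub>A\<^esub>)"
  "\<phi> \<oplus>\<^bsub>dual_bimodule A M\<^esub> \<psi> = (\<lambda>u\<in>carrier M. \<phi> u \<oplus>\<^bsub>A\<^esub> \<psi> u)"
  "\<phi> \<triangleleft>\<^bsub>dual_bimodule A M\<^esub> b = (\<lambda>u\<in>carrier M. \<phi> (b \<triangleright>\<^bsub>M\<^esub> u))"
  "a \<triangleright>\<^bsub>dual_bimodule A M\<^esub> \<phi> = (\<lambda>u\<in>carrier M. a \<otimes>\<^bsub>A\<^esub> \<phi> u)"
  by (simp_all add: dual_bimodule_def)

lemma dual_apply:
  assumes "\<phi> \<in> carrier (dual_bimodule A M)"
  shows "u \<in> carrier M \<Longrightarrow> \<phi> u \<in> carrier A"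
    and "\<lbrakk>u \<in> carrier M; v \<in> carrier M\<rbrakk> \<Longrightarrow> \<phi> (u \<oplus>\<^bsub>M\<^esub> v) = \<phi> u \<oplus>\<^bsub>A\<^esub> \<phi> v"
    and "\<lbrakk>u \<in> carrier M; a \<in> carrier A\<rbrakk> \<Longrightarrow> \<phi> (u \<triangleleft>\<^bsub>M\<^esub> a) = \<phi> u \<otimes>\<^bsub>A\<^esub> a"
  using assms by (auto simp: right_hom_def)

lemma dual_memI:
  assumes "\<And>u. u \<in> carrier M \<Longrightarrow> f u \<in> carrier A"
    and "\<And>u v. \<lbrakk>u \<in> carrier M; v \<in> carrier M; u \<oplus>\<^bsub>M\<^esub> v \<in> carrier M\<rbrakk> \<Longrightarrow> f (u \<oplus>\<^bsub>M\<^esub> v) = f u \<oplus>\<^bsub>A\<^esub> f v"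
    and "\<And>u a. \<lbrakk>u \<in> carrier M; a \<in> carrier A; u \<triangleleft>\<^bsub>M\<^esub> a \<in> carrier M\<rbrakk> \<Longrightarrow> f (u \<triangleleft>\<^bsub>M\<^esub> a) = f u \<otimes>\<^bsub>A\<^esub> a"
    and M: "right_module A M"
  shows "(\<lambda>u\<in>carrier M. f u) \<in> carrier (dual_bimodule A M)"
proof -
  interpret right_module A M by fact
  show ?thesis
    using assms(1-3) by (auto simp: right_hom_def rsmult_closed)
qed

lemma dual_eqI:
  assumes "\<phi> \<in> carrier (dual_bimodule A M)" "\<psi> \<in> carrier (dual_bimodule A M)"
    and "\<And>u. u \<in> carrier M \<Longrightarrow> \<phi> u = \<psi> u"
  shows "\<phi> = \<psi>"
  using assms by (auto intro: extensionalityI)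

text \<open>Used twice: for the dual bimodule to centralize \<open>K\<close>, and for a scalar
  multiple of an endomorphism to remain right linear.\<close>

lemma (in assoc_algebra) scalar_central:
  assumes "k \<in> carrier K" "a \<in> carrier A"
  shows "(k \<odot>\<^bsub>A\<^esub> \<one>\<^bsub>A\<^esub>) \<otimes>\<^bsub>A\<^esub> a = a \<otimes>\<^bsub>A\<^esub> (k \<odot>\<^bsub>A\<^esub> \<one>\<^bsub>A\<^esub>)"
  using assms by (simp add: smult_mult_left smult_mult_right)

text \<open>Functionals are normalized outside the carrier, so every law is checked pointwise on it.
  The law for \<open>K\<close> is the chain \<open>(k 1) \<phi>(u) = \<phi>(u) (k 1) = \<phi>(u (k
  1)) = \<phi>((k 1) u)\<close>, by centrality in \<open>A\<close>, linearity of
  \<open>\<phi>\<close> and the same law in \<open>M\<close>.\<close>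

lemma bimodule_dual:
  assumes "bimodule K B A M"
  shows "bimodule K A B (dual_bimodule A M)"
proof -
  have alg: "assoc_algebra K A" "assoc_algebra K B" using assms by (simp_all add: bimodule_def)
  interpret A: ring A using alg by (simp add: assoc_algebra_def)
  interpret B: ring B using alg by (simp add: assoc_algebra_def)
  interpret M: bimodule K B A M by fact
  let ?M' = "dual_bimodule A M"
  note simps = dual_bimodule_simps(2-)
  note app = dual_apply
  have add: "\<phi> \<oplus>\<^bsub>?M'\<^esub> \<psi> \<in> carrier ?M'" if "\<phi> \<in> carrier ?M'" "\<psi> \<in> carrier ?M'" for \<phi> \<psi>
    unfolding simps using app[OF that(1)] app[OF that(2)]
    by (intro dual_memI M.right_module_axioms) (simp_all add: A.a_ac A.l_distr)
  have zero: "\<zero>\<^bsub>?M'\<^esub> \<in> carrier ?M'"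
    unfolding simps by (intro dual_memI M.right_module_axioms) simp_all
  have l: "a \<triangleright>\<^bsub>?M'\<^esub> \<phi> \<in> carrier ?M'" if "a \<in> carrier A" "\<phi> \<in> carrier ?M'" for a \<phi>
    unfolding simps using app[OF that(2)] that(1)
    by (intro dual_memI M.right_module_axioms) (simp_all add: A.r_distr A.m_assoc)
  have r: "\<phi> \<triangleleft>\<^bsub>?M'\<^esub> b \<in> carrier ?M'" if "b \<in> carrier B" "\<phi> \<in> carrier ?M'" for b \<phi>
    unfolding simps using app[OF that(2)] that(1)
    by (intro dual_memI M.right_module_axioms)
      (simp_all add: M.lsmult_closed M.lsmult_r_distr M.lsmult_rsmult[symmetric])
  have neg: "(\<lambda>u\<in>carrier M. \<ominus>\<^bsub>A\<^esub> \<phi> u) \<in> carrier ?M'" if "\<phi> \<in> carrier ?M'" for \<phi>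
    using app[OF that]
    by (intro dual_memI M.right_module_axioms) (simp_all add: A.minus_add A.l_minus)
  note mem = add zero l r
  show ?thesis
  proof (intro bimodule.intro bimodule_axioms.intro right_module.intro right_module_axioms.intro alg)
    show "abelian_group ?M'"
    proof (rule abelian_groupI)
      fix \<phi> assume \<phi>: "\<phi> \<in> carrier ?M'"
      show "\<exists>\<psi>\<in>carrier ?M'. \<psi> \<oplus>\<^bsub>?M'\<^esub> \<phi> = \<zero>\<^bsub>?M'\<^esub>"
        using neg[OF \<phi>] app[OF \<phi>]
        by (intro bexI[OF _ neg[OF \<phi>]] ext) (simp add: A.l_neg restrict_def)
    qed (rule dual_eqI[of _ A M] | intro mem | assumption
        | (simp add: app A.a_ac del: dual_bimodule_simps(1); fail))+
  qed (rule dual_eqI[of _ A M] | intro mem | assumption | (rule B.ring_axioms)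
       | (simp add: app M.lsmult_closed M.lsmult_r_distr M.lsmult_l_distr M.lsmult_assoc M.lsmult_one
           A.l_distr A.r_distr A.m_assoc M.rsmult_closed assoc_algebra.scalar_central[OF alg(1)]
           M.centralizes assoc_algebra_scalar_closed[OF alg(1)] assoc_algebra_scalar_closed[OF alg(2)] del: dual_bimodule_simps(1); fail))+
qed

section \<open>The comatrix coring\<close>

lemma comatrix_coring_simps [simp]:
  "carrier (comatrix_coring B A M n e' e) = carrier (tensor_group B (dual_bimodule A M) M)"
  "ring.zero (comatrix_coring B A M n e' e) = ring.zero (tensor_group B (dual_bimodule A M) M)"
  "ring.add (comatrix_coring B A M n e' e) = ring.add (tensor_group B (dual_bimodule A M) M)"
  "rsmult (comatrix_coring B A M n e' e) = rsmult (tensor B (dual_bimodule A M) M)"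
  "lsmult (comatrix_coring B A M n e' e) = lsmult (tensor B (dual_bimodule A M) M)"
  "comult (comatrix_coring B A M n e' e) = comatrix_comult B A M n e' e"
  "counit (comatrix_coring B A M n e' e) = comatrix_counit A"
  by (simp_all add: comatrix_coring_def bimodule.extend_def coring.fields_def)

text \<open>The base ring \<open>B\<close> stays arbitrary: the coring axioms rest on the bimodule
  and its dual basis, and comodules appear only when \<open>B\<close> is later taken to be an
  endomorphism ring.\<close>

locale comatrix = M?: bimodule K B A M
  for K (structure) and B (structure) and A (structure) and M (structure) +
  fixes n :: nat and e' e
  assumes dual_basis: "dual_basis A M n e' e"
begin

abbreviation "M' \<equiv> dual_bimodule A M"
abbreviation "X \<equiv> comatrix_coring B A M n e' e"
abbreviation "t \<equiv> tens B M' M"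
abbreviation "tt \<equiv> tens A X X"

lemma alg_A: "assoc_algebra K A"
  using M.bimodule_axioms by (simp add: bimodule_def)

lemma bimodule_M': "bimodule K A B M'"
  by (rule bimodule_dual[OF M.bimodule_axioms])

lemma left_module_M: "left_module B M"
  by (rule bimodule_left_module[OF M.bimodule_axioms])

lemma bimodule_X: "bimodule K A A X"
  by (rule bimodule_cong[OF bimodule_tensor[OF bimodule_M' M.bimodule_axioms]]) simp_all

lemma pair_M'M: "tensor_pair B M' M"
  by (rule tensor_pairI[OF bimodule_right_module[OF bimodule_M'] left_module_M])

lemma pair_XX: "tensor_pair A X X"
  by (rule tensor_pairI[OF bimodule_right_module[OF bimodule_X] bimodule_left_module[OF bimodule_X]])

lemma triple_XXX: "tensor_triple K A A A X X X"
  by (intro tensor_triple.intro bimodule_right_module[OF bimodule_X] bimodule_X)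

interpretation M': bimodule K A B M' by (rule bimodule_M')
interpretation M'M: tensor_pair B M' M by (rule pair_M'M)
interpretation XX: tensor_pair A X X by (rule pair_XX)
interpretation XXX: tensor_triple K A A A X X X by (rule triple_XXX)
interpretation A: ring A using alg_A by (simp add: assoc_algebra_def)

lemma abelian_group_X: "abelian_group X"
  using bimodule_right_module[OF bimodule_X] by (simp add: right_module_def)

lemma abelian_group_A: "abelian_group A"
  by (rule A.is_abelian_group)

lemma dual_basis_closed: "i < n \<Longrightarrow> e' i \<in> carrier M'" "i < n \<Longrightarrow> e i \<in> carrier M"
  using dual_basis by (auto simp: dual_basis_def)

lemma expand: "u \<in> carrier M \<Longrightarrow> (\<Oplus>\<^bsub>M\<^esub>i\<in>{..<n}. e i \<triangleleft>\<^bsub>M\<^esub> e' i u) = u"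
  using dual_basis by (simp add: dual_basis_def)

lemma dual_closed: "\<lbrakk>\<phi> \<in> carrier M'; u \<in> carrier M\<rbrakk> \<Longrightarrow> \<phi> u \<in> carrier A"
  by (rule dual_apply)

lemma dual_lsmult_apply: "u \<in> carrier M \<Longrightarrow> (a \<triangleright>\<^bsub>M'\<^esub> \<phi>) u = a \<otimes>\<^bsub>A\<^esub> \<phi> u"
  by simp

lemma dual_rsmult_apply: "u \<in> carrier M \<Longrightarrow> (\<phi> \<triangleleft>\<^bsub>M'\<^esub> b) u = \<phi> (b \<triangleright>\<^bsub>M\<^esub> u)"
  by simp

lemma additive_dual: "\<phi> \<in> carrier M' \<Longrightarrow> \<phi> \<in> additive M A"
  by (rule additiveI) (simp_all add: dual_apply del: dual_bimodule_simps)

text \<open>Together with \<open>additive_finsum\<close> this evaluates finite sums of functionals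
  pointwise.\<close>

lemma additive_eval: "u \<in> carrier M \<Longrightarrow> (\<lambda>\<phi>. \<phi> u) \<in> additive M' A"
  by (intro additiveI) (auto simp: right_hom_def)

text \<open>The transposed dual basis identity: apply \<open>\<phi>\<close> to the expansion of
  \<open>u\<close> and use right linearity. It yields the left counit axiom and one half of the
  balance of the comultiplication.\<close>

lemma dual_expand:
  assumes \<phi>: "\<phi> \<in> carrier M'"
  shows "(\<Oplus>\<^bsub>M'\<^esub>i\<in>{..<n}. \<phi> (e i) \<triangleright>\<^bsub>M'\<^esub> e' i) = \<phi>"
proof (rule dual_eqI[OF _ \<phi>])
  have c: "\<phi> (e i) \<triangleright>\<^bsub>M'\<^esub> e' i \<in> carrier M'" if "i < n" for i
    using that \<phi> by (intro M'.lsmult_closed dual_closed dual_basis_closed)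
  show "(\<Oplus>\<^bsub>M'\<^esub>i\<in>{..<n}. \<phi> (e i) \<triangleright>\<^bsub>M'\<^esub> e' i) \<in> carrier M'"
    using c by (intro M'.finsum_closed) auto
  fix u assume u: "u \<in> carrier M"
  have "(\<Oplus>\<^bsub>M'\<^esub>i\<in>{..<n}. \<phi> (e i) \<triangleright>\<^bsub>M'\<^esub> e' i) u = (\<Oplus>\<^bsub>A\<^esub>i\<in>{..<n}. (\<phi> (e i) \<triangleright>\<^bsub>M'\<^esub> e' i) u)"
    using c by (intro additive_finsum[OF M'.abelian_group_axioms abelian_group_A additive_eval[OF u]]) auto
  also have "\<dots> = (\<Oplus>\<^bsub>A\<^esub>i\<in>{..<n}. \<phi> (e i \<triangleleft>\<^bsub>M\<^esub> e' i u))"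
    using u \<phi> dual_basis_closed
    by (intro abelian_monoid.finsum_cong'[OF abelian_group.axioms(1)[OF abelian_group_A]]) (auto simp: dual_closed dual_apply(3)[OF \<phi>] M.rsmult_closed simp del: dual_bimodule_simps(1))
  also have "\<dots> = \<phi> (\<Oplus>\<^bsub>M\<^esub>i\<in>{..<n}. e i \<triangleleft>\<^bsub>M\<^esub> e' i u)"
    using u dual_basis_closed
    by (intro additive_finsum[symmetric, OF M.abelian_group_axioms abelian_group_A additive_dual[OF \<phi>]])
      (auto intro!: M.rsmult_closed dual_closed simp del: dual_bimodule_simps(1))
  also have "\<dots> = \<phi> u" using u by (simp add: expand)
  finally show "(\<Oplus>\<^bsub>M'\<^esub>i\<in>{..<n}. \<phi> (e i) \<triangleright>\<^bsub>M'\<^esub> e' i) u = \<phi> u" .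
qed

text \<open>\<open>comatrix_comult\<close> is defined over the plain bimodule, before the coring
  fields are attached, while all reasoning here takes place over \<open>X\<close>.\<close>

lemma tens_DD: "tens A (tensor B M' M) (tensor B M' M) = tt"
  "tensor_group A (tensor B M' M) (tensor B M' M) = tensor_group A X X"
  by (rule tens_cong; simp)+

lemma t_closed: "\<lbrakk>\<phi> \<in> carrier M'; u \<in> carrier M\<rbrakk> \<Longrightarrow> t \<phi> u \<in> carrier X"
  using M'M.tens_closed by simp

lemma t_rsmult:
  "\<lbrakk>\<phi> \<in> carrier M'; u \<in> carrier M; a \<in> carrier A\<rbrakk> \<Longrightarrow> t \<phi> u \<triangleleft>\<^bsub>X\<^esub> a = t \<phi> (u \<triangleleft>\<^bsub>M\<^esub> a)"
  using tens_rsmult[OF bimodule_right_module[OF bimodule_M'] M.bimodule_axioms, of \<phi> u a]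
  by (simp del: dual_bimodule_simps)

lemma t_lsmult:
  "\<lbrakk>\<phi> \<in> carrier M'; u \<in> carrier M; a \<in> carrier A\<rbrakk> \<Longrightarrow> a \<triangleright>\<^bsub>X\<^esub> t \<phi> u = t (a \<triangleright>\<^bsub>M'\<^esub> \<phi>) u"
  using tens_lsmult[OF bimodule_M' left_module_M, of \<phi> u a] by (simp del: dual_bimodule_simps)

lemma additive_X:
  "additive X P = additive (tensor_group B M' M) P" "additive P X = additive P (tensor_group B M' M)"
  by (rule additive_cong; simp)+

lemma X_eqI:
  assumes "abelian_group P" "f \<in> additive X P" "g \<in> additive X P"
    and "\<And>\<phi> u. \<lbrakk>\<phi> \<in> carrier M'; u \<in> carrier M\<rbrakk> \<Longrightarrow> f (t \<phi> u) = g (t \<phi> u)" "x \<in> carrier X"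
  shows "f x = g x"
  using M'M.tensor_eqI[of P f g x] assms by (simp add: additive_X del: dual_bimodule_simps)

lemma additive_t_left: "u \<in> carrier M \<Longrightarrow> (\<lambda>\<phi>. t \<phi> u) \<in> additive M' X"
  using M'M.additive_tens_left by (simp add: additive_X)

lemma additive_t_right: "\<phi> \<in> carrier M' \<Longrightarrow> t \<phi> \<in> additive M X"
  using M'M.additive_tens_right by (simp add: additive_X del: dual_bimodule_simps)

lemma counit_balanced: "balanced B M' M A (\<lambda>(\<phi>, u). \<phi> u)"
  by (rule balancedI) (auto simp: right_hom_def)

lemma counit_tens: "\<lbrakk>\<phi> \<in> carrier M'; u \<in> carrier M\<rbrakk> \<Longrightarrow> comatrix_counit A (t \<phi> u) = \<phi> u"
  unfolding comatrix_counit_def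
  by (subst M'M.tensor_lift_tens[OF abelian_group_A counit_balanced]) (simp_all del: dual_bimodule_simps)

lemma counit_additive: "comatrix_counit A \<in> additive X A"
  unfolding comatrix_counit_def additive_X
  by (rule M'M.tensor_lift_additive[OF abelian_group_A counit_balanced])

lemma counit_right_hom: "comatrix_counit A \<in> right_hom A X (regular_bimodule A)"
proof -
  have "comatrix_counit A (x \<triangleleft>\<^bsub>X\<^esub> a) = comatrix_counit A x \<otimes>\<^bsub>A\<^esub> a"
    if x: "x \<in> carrier X" and a: "a \<in> carrier A" for x a
    by (rule X_eqI[OF abelian_group_A
          additive_compose[OF right_module.rsmult_additive[OF bimodule_right_module[OF bimodule_X] a] counit_additive]
          additive_compose[OF counit_additive] _ x])
      (use a in \<open>simp_all add: t_rsmult counit_tens dual_apply(3) M.rsmult_closed A.l_distr additiveI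
        del: dual_bimodule_simps comatrix_coring_simps\<close>)
  then show ?thesis using counit_additive by (simp add: right_hom_eq del: comatrix_coring_simps)
qed

lemma counit_left_hom: "comatrix_counit A \<in> left_hom A X (regular_bimodule A)"
proof -
  have "comatrix_counit A (a \<triangleright>\<^bsub>X\<^esub> x) = a \<otimes>\<^bsub>A\<^esub> comatrix_counit A x"
    if x: "x \<in> carrier X" and a: "a \<in> carrier A" for x a
    by (rule X_eqI[OF abelian_group_A
          additive_compose[OF left_module.lsmult_additive[OF bimodule_left_module[OF bimodule_X] a] counit_additive]
          additive_compose[OF counit_additive] _ x])
      (use a in \<open>simp_all add: t_lsmult counit_tens M'.lsmult_closed dual_lsmult_apply A.r_distr additiveI
        del: dual_bimodule_simps comatrix_coring_simps\<close>)
  then show ?thesis using counit_additive by (simp add: left_hom_def del: comatrix_coring_simps)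
qed

lemma comult_term_closed:
  "\<lbrakk>\<phi> \<in> carrier M'; u \<in> carrier M; i < n\<rbrakk> \<Longrightarrow> tt (t \<phi> (e i)) (t (e' i) u) \<in> carrier (tensor_group A X X)"
  by (intro XX.tens_closed t_closed dual_basis_closed)

text \<open>Both sides of the balance condition \<open>\<phi> b \<otimes> u = \<phi> \<otimes> b u\<close> equal
  \<open>\<Sum>\<^sub>i \<Sum>\<^sub>j (\<phi> \<otimes> e j) \<otimes> (e' j (b e i) e' i \<otimes> u)\<close>.\<close>

lemma comult_balanced:
  "balanced B M' M (tensor_group A X X) (\<lambda>(\<phi>, u). \<Oplus>\<^bsub>tensor_group A X X\<^esub>i\<in>{..<n}. tt (t \<phi> (e i)) (t (e' i) u))"
proof -
  let ?P = "tensor_group A X X"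
  interpret P: abelian_group ?P by (rule XX.abelian_group_tensor)
  note del = dual_bimodule_simps comatrix_coring_simps
  show ?thesis
  proof (rule balancedI, unfold case_prod_conv)
    fix \<phi> u assume "\<phi> \<in> carrier M'" "u \<in> carrier M"
    then show "(\<Oplus>\<^bsub>?P\<^esub>i\<in>{..<n}. tt (t \<phi> (e i)) (t (e' i) u)) \<in> carrier ?P"
      by (intro P.finsum_closed) (auto intro: comult_term_closed simp del: del)
  next
    fix \<phi> \<phi>' u assume \<phi>: "\<phi> \<in> carrier M'" "\<phi>' \<in> carrier M'" and u: "u \<in> carrier M"
    have "(\<lambda>\<phi>. \<Oplus>\<^bsub>?P\<^esub>i\<in>{..<n}. tt (t \<phi> (e i)) (t (e' i) u)) \<in> additive M' ?P"
      using u by (intro additive_finsum_pointwise P.abelian_group_axioms additive_compose[OF additive_t_left XX.additive_tens_left])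
        (auto intro: t_closed dual_basis_closed simp del: del)
    then show "(\<Oplus>\<^bsub>?P\<^esub>i\<in>{..<n}. tt (t (\<phi> \<oplus>\<^bsub>M'\<^esub> \<phi>') (e i)) (t (e' i) u)) =
        (\<Oplus>\<^bsub>?P\<^esub>i\<in>{..<n}. tt (t \<phi> (e i)) (t (e' i) u)) \<oplus>\<^bsub>?P\<^esub>
        (\<Oplus>\<^bsub>?P\<^esub>i\<in>{..<n}. tt (t \<phi>' (e i)) (t (e' i) u))"
      by (rule additive_add[OF _ \<phi>])
  next
    fix \<phi> u v assume \<phi>: "\<phi> \<in> carrier M'" and u: "u \<in> carrier M" "v \<in> carrier M"
    have "(\<lambda>u. \<Oplus>\<^bsub>?P\<^esub>i\<in>{..<n}. tt (t \<phi> (e i)) (t (e' i) u)) \<in> additive M ?P"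
      using \<phi> by (intro additive_finsum_pointwise P.abelian_group_axioms additive_compose[OF additive_t_right XX.additive_tens_right])
        (auto intro: t_closed dual_basis_closed simp del: del)
    then show "(\<Oplus>\<^bsub>?P\<^esub>i\<in>{..<n}. tt (t \<phi> (e i)) (t (e' i) (u \<oplus>\<^bsub>M\<^esub> v))) =
        (\<Oplus>\<^bsub>?P\<^esub>i\<in>{..<n}. tt (t \<phi> (e i)) (t (e' i) u)) \<oplus>\<^bsub>?P\<^esub>
        (\<Oplus>\<^bsub>?P\<^esub>i\<in>{..<n}. tt (t \<phi> (e i)) (t (e' i) v))"
      by (rule additive_add[OF _ u])
  next
    fix \<phi> b u assume \<phi>: "\<phi> \<in> carrier M'" and b: "b \<in> carrier B" and u: "u \<in> carrier M"
    \<comment> \<open>The matrix of \<open>b\<close> in the dual basis. The same entries expand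
      \<open>b e i\<close> over \<open>e j\<close> and \<open>e' j b\<close> over
      \<open>e' i\<close>, since \<open>(e' j b)(e i) = e' j (b e i)\<close>.\<close>
    let ?c = "\<lambda>j i. e' j (b \<triangleright>\<^bsub>M\<^esub> e i)"
    have be: "b \<triangleright>\<^bsub>M\<^esub> e i \<in> carrier M" if "i < n" for i
      using that b by (intro M.lsmult_closed dual_basis_closed)
    have c: "?c j i \<in> carrier A" if "i < n" "j < n" for i j
      using that by (intro dual_closed dual_basis_closed be)
    have e'b: "e' j \<triangleleft>\<^bsub>M'\<^esub> b \<in> carrier M'" if "j < n" for j
      using that b by (intro M'.rsmult_closed dual_basis_closed)
    have ce': "?c j i \<triangleright>\<^bsub>M'\<^esub> e' i \<in> carrier M'" if "i < n" "j < n" for i j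
      using that c by (intro M'.lsmult_closed dual_basis_closed)
    have ec: "e j \<triangleleft>\<^bsub>M\<^esub> ?c j i \<in> carrier M" if "i < n" "j < n" for i j
      using that c by (intro M.rsmult_closed dual_basis_closed)
    have tc: "tt (t \<phi> (e j)) (t (?c j i \<triangleright>\<^bsub>M'\<^esub> e' i) u) \<in> carrier ?P" if "i < n" "j < n" for i j
      using that by (intro XX.tens_closed t_closed dual_basis_closed \<phi> u ce')
    have 1: "tt (t (\<phi> \<triangleleft>\<^bsub>M'\<^esub> b) (e i)) (t (e' i) u) =
      (\<Oplus>\<^bsub>?P\<^esub>j\<in>{..<n}. tt (t \<phi> (e j)) (t (?c j i \<triangleright>\<^bsub>M'\<^esub> e' i) u))" if i: "i < n" for i
    proof -
      have "t (\<phi> \<triangleleft>\<^bsub>M'\<^esub> b) (e i) = t \<phi> (b \<triangleright>\<^bsub>M\<^esub> e i)"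
        by (rule M'M.tens_smult[OF \<phi> b dual_basis_closed(2)[OF i]])
      also have "\<dots> = t \<phi> (\<Oplus>\<^bsub>M\<^esub>j\<in>{..<n}. e j \<triangleleft>\<^bsub>M\<^esub> ?c j i)"
        by (simp only: expand[OF be[OF i]])
      finally have "tt (t (\<phi> \<triangleleft>\<^bsub>M'\<^esub> b) (e i)) (t (e' i) u) =
        (\<lambda>x. tt (t \<phi> x) (t (e' i) u)) (\<Oplus>\<^bsub>M\<^esub>j\<in>{..<n}. e j \<triangleleft>\<^bsub>M\<^esub> ?c j i)" by simp
      also have "\<dots> = (\<Oplus>\<^bsub>?P\<^esub>j\<in>{..<n}. tt (t \<phi> (e j \<triangleleft>\<^bsub>M\<^esub> ?c j i)) (t (e' i) u))"
        using i u ec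
        by (intro additive_finsum[where f = "\<lambda>x. tt (t \<phi> x) (t (e' i) u)"]
            M.abelian_group_axioms P.abelian_group_axioms
            additive_compose[OF additive_t_right[OF \<phi>] XX.additive_tens_left])
          (auto intro: t_closed dual_basis_closed simp del: del)
      also have "\<dots> = (\<Oplus>\<^bsub>?P\<^esub>j\<in>{..<n}. tt (t \<phi> (e j)) (t (?c j i \<triangleright>\<^bsub>M'\<^esub> e' i) u))"
      proof (rule P.finsum_cong')
        fix j assume "j \<in> {..<n}"
        then have j: "j < n" by simp
        show "tt (t \<phi> (e j \<triangleleft>\<^bsub>M\<^esub> ?c j i)) (t (e' i) u) = tt (t \<phi> (e j)) (t (?c j i \<triangleright>\<^bsub>M'\<^esub> e' i) u)"
          using XX.tens_smult[OF t_closed[OF \<phi> dual_basis_closed(2)[OF j]] c[OF i j] t_closed[OF dual_basis_closed(1)[OF i] u]]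
          by (simp only: t_rsmult[OF \<phi> dual_basis_closed(2)[OF j] c[OF i j]] t_lsmult[OF dual_basis_closed(1)[OF i] u c[OF i j]])
      qed (use i tc in \<open>simp_all add: Pi_iff del: del\<close>)
      finally show ?thesis .
    qed
    \<comment> \<open>With \<open>j\<close> fixed, \<open>dual_expand\<close> reassembles the
      coefficients into \<open>e' j b\<close>, and \<open>b\<close> then moves onto \<open>u\<close>
      across the tensor sign over \<open>B\<close>.\<close>
    have 2: "(\<Oplus>\<^bsub>?P\<^esub>i\<in>{..<n}. tt (t \<phi> (e j)) (t (?c j i \<triangleright>\<^bsub>M'\<^esub> e' i) u)) =
      tt (t \<phi> (e j)) (t (e' j) (b \<triangleright>\<^bsub>M\<^esub> u))" if j: "j < n" for j
    proof -
      have "(\<Oplus>\<^bsub>M'\<^esub>i\<in>{..<n}. ?c j i \<triangleright>\<^bsub>M'\<^esub> e' i) = (\<Oplus>\<^bsub>M'\<^esub>i\<in>{..<n}. (e' j \<triangleleft>\<^bsub>M'\<^esub> b) (e i) \<triangleright>\<^bsub>M'\<^esub> e' i)"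
        using j ce' by (intro M'.finsum_cong') (simp_all add: Pi_iff dual_rsmult_apply dual_basis_closed del: del)
      also have "\<dots> = e' j \<triangleleft>\<^bsub>M'\<^esub> b" by (rule dual_expand[OF e'b[OF j]])
      finally have s: "(\<Oplus>\<^bsub>M'\<^esub>i\<in>{..<n}. ?c j i \<triangleright>\<^bsub>M'\<^esub> e' i) = e' j \<triangleleft>\<^bsub>M'\<^esub> b" .
      have "(\<lambda>\<psi>. tt (t \<phi> (e j)) (t \<psi> u)) (\<Oplus>\<^bsub>M'\<^esub>i\<in>{..<n}. ?c j i \<triangleright>\<^bsub>M'\<^esub> e' i) =
        (\<Oplus>\<^bsub>?P\<^esub>i\<in>{..<n}. tt (t \<phi> (e j)) (t (?c j i \<triangleright>\<^bsub>M'\<^esub> e' i) u))"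
        using j u \<phi> ce'
        by (intro additive_finsum[where f = "\<lambda>\<psi>. tt (t \<phi> (e j)) (t \<psi> u)"]
            M'.abelian_group_axioms P.abelian_group_axioms
            additive_compose[OF additive_t_left[OF u] XX.additive_tens_right])
          (auto intro: t_closed dual_basis_closed simp del: del)
      then have "(\<Oplus>\<^bsub>?P\<^esub>i\<in>{..<n}. tt (t \<phi> (e j)) (t (?c j i \<triangleright>\<^bsub>M'\<^esub> e' i) u)) =
        tt (t \<phi> (e j)) (t (\<Oplus>\<^bsub>M'\<^esub>i\<in>{..<n}. ?c j i \<triangleright>\<^bsub>M'\<^esub> e' i) u)" by (rule sym)
      also have "\<dots> = tt (t \<phi> (e j)) (t (e' j) (b \<triangleright>\<^bsub>M\<^esub> u))"
        using M'M.tens_smult[OF dual_basis_closed(1)[OF j] b u] by (simp only: s)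
      finally show ?thesis .
    qed
    have "(\<Oplus>\<^bsub>?P\<^esub>i\<in>{..<n}. tt (t (\<phi> \<triangleleft>\<^bsub>M'\<^esub> b) (e i)) (t (e' i) u)) =
      (\<Oplus>\<^bsub>?P\<^esub>i\<in>{..<n}. \<Oplus>\<^bsub>?P\<^esub>j\<in>{..<n}. tt (t \<phi> (e j)) (t (?c j i \<triangleright>\<^bsub>M'\<^esub> e' i) u))"
      by (intro P.finsum_cong') (simp_all add: 1 tc Pi_iff P.finsum_closed del: del)
    also have "\<dots> = (\<Oplus>\<^bsub>?P\<^esub>j\<in>{..<n}. \<Oplus>\<^bsub>?P\<^esub>i\<in>{..<n}. tt (t \<phi> (e j)) (t (?c j i \<triangleright>\<^bsub>M'\<^esub> e' i) u))"
      by (intro P.finsum_swap) (simp_all add: tc del: del)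
    also have "\<dots> = (\<Oplus>\<^bsub>?P\<^esub>j\<in>{..<n}. tt (t \<phi> (e j)) (t (e' j) (b \<triangleright>\<^bsub>M\<^esub> u)))"
      using comult_term_closed[OF \<phi> M.lsmult_closed[OF b u]]
      by (intro P.finsum_cong') (simp_all add: 2 Pi_iff del: del)
    finally show "(\<Oplus>\<^bsub>?P\<^esub>i\<in>{..<n}. tt (t (\<phi> \<triangleleft>\<^bsub>M'\<^esub> b) (e i)) (t (e' i) u)) =
      (\<Oplus>\<^bsub>?P\<^esub>i\<in>{..<n}. tt (t \<phi> (e i)) (t (e' i) (b \<triangleright>\<^bsub>M\<^esub> u)))" .
  qed
qed

lemma comult_tens:
  assumes "\<phi> \<in> carrier M'" "u \<in> carrier M"
  shows "comatrix_comult B A M n e' e (t \<phi> u) = (\<Oplus>\<^bsub>tensor_group A X X\<^esub>i\<in>{..<n}. tt (t \<phi> (e i)) (t (e' i) u))"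
  unfolding comatrix_comult_def Let_def tens_DD
  by (subst M'M.tensor_lift_tens[OF XX.abelian_group_tensor comult_balanced assms]) simp

lemma comult_additive: "comatrix_comult B A M n e' e \<in> additive X (tensor_group A X X)"
  unfolding comatrix_comult_def Let_def tens_DD additive_X
  by (rule M'M.tensor_lift_additive[OF XX.abelian_group_tensor comult_balanced])

end

lemma tens_rsmult_tensor:
  assumes "right_module R M" "bimodule K R A N" "m \<in> carrier M" "n \<in> carrier N" "a \<in> carrier A"
  shows "tens R M N m n \<triangleleft>\<^bsub>tensor R M N\<^esub> a = tens R M N m (n \<triangleleft>\<^bsub>N\<^esub> a)"
  using tens_rsmult[OF assms] by simp

section \<open>The coring axioms for the comatrix coring\<close>

context comatrix
begin

interpretation M': bimodule K A B M' by (rule bimodule_M')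
interpretation M'M: tensor_pair B M' M by (rule pair_M'M)
interpretation XX: tensor_pair A X X by (rule pair_XX)
interpretation XXX: tensor_triple K A A A X X X by (rule triple_XXX)
interpretation A: ring A using alg_A by (simp add: assoc_algebra_def)
interpretation P: abelian_group "tensor_group A X X" by (rule XX.abelian_group_tensor)

abbreviation "\<Delta> \<equiv> comatrix_comult B A M n e' e"
abbreviation "T2 \<equiv> tensor A X X"

lemma bimodule_T2: "bimodule K A A T2"
  by (rule bimodule_tensor[OF bimodule_X bimodule_X])

lemma pair_T2_X: "tensor_pair A T2 X"
  by (rule tensor_pairI[OF bimodule_right_module[OF bimodule_T2] bimodule_left_module[OF bimodule_X]])

lemma pair_X_T2: "tensor_pair A X T2"
  by (rule tensor_pairI[OF bimodule_right_module[OF bimodule_X] bimodule_left_module[OF bimodule_T2]])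

text \<open>An additive map is applied termwise to the dual basis sum. The axioms involving the
  comultiplication are all reduced to pure tensors of pure tensors in this way.\<close>

lemma additive_comult:
  assumes "abelian_group P" "f \<in> additive (tensor_group A X X) P" "\<phi> \<in> carrier M'" "u \<in> carrier M"
  shows "f (\<Delta> (t \<phi> u)) = (\<Oplus>\<^bsub>P\<^esub>i\<in>{..<n}. f (tt (t \<phi> (e i)) (t (e' i) u)))"
  unfolding comult_tens[OF assms(3,4)]
  by (rule additive_finsum[OF P.abelian_group_axioms assms(1,2)])
    (use comult_term_closed[OF assms(3,4)] in simp_all)

lemma comult_right_hom: "\<Delta> \<in> right_hom A X T2"
proof -
  note del = dual_bimodule_simps comatrix_coring_simps tensor_simps
  have add: "(\<lambda>z. z \<triangleleft>\<^bsub>T2\<^esub> a) \<in> additive (tensor_group A X X) (tensor_group A X X)" if "a \<in> carrier A" for a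
    using right_module.rsmult_additive[OF bimodule_right_module[OF bimodule_T2] that] by (simp del: tensor_simps)
  have "\<Delta> (x \<triangleleft>\<^bsub>X\<^esub> a) = \<Delta> x \<triangleleft>\<^bsub>T2\<^esub> a" if x: "x \<in> carrier X" and a: "a \<in> carrier A" for x a
  proof (rule X_eqI[OF P.abelian_group_axioms
        additive_compose[OF right_module.rsmult_additive[OF bimodule_right_module[OF bimodule_X] a] comult_additive]
        additive_compose[OF comult_additive add[OF a]] _ x])
    fix \<phi> u assume \<phi>: "\<phi> \<in> carrier M'" and u: "u \<in> carrier M"
    have "\<Delta> (t \<phi> u \<triangleleft>\<^bsub>X\<^esub> a) = (\<Oplus>\<^bsub>tensor_group A X X\<^esub>i\<in>{..<n}. tt (t \<phi> (e i)) (t (e' i) (u \<triangleleft>\<^bsub>M\<^esub> a)))"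
      using \<phi> u a by (simp only: t_rsmult comult_tens M.rsmult_closed)
    also have "\<dots> = (\<Oplus>\<^bsub>tensor_group A X X\<^esub>i\<in>{..<n}. tt (t \<phi> (e i)) (t (e' i) u) \<triangleleft>\<^bsub>T2\<^esub> a)"
      using \<phi> u a comult_term_closed[OF \<phi> M.rsmult_closed[OF u a]]
      by (intro P.finsum_cong')
        (simp_all add: t_rsmult t_closed dual_basis_closed Pi_iff additive_closed[OF add]
          tens_rsmult_tensor[OF bimodule_right_module[OF bimodule_X] bimodule_X] comult_term_closed del: del)
    also have "\<dots> = \<Delta> (t \<phi> u) \<triangleleft>\<^bsub>T2\<^esub> a"
      by (rule additive_comult[OF P.abelian_group_axioms add[OF a] \<phi> u, symmetric])
    finally show "\<Delta> (t \<phi> u \<triangleleft>\<^bsub>X\<^esub> a) = \<Delta> (t \<phi> u) \<triangleleft>\<^bsub>T2\<^esub> a" .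
  qed
  then show ?thesis using comult_additive by (simp add: right_hom_eq del: comatrix_coring_simps tensor_simps)
qed

lemma comult_left_hom: "\<Delta> \<in> left_hom A X T2"
proof -
  note del = dual_bimodule_simps comatrix_coring_simps tensor_simps
  have add: "(\<lambda>z. a \<triangleright>\<^bsub>T2\<^esub> z) \<in> additive (tensor_group A X X) (tensor_group A X X)" if "a \<in> carrier A" for a
    using left_module.lsmult_additive[OF bimodule_left_module[OF bimodule_T2] that] by (simp del: tensor_simps)
  have "\<Delta> (a \<triangleright>\<^bsub>X\<^esub> x) = a \<triangleright>\<^bsub>T2\<^esub> \<Delta> x" if x: "x \<in> carrier X" and a: "a \<in> carrier A" for x a
  proof (rule X_eqI[OF P.abelian_group_axioms
        additive_compose[OF left_module.lsmult_additive[OF bimodule_left_module[OF bimodule_X] a] comult_additive]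
        additive_compose[OF comult_additive add[OF a]] _ x])
    fix \<phi> u assume \<phi>: "\<phi> \<in> carrier M'" and u: "u \<in> carrier M"
    have a\<phi>: "a \<triangleright>\<^bsub>M'\<^esub> \<phi> \<in> carrier M'" by (rule M'.lsmult_closed[OF a \<phi>])
    have "\<Delta> (a \<triangleright>\<^bsub>X\<^esub> t \<phi> u) = (\<Oplus>\<^bsub>tensor_group A X X\<^esub>i\<in>{..<n}. tt (t (a \<triangleright>\<^bsub>M'\<^esub> \<phi>) (e i)) (t (e' i) u))"
      using \<phi> u a by (simp only: t_lsmult comult_tens a\<phi>)
    also have "\<dots> = (\<Oplus>\<^bsub>tensor_group A X X\<^esub>i\<in>{..<n}. a \<triangleright>\<^bsub>T2\<^esub> tt (t \<phi> (e i)) (t (e' i) u))"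
      using \<phi> u a comult_term_closed[OF a\<phi> u]
      by (intro P.finsum_cong')
        (simp_all add: t_lsmult t_closed dual_basis_closed Pi_iff additive_closed[OF add]
          tens_lsmult[OF bimodule_X bimodule_left_module[OF bimodule_X]] comult_term_closed del: del)
    also have "\<dots> = a \<triangleright>\<^bsub>T2\<^esub> \<Delta> (t \<phi> u)"
      by (rule additive_comult[OF P.abelian_group_axioms add[OF a] \<phi> u, symmetric])
    finally show "\<Delta> (a \<triangleright>\<^bsub>X\<^esub> t \<phi> u) = a \<triangleright>\<^bsub>T2\<^esub> \<Delta> (t \<phi> u)" .
  qed
  then show ?thesis using comult_additive by (simp add: left_hom_def del: comatrix_coring_simps tensor_simps)
qed

text \<open>Both sides insert two dual basis cuts between \<open>\<phi>\<close> and
  \<open>u\<close>, in opposite order; the difference is an interchange of two finite sums.\<close>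

lemma comatrix_coassoc:
  assumes x: "x \<in> carrier X"
  shows "tensor_map A T2 X \<Delta> (\<lambda>x. x) (\<Delta> x) = tensor_assoc A A X X X (tensor_map A X T2 (\<lambda>x. x) \<Delta> (\<Delta> x))"
proof -
  let ?P = "tensor_group A (tensor_right A X X) X"
  let ?tt = "tens A (tensor_right A X X) X"
  interpret Q: abelian_group ?P by (rule tensor_pair.abelian_group_tensor[OF XXX.pair_LM_N])
  interpret T2X: tensor_pair A "tensor_right A X X" X by (rule XXX.pair_LM_N)
  interpret XT2: tensor_pair A X T2 by (rule pair_X_T2)
  note del = dual_bimodule_simps comatrix_coring_simps tensor_simps(2-)
  note left = XX.tensor_map_additive[OF pair_T2_X comult_right_hom left_hom_id, unfolded tens_tensor_left]
  note right = additive_compose[OF XX.tensor_map_additive[OF pair_X_T2 right_hom_id comult_left_hom] XXX.tensor_assoc_additive]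
  show ?thesis
  proof (rule X_eqI[OF Q.abelian_group_axioms additive_compose[OF comult_additive left]
        additive_compose[OF comult_additive right] _ x])
    fix \<phi> u assume \<phi>: "\<phi> \<in> carrier M'" and u: "u \<in> carrier M"
    \<comment> \<open>Index \<open>j\<close> belongs to the cut next to \<open>\<phi>\<close>, index
      \<open>i\<close> to the cut next to \<open>u\<close>. Comultiplying the first leg leaves the
      sum over \<open>i\<close> outside, comultiplying the second leg leaves the sum over
      \<open>j\<close> outside.\<close>
    let ?f = "\<lambda>i j. ?tt (tt (t \<phi> (e j)) (t (e' j) (e i))) (t (e' i) u)"
    have f: "?f i j \<in> carrier ?P" if "i < n" "j < n" for i j
      by (rule T2X.tens_closed) (use that \<phi> u in \<open>simp_all add: XX.tens_closed t_closed dual_basis_closed del: del\<close>)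
    have 1: "tensor_map A T2 X \<Delta> (\<lambda>x. x) (tt (t \<phi> (e i)) (t (e' i) u)) = (\<Oplus>\<^bsub>?P\<^esub>j\<in>{..<n}. ?f i j)" if i: "i < n" for i
    proof -
      have c: "t \<phi> (e i) \<in> carrier X" "t (e' i) u \<in> carrier X"
        using i by (simp_all add: t_closed dual_basis_closed \<phi> u del: del)
      have "tensor_map A T2 X \<Delta> (\<lambda>x. x) (tt (t \<phi> (e i)) (t (e' i) u)) = ?tt (\<Delta> (t \<phi> (e i))) (t (e' i) u)"
        using XX.tensor_map_tens[OF pair_T2_X comult_right_hom left_hom_id c] unfolding tens_tensor_left .
      also have "\<dots> = (\<Oplus>\<^bsub>?P\<^esub>j\<in>{..<n}. ?f i j)"
        using T2X.additive_tens_left[OF c(2)]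
        by (intro additive_comult[where f = "\<lambda>Y. ?tt Y (t (e' i) u)", OF Q.abelian_group_axioms _ \<phi> dual_basis_closed(2)[OF i]]) simp
      finally show ?thesis .
    qed
    have 2: "tensor_assoc A A X X X (tensor_map A X T2 (\<lambda>x. x) \<Delta> (tt (t \<phi> (e j)) (t (e' j) u))) = (\<Oplus>\<^bsub>?P\<^esub>i\<in>{..<n}. ?f i j)"
      if j: "j < n" for j
    proof -
      have c: "t \<phi> (e j) \<in> carrier X" "t (e' j) u \<in> carrier X"
        using j by (simp_all add: t_closed dual_basis_closed \<phi> u del: del)
      let ?g = "\<lambda>Y. tensor_assoc A A X X X (tens A X T2 (t \<phi> (e j)) Y)"
      have g: "?g \<in> additive (tensor_group A X X) ?P"
        using additive_compose[OF XT2.additive_tens_right[OF c(1)] XXX.tensor_assoc_additive] by simp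
      have "tensor_assoc A A X X X (tensor_map A X T2 (\<lambda>x. x) \<Delta> (tt (t \<phi> (e j)) (t (e' j) u))) = ?g (\<Delta> (t (e' j) u))"
        using XX.tensor_map_tens[OF pair_X_T2 right_hom_id comult_left_hom c] by simp
      also have "\<dots> = (\<Oplus>\<^bsub>?P\<^esub>i\<in>{..<n}. ?g (tt (t (e' j) (e i)) (t (e' i) u)))"
        by (rule additive_comult[OF Q.abelian_group_axioms g dual_basis_closed(1)[OF j] u])
      also have "\<dots> = (\<Oplus>\<^bsub>?P\<^esub>i\<in>{..<n}. ?f i j)"
        using f j u \<phi> by (intro Q.finsum_cong')
          (simp_all add: Pi_iff XXX.tensor_assoc_tens t_closed dual_basis_closed del: del)
      finally show ?thesis .
    qed
    have "tensor_map A T2 X \<Delta> (\<lambda>x. x) (\<Delta> (t \<phi> u)) = (\<Oplus>\<^bsub>?P\<^esub>i\<in>{..<n}. tensor_map A T2 X \<Delta> (\<lambda>x. x) (tt (t \<phi> (e i)) (t (e' i) u)))"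
      by (rule additive_comult[OF Q.abelian_group_axioms left \<phi> u])
    also have "\<dots> = (\<Oplus>\<^bsub>?P\<^esub>i\<in>{..<n}. \<Oplus>\<^bsub>?P\<^esub>j\<in>{..<n}. ?f i j)"
      using f by (intro Q.finsum_cong') (simp_all add: 1 Pi_iff Q.finsum_closed del: del)
    also have "\<dots> = (\<Oplus>\<^bsub>?P\<^esub>j\<in>{..<n}. \<Oplus>\<^bsub>?P\<^esub>i\<in>{..<n}. ?f i j)"
      using f by (intro Q.finsum_swap) simp_all
    also have "\<dots> = (\<Oplus>\<^bsub>?P\<^esub>j\<in>{..<n}. tensor_assoc A A X X X (tensor_map A X T2 (\<lambda>x. x) \<Delta> (tt (t \<phi> (e j)) (t (e' j) u))))"
      using f by (intro Q.finsum_cong') (simp_all add: 2 Pi_iff Q.finsum_closed del: del)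
    also have "\<dots> = tensor_assoc A A X X X (tensor_map A X T2 (\<lambda>x. x) \<Delta> (\<Delta> (t \<phi> u)))"
      by (rule additive_comult[OF Q.abelian_group_axioms right \<phi> u, symmetric])
    finally show "tensor_map A T2 X \<Delta> (\<lambda>x. x) (\<Delta> (t \<phi> u)) =
      tensor_assoc A A X X X (tensor_map A X T2 (\<lambda>x. x) \<Delta> (\<Delta> (t \<phi> u)))" .
  qed
qed

text \<open>The first leg contributes the scalar \<open>\<phi> (e i)\<close>, which acts on
  \<open>e' i\<close>; the sum then collapses by the transposed identity
  \<open>dual_expand\<close>.\<close>

lemma comatrix_counit_left:
  assumes x: "x \<in> carrier X"
  shows "left_unit X (tensor_map A (regular_bimodule A) X (comatrix_counit A) (\<lambda>x. x) (\<Delta> x)) = x"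
proof -
  note del = dual_bimodule_simps comatrix_coring_simps tensor_simps
  let ?g = "\<lambda>z. left_unit X (tensor_map A (regular_bimodule A) X (comatrix_counit A) (\<lambda>x. x) z)"
  have g: "?g \<in> additive (tensor_group A X X) X"
    by (rule additive_compose[OF XX.tensor_map_additive[OF XX.left_unit_pair counit_right_hom left_hom_id] XX.left_unit_additive])
  show ?thesis
  proof (rule X_eqI[OF abelian_group_X additive_compose[OF comult_additive g] additive_id _ x])
    fix \<phi> u assume \<phi>: "\<phi> \<in> carrier M'" and u: "u \<in> carrier M"
    have c: "\<phi> (e i) \<triangleright>\<^bsub>M'\<^esub> e' i \<in> carrier M'" if "i < n" for i
      using that dual_basis_closed by (intro M'.lsmult_closed dual_closed[OF \<phi>])
    have "?g (\<Delta> (t \<phi> u)) = (\<Oplus>\<^bsub>X\<^esub>i\<in>{..<n}. ?g (tt (t \<phi> (e i)) (t (e' i) u)))"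
      by (rule additive_comult[OF abelian_group_X g \<phi> u])
    also have "\<dots> = (\<Oplus>\<^bsub>X\<^esub>i\<in>{..<n}. t (\<phi> (e i) \<triangleright>\<^bsub>M'\<^esub> e' i) u)"
      using \<phi> u c
      by (intro abelian_monoid.finsum_cong'[OF abelian_group.axioms(1)[OF abelian_group_X]])
        (simp_all add: Pi_iff XX.tensor_map_tens[OF XX.left_unit_pair counit_right_hom left_hom_id]
          XX.left_unit_tens counit_tens t_closed dual_basis_closed dual_closed t_lsmult del: del)
    also have "\<dots> = t (\<Oplus>\<^bsub>M'\<^esub>i\<in>{..<n}. \<phi> (e i) \<triangleright>\<^bsub>M'\<^esub> e' i) u"
      by (rule additive_finsum[symmetric, OF M'.abelian_group_axioms abelian_group_X additive_t_left[OF u]])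
        (use c in auto)
    finally show "?g (\<Delta> (t \<phi> u)) = t \<phi> u" by (simp only: dual_expand[OF \<phi>])
  qed
qed

text \<open>Here the scalar is \<open>e' i u\<close> and acts on \<open>e i\<close>, so the dual
  basis identity itself applies.\<close>

lemma comatrix_counit_right:
  assumes x: "x \<in> carrier X"
  shows "right_unit X (tensor_map A X (regular_bimodule A) (\<lambda>x. x) (comatrix_counit A) (\<Delta> x)) = x"
proof -
  note del = dual_bimodule_simps comatrix_coring_simps tensor_simps
  let ?g = "\<lambda>z. right_unit X (tensor_map A X (regular_bimodule A) (\<lambda>x. x) (comatrix_counit A) z)"
  have g: "?g \<in> additive (tensor_group A X X) X"
    by (rule additive_compose[OF XX.tensor_map_additive[OF XX.right_unit_pair right_hom_id counit_left_hom] XX.right_unit_additive])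
  show ?thesis
  proof (rule X_eqI[OF abelian_group_X additive_compose[OF comult_additive g] additive_id _ x])
    fix \<phi> u assume \<phi>: "\<phi> \<in> carrier M'" and u: "u \<in> carrier M"
    have c: "e i \<triangleleft>\<^bsub>M\<^esub> e' i u \<in> carrier M" if "i < n" for i
      using that dual_basis_closed by (intro M.rsmult_closed dual_closed[OF _ u])
    have "?g (\<Delta> (t \<phi> u)) = (\<Oplus>\<^bsub>X\<^esub>i\<in>{..<n}. ?g (tt (t \<phi> (e i)) (t (e' i) u)))"
      by (rule additive_comult[OF abelian_group_X g \<phi> u])
    also have "\<dots> = (\<Oplus>\<^bsub>X\<^esub>i\<in>{..<n}. t \<phi> (e i \<triangleleft>\<^bsub>M\<^esub> e' i u))"
      using \<phi> u c
      by (intro abelian_monoid.finsum_cong'[OF abelian_group.axioms(1)[OF abelian_group_X]])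
        (simp_all add: Pi_iff XX.tensor_map_tens[OF XX.right_unit_pair right_hom_id counit_left_hom]
          XX.right_unit_tens counit_tens t_closed dual_basis_closed dual_closed t_rsmult del: del)
    also have "\<dots> = t \<phi> (\<Oplus>\<^bsub>M\<^esub>i\<in>{..<n}. e i \<triangleleft>\<^bsub>M\<^esub> e' i u)"
      by (rule additive_finsum[symmetric, OF M.abelian_group_axioms abelian_group_X additive_t_right[OF \<phi>]])
        (use c in auto)
    finally show "?g (\<Delta> (t \<phi> u)) = t \<phi> u" by (simp only: expand[OF u])
  qed
qed

theorem coring_comatrix: "coring K A X"
proof (intro coring.intro coring_axioms.intro bimodule_X, unfold comatrix_coring_simps(6,7))
  show "\<Delta> \<in> bimodule_hom A A X T2"
    using comult_right_hom comult_left_hom by (simp add: bimodule_hom_eq)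
  show "comatrix_counit A \<in> bimodule_hom A A X (regular_bimodule A)"
    using counit_right_hom counit_left_hom by (simp add: bimodule_hom_eq)
qed (fact comatrix_coassoc comatrix_counit_left comatrix_counit_right)+

end

lemma additive_neg:
  assumes "abelian_group M" "abelian_group N" "f \<in> additive M N" "x \<in> carrier M"
  shows "f (\<ominus>\<^bsub>M\<^esub> x) = \<ominus>\<^bsub>N\<^esub> f x"
proof -
  interpret M: abelian_group M by fact
  interpret N: abelian_group N by fact
  have "f (\<ominus>\<^bsub>M\<^esub> x) \<oplus>\<^bsub>N\<^esub> f x = f (\<ominus>\<^bsub>M\<^esub> x \<oplus>\<^bsub>M\<^esub> x)"
    using assms(4) by (intro additive_add[OF assms(3), symmetric]) simp_all
  also have "\<dots> = \<zero>\<^bsub>N\<^esub>"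
    using assms(4) by (simp add: M.l_neg additive_zero[OF assms(1-3)])
  finally show ?thesis
    using assms(4) by (intro N.minus_equality[symmetric]) (auto intro: additive_closed[OF assms(3)])
qed

lemma additive_uminus: "abelian_group M \<Longrightarrow> (\<lambda>x. \<ominus>\<^bsub>M\<^esub> x) \<in> additive M M"
  by (intro additiveI) (auto simp: abelian_group.minus_add abelian_group.a_inv_closed)

lemma additive_const_zero: "abelian_group N \<Longrightarrow> (\<lambda>x. \<zero>\<^bsub>N\<^esub>) \<in> additive M N"
  using abelian_groupE(2,5)[of N] by (intro additiveI) auto

section \<open>Comodule endomorphisms\<close>

lemma comodule_End_simps [simp]:
  "carrier (comodule_End A C M) = comodule_hom A C M M \<inter> extensional (carrier M)"
  "f \<otimes>\<^bsub>comodule_End A C M\<^esub> g = compose (carrier M) f g"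
  "\<one>\<^bsub>comodule_End A C M\<^esub> = (\<lambda>u\<in>carrier M. u)"
  "\<zero>\<^bsub>comodule_End A C M\<^esub> = (\<lambda>u\<in>carrier M. \<zero>\<^bsub>M\<^esub>)"
  "f \<oplus>\<^bsub>comodule_End A C M\<^esub> g = (\<lambda>u\<in>carrier M. f u \<oplus>\<^bsub>M\<^esub> g u)"
  "k \<odot>\<^bsub>comodule_End A C M\<^esub> f = (\<lambda>u\<in>carrier M. f u \<triangleleft>\<^bsub>M\<^esub> (k \<odot>\<^bsub>A\<^esub> \<one>\<^bsub>A\<^esub>))"
  by (simp_all add: comodule_End_def)

lemma End_bimodule_simps [simp]:
  "carrier (End_bimodule M) = carrier M" "ring.zero (End_bimodule M) = ring.zero M"
  "ring.add (End_bimodule M) = ring.add M" "rsmult (End_bimodule M) = rsmult M"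
  "f \<triangleright>\<^bsub>End_bimodule M\<^esub> u = f u"
  by (simp_all add: End_bimodule_def right_module.extend_def right_module.truncate_def bimodule.fields_def)

text \<open>Dual bases are stated over \<open>End_bimodule M\<close>, whereas their sums are
  computed in \<open>M\<close>.\<close>

lemma finsum_End_bimodule: "finsum (End_bimodule M) = finsum M"
  by (simp add: finsum_def finprod_def fun_eq_iff)

lemma right_hom_closed: "\<lbrakk>f \<in> right_hom A M N; x \<in> carrier M\<rbrakk> \<Longrightarrow> f x \<in> carrier N"
  by (rule additive_closed[OF right_hom_additive])

lemma right_hom_add:
  "\<lbrakk>f \<in> right_hom A M N; x \<in> carrier M; y \<in> carrier M\<rbrakk> \<Longrightarrow> f (x \<oplus>\<^bsub>M\<^esub> y) = f x \<oplus>\<^bsub>N\<^esub> f y"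
  by (rule additive_add[OF right_hom_additive])

text \<open>The assumptions are those of \<open>right_comodule\<close>; listing the module and the coring separately
  gives their facts distinct qualifiers.\<close>

locale canonical = M: right_module A M + C: coring K A C + right_comodule K A C M
  for K (structure) and A (structure) and C (structure) and M (structure)
begin

abbreviation "T \<equiv> comodule_End A C M"
abbreviation "M\<^sub>T \<equiv> End_bimodule M"
abbreviation "\<rho> \<equiv> coaction M"
abbreviation "MC \<equiv> tensor_right A M C"

lemma alg_A: "assoc_algebra K A"
  using C.bimodule_axioms by (simp add: bimodule_def)

lemma cring_K: "cring K"
  using alg_A by (simp add: assoc_algebra_def module_def)

lemma left_module_C: "left_module A C"
  by (rule bimodule_left_module[OF C.bimodule_axioms])

lemma pair_MC: "tensor_pair A M C"
  by (rule tensor_pairI[OF M.right_module_axioms left_module_C])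

lemma right_module_MC: "right_module A MC"
  by (rule right_module_tensor_right[OF M.right_module_axioms C.bimodule_axioms])

interpretation MC: tensor_pair A M C by (rule pair_MC)
interpretation G: abelian_group "tensor_group A M C" by (rule MC.abelian_group_tensor)
interpretation A: ring A using alg_A by (simp add: assoc_algebra_def)

lemma coaction_additive: "\<rho> \<in> additive M (tensor_group A M C)"
  using right_hom_additive[OF coaction_hom] by simp

lemma coaction_closed: "u \<in> carrier M \<Longrightarrow> \<rho> u \<in> carrier (tensor_group A M C)"
  by (rule additive_closed[OF coaction_additive])

lemma additive_tensor_map:
  "f \<in> right_hom A M M \<Longrightarrow> tensor_map A M C f (\<lambda>x. x) \<in> additive (tensor_group A M C) (tensor_group A M C)"
  by (rule MC.tensor_map_additive[OF pair_MC _ left_hom_id])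

lemma tensor_map_tens:
  "\<lbrakk>f \<in> right_hom A M M; m \<in> carrier M; c \<in> carrier C\<rbrakk>
    \<Longrightarrow> tensor_map A M C f (\<lambda>x. x) (tens A M C m c) = tens A M C (f m) c"
  by (rule MC.tensor_map_tens[OF pair_MC _ left_hom_id])

text \<open>The pattern behind the closure properties of \<open>T\<close>: the tensor map of a
  combined endomorphism is identified on all of \<open>M \<otimes> C\<close> with the same
  combination of tensor maps, and only then evaluated at \<open>\<rho> u\<close>.\<close>

lemma tensor_map_eqI:
  assumes "f \<in> right_hom A M M" "g \<in> additive (tensor_group A M C) (tensor_group A M C)"
    and "\<And>m c. \<lbrakk>m \<in> carrier M; c \<in> carrier C\<rbrakk> \<Longrightarrow> tens A M C (f m) c = g (tens A M C m c)"
    and "Y \<in> carrier (tensor_group A M C)"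
  shows "tensor_map A M C f (\<lambda>x. x) Y = g Y"
  by (rule MC.tensor_eqI[OF G.abelian_group_axioms additive_tensor_map[OF assms(1)] assms(2) _ assms(4)])
    (simp add: tensor_map_tens assms)

lemma T_right_hom: "f \<in> carrier T \<Longrightarrow> f \<in> right_hom A M M"
  by (simp add: comodule_hom_def)

lemma T_coaction: "\<lbrakk>f \<in> carrier T; u \<in> carrier M\<rbrakk> \<Longrightarrow> tensor_map A M C f (\<lambda>x. x) (\<rho> u) = \<rho> (f u)"
  by (simp add: comodule_hom_def)

text \<open>Normalization by \<open>restrict\<close> changes \<open>f\<close> as a function, and
  with it the map under the lift. The two tensor maps still agree, because pure tensors only see
  values on the carrier. Hence colinearity can be proved for the unrestricted term.\<close>

lemma T_memI:
  assumes f: "f \<in> right_hom A M M"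
    and co: "\<And>u. u \<in> carrier M \<Longrightarrow> tensor_map A M C f (\<lambda>x. x) (\<rho> u) = \<rho> (f u)"
  shows "(\<lambda>u\<in>carrier M. f u) \<in> carrier T"
proof -
  have r: "(\<lambda>u\<in>carrier M. f u) \<in> right_hom A M M"
    using f by (auto simp: right_hom_def M.rsmult_closed)
  have "tensor_map A M C (\<lambda>u\<in>carrier M. f u) (\<lambda>x. x) (\<rho> u) = \<rho> (f u)" if u: "u \<in> carrier M" for u
  proof -
    have "tensor_map A M C (\<lambda>u\<in>carrier M. f u) (\<lambda>x. x) (\<rho> u) = tensor_map A M C f (\<lambda>x. x) (\<rho> u)"
      by (rule tensor_map_eqI[OF r additive_tensor_map[OF f] _ coaction_closed[OF u]])
        (simp add: tensor_map_tens[OF f])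
    then show ?thesis by (simp add: co u)
  qed
  then show ?thesis using r by (auto simp: comodule_hom_def)
qed

lemma T_eqI:
  assumes "f \<in> carrier T" "g \<in> carrier T" "\<And>u. u \<in> carrier M \<Longrightarrow> f u = g u"
  shows "f = g"
  using assms by (auto intro: extensionalityI)

lemma T_closed: "\<lbrakk>f \<in> carrier T; u \<in> carrier M\<rbrakk> \<Longrightarrow> f u \<in> carrier M"
  by (rule right_hom_closed[OF T_right_hom])

lemma T_add: "\<lbrakk>f \<in> carrier T; u \<in> carrier M; v \<in> carrier M\<rbrakk> \<Longrightarrow> f (u \<oplus>\<^bsub>M\<^esub> v) = f u \<oplus>\<^bsub>M\<^esub> f v"
  by (rule right_hom_add[OF T_right_hom])

lemma T_rsmult: "\<lbrakk>f \<in> carrier T; u \<in> carrier M; a \<in> carrier A\<rbrakk> \<Longrightarrow> f (u \<triangleleft>\<^bsub>M\<^esub> a) = f u \<triangleleft>\<^bsub>M\<^esub> a"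
  by (rule right_hom_smult[OF T_right_hom])

lemma T_mult_closed:
  assumes f: "f \<in> carrier T" and g: "g \<in> carrier T"
  shows "f \<otimes>\<^bsub>T\<^esub> g \<in> carrier T"
  unfolding comodule_End_simps(2) compose_def
proof (rule T_memI)
  show fg: "(\<lambda>u. f (g u)) \<in> right_hom A M M"
    using T_right_hom[OF f] T_right_hom[OF g] by (auto simp: right_hom_def Pi_iff)
  fix u assume u: "u \<in> carrier M"
  have "tensor_map A M C (\<lambda>u. f (g u)) (\<lambda>x. x) (\<rho> u) =
      tensor_map A M C f (\<lambda>x. x) (tensor_map A M C g (\<lambda>x. x) (\<rho> u))"
    by (rule tensor_map_eqI[OF fg additive_compose[OF additive_tensor_map[OF T_right_hom[OF g]]
            additive_tensor_map[OF T_right_hom[OF f]]] _ coaction_closed[OF u]])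
      (use f g in \<open>simp add: tensor_map_tens T_right_hom T_closed del: comodule_End_simps\<close>)
  then show "tensor_map A M C (\<lambda>u. f (g u)) (\<lambda>x. x) (\<rho> u) = \<rho> (f (g u))"
    using f g u by (simp only: T_coaction T_closed)
qed

lemma T_one_closed: "\<one>\<^bsub>T\<^esub> \<in> carrier T"
  unfolding comodule_End_simps(3)
  by (rule T_memI[OF right_hom_id]) (rule tensor_map_eqI[OF right_hom_id additive_id _ coaction_closed], simp_all)

lemma T_zero_closed: "\<zero>\<^bsub>T\<^esub> \<in> carrier T"
  unfolding comodule_End_simps(4)
proof (rule T_memI)
  have "(\<lambda>u. \<zero>\<^bsub>M\<^esub> \<triangleleft>\<^bsub>M\<^esub> a) \<in> additive M M" if "a \<in> carrier A" for a
    using additive_compose[OF additive_const_zero[OF M.abelian_group_axioms] M.rsmult_additive[OF that]] .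
  then show z: "(\<lambda>u. \<zero>\<^bsub>M\<^esub>) \<in> right_hom A M M"
    using additive_zero[OF M.abelian_group_axioms M.abelian_group_axioms M.rsmult_additive]
    by (simp add: right_hom_def)
  fix u assume u: "u \<in> carrier M"
  have "tensor_map A M C (\<lambda>u. \<zero>\<^bsub>M\<^esub>) (\<lambda>x. x) (\<rho> u) = \<zero>\<^bsub>tensor_group A M C\<^esub>"
    by (rule tensor_map_eqI[OF z additive_const_zero[OF G.abelian_group_axioms] _ coaction_closed[OF u]])
      (rule additive_zero[OF M.abelian_group_axioms G.abelian_group_axioms MC.additive_tens_left])
  then show "tensor_map A M C (\<lambda>u. \<zero>\<^bsub>M\<^esub>) (\<lambda>x. x) (\<rho> u) = \<rho> \<zero>\<^bsub>M\<^esub>"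
    by (simp add: additive_zero[OF M.abelian_group_axioms G.abelian_group_axioms coaction_additive])
qed

lemma T_add_closed:
  assumes f: "f \<in> carrier T" and g: "g \<in> carrier T"
  shows "f \<oplus>\<^bsub>T\<^esub> g \<in> carrier T"
  unfolding comodule_End_simps(5)
proof (rule T_memI)
  have "(\<lambda>u. f u \<oplus>\<^bsub>M\<^esub> g u) \<in> additive M M"
    by (rule additive_plus[OF M.abelian_group_axioms right_hom_additive[OF T_right_hom[OF f]]
          right_hom_additive[OF T_right_hom[OF g]]])
  then show fg: "(\<lambda>u. f u \<oplus>\<^bsub>M\<^esub> g u) \<in> right_hom A M M"
    using f g by (simp add: right_hom_eq T_rsmult T_closed M.rsmult_l_distr del: comodule_End_simps)
  fix u assume u: "u \<in> carrier M"
  have "tensor_map A M C (\<lambda>u. f u \<oplus>\<^bsub>M\<^esub> g u) (\<lambda>x. x) (\<rho> u) =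
      tensor_map A M C f (\<lambda>x. x) (\<rho> u) \<oplus>\<^bsub>tensor_group A M C\<^esub> tensor_map A M C g (\<lambda>x. x) (\<rho> u)"
    by (rule tensor_map_eqI[OF fg additive_plus[OF G.abelian_group_axioms
            additive_tensor_map[OF T_right_hom[OF f]] additive_tensor_map[OF T_right_hom[OF g]]] _ coaction_closed[OF u]])
      (use f g in \<open>simp add: tensor_map_tens T_right_hom T_closed MC.tens_add_left del: comodule_End_simps\<close>)
  also have "\<dots> = \<rho> (f u \<oplus>\<^bsub>M\<^esub> g u)"
    using f g u by (simp add: T_coaction additive_add[OF coaction_additive] T_closed del: comodule_End_simps)
  finally show "tensor_map A M C (\<lambda>u. f u \<oplus>\<^bsub>M\<^esub> g u) (\<lambda>x. x) (\<rho> u) = \<rho> (f u \<oplus>\<^bsub>M\<^esub> g u)" .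
qed

lemma T_uminus_closed:
  assumes f: "f \<in> carrier T"
  shows "(\<lambda>u\<in>carrier M. \<ominus>\<^bsub>M\<^esub> f u) \<in> carrier T"
proof (rule T_memI)
  have "(\<lambda>u. \<ominus>\<^bsub>M\<^esub> f u) \<in> additive M M"
    by (rule additive_compose[OF right_hom_additive[OF T_right_hom[OF f]] additive_uminus[OF M.abelian_group_axioms]])
  then show nf: "(\<lambda>u. \<ominus>\<^bsub>M\<^esub> f u) \<in> right_hom A M M"
    using f by (simp add: right_hom_eq T_rsmult T_closed
        additive_neg[OF M.abelian_group_axioms M.abelian_group_axioms M.rsmult_additive] del: comodule_End_simps)
  fix u assume u: "u \<in> carrier M"
  have "tensor_map A M C (\<lambda>u. \<ominus>\<^bsub>M\<^esub> f u) (\<lambda>x. x) (\<rho> u) =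
      \<ominus>\<^bsub>tensor_group A M C\<^esub> tensor_map A M C f (\<lambda>x. x) (\<rho> u)"
    by (rule tensor_map_eqI[OF nf additive_compose[OF additive_tensor_map[OF T_right_hom[OF f]]
            additive_uminus[OF G.abelian_group_axioms]] _ coaction_closed[OF u]])
      (use f in \<open>simp add: tensor_map_tens T_right_hom T_closed
         additive_neg[OF M.abelian_group_axioms G.abelian_group_axioms MC.additive_tens_left] del: comodule_End_simps\<close>)
  also have "\<dots> = \<rho> (\<ominus>\<^bsub>M\<^esub> f u)"
    using f u by (simp add: T_coaction T_closed
        additive_neg[OF M.abelian_group_axioms G.abelian_group_axioms coaction_additive] del: comodule_End_simps)
  finally show "tensor_map A M C (\<lambda>u. \<ominus>\<^bsub>M\<^esub> f u) (\<lambda>x. x) (\<rho> u) = \<rho> (\<ominus>\<^bsub>M\<^esub> f u)" .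
qed

text \<open>The actions of \<open>K\<close> on the two tensor factors agree because \<open>C\<close> centralizes \<open>K\<close>.\<close>

lemma T_smult_closed:
  assumes k: "k \<in> carrier K" and f: "f \<in> carrier T"
  shows "k \<odot>\<^bsub>T\<^esub> f \<in> carrier T"
  unfolding comodule_End_simps(6)
proof (rule T_memI)
  let ?k = "k \<odot>\<^bsub>A\<^esub> \<one>\<^bsub>A\<^esub>"
  have kA: "?k \<in> carrier A" by (rule assoc_algebra_scalar_closed[OF alg_A k])
  have "(\<lambda>u. f u \<triangleleft>\<^bsub>M\<^esub> ?k) \<in> additive M M"
    by (rule additive_compose[OF right_hom_additive[OF T_right_hom[OF f]] M.rsmult_additive[OF kA]])
  \<comment> \<open>Right linearity holds because \<open>?k\<close> is central in
    \<open>A\<close>.\<close>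
  then show fk: "(\<lambda>u. f u \<triangleleft>\<^bsub>M\<^esub> ?k) \<in> right_hom A M M"
    using f k kA by (simp add: right_hom_eq T_rsmult T_closed M.rsmult_assoc[symmetric]
        assoc_algebra.scalar_central[OF alg_A] del: comodule_End_simps)
  fix u assume u: "u \<in> carrier M"
  have "(\<lambda>Y. Y \<triangleleft>\<^bsub>MC\<^esub> ?k) \<in> additive (tensor_group A M C) (tensor_group A M C)"
    using right_module.rsmult_additive[OF right_module_MC kA] by (simp del: tensor_right_simps)
  note add = additive_compose[OF additive_tensor_map[OF T_right_hom[OF f]] this]
  have "tensor_map A M C (\<lambda>u. f u \<triangleleft>\<^bsub>M\<^esub> ?k) (\<lambda>x. x) (\<rho> u) = tensor_map A M C f (\<lambda>x. x) (\<rho> u) \<triangleleft>\<^bsub>MC\<^esub> ?k"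
    by (rule tensor_map_eqI[OF fk add _ coaction_closed[OF u]])
      (use f k kA in \<open>simp add: tensor_map_tens T_right_hom T_closed MC.tens_smult C.centralizes
         tens_rsmult[OF M.right_module_axioms C.bimodule_axioms] del: comodule_End_simps tensor_right_simps\<close>)
  also have "\<dots> = \<rho> (f u \<triangleleft>\<^bsub>M\<^esub> ?k)"
    using f u kA by (simp add: T_coaction T_closed right_hom_smult[OF coaction_hom] del: comodule_End_simps tensor_right_simps)
  finally show "tensor_map A M C (\<lambda>u. f u \<triangleleft>\<^bsub>M\<^esub> ?k) (\<lambda>x. x) (\<rho> u) = \<rho> (f u \<triangleleft>\<^bsub>M\<^esub> ?k)" .
qed

lemmas T_mem = T_mult_closed T_one_closed T_zero_closed T_add_closed T_uminus_closed T_smult_closed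

lemma T_apply:
  "u \<in> carrier M \<Longrightarrow> (f \<otimes>\<^bsub>T\<^esub> g) u = f (g u)" "u \<in> carrier M \<Longrightarrow> \<one>\<^bsub>T\<^esub> u = u"
  "u \<in> carrier M \<Longrightarrow> \<zero>\<^bsub>T\<^esub> u = \<zero>\<^bsub>M\<^esub>" "u \<in> carrier M \<Longrightarrow> (f \<oplus>\<^bsub>T\<^esub> g) u = f u \<oplus>\<^bsub>M\<^esub> g u"
  "u \<in> carrier M \<Longrightarrow> (k \<odot>\<^bsub>T\<^esub> f) u = f u \<triangleleft>\<^bsub>M\<^esub> (k \<odot>\<^bsub>A\<^esub> \<one>\<^bsub>A\<^esub>)"
  by (simp_all add: compose_def)

lemma abelian_group_T: "abelian_group T"
proof (rule abelian_groupI)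
  fix f assume f: "f \<in> carrier T"
  have "(\<lambda>u\<in>carrier M. \<ominus>\<^bsub>M\<^esub> f u) \<oplus>\<^bsub>T\<^esub> f = \<zero>\<^bsub>T\<^esub>"
    using f by (intro T_eqI T_mem) (simp_all add: T_apply T_closed M.l_neg del: comodule_End_simps)
  then show "\<exists>g\<in>carrier T. g \<oplus>\<^bsub>T\<^esub> f = \<zero>\<^bsub>T\<^esub>" using T_uminus_closed[OF f] by blast
qed (rule T_eqI | (intro T_mem; assumption) | (simp add: T_apply T_closed M.a_ac T_mem del: comodule_End_simps; fail))+

lemma ring_T: "ring T"
proof (rule ringI[OF abelian_group_T])
  show "monoid T"
    by (rule monoidI) (rule T_eqI | (simp add: T_apply T_closed T_mem del: comodule_End_simps; fail))+
qed (rule T_eqI | (simp add: T_apply T_closed T_add T_mem del: comodule_End_simps; fail))+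

lemma assoc_algebra_T: "assoc_algebra K T"
proof -
  have mod: "module K A" using alg_A by (simp add: assoc_algebra_def)
  have K_comm: "k \<otimes>\<^bsub>K\<^esub> l = l \<otimes>\<^bsub>K\<^esub> k" and K_closed: "k \<otimes>\<^bsub>K\<^esub> l \<in> carrier K"
    if "k \<in> carrier K" "l \<in> carrier K" for k l
    using that cring_K by (simp_all add: cring.cring_simprules)
  note [simp] = assoc_algebra_scalar_closed[OF alg_A]
  have "module K T"
  proof (rule moduleI[OF cring_K abelian_group_T])
    fix k l f assume *: "k \<in> carrier K" "l \<in> carrier K" "f \<in> carrier T"
    \<comment> \<open>Scalars act by right multiplication, so iterating them reverses the order of
      the factors; commutativity of \<open>K\<close> repairs this.\<close>
    have "(k \<otimes>\<^bsub>K\<^esub> l) \<odot>\<^bsub>A\<^esub> \<one>\<^bsub>A\<^esub> = (l \<odot>\<^bsub>A\<^esub> \<one>\<^bsub>A\<^esub>) \<otimes>\<^bsub>A\<^esub> (k \<odot>\<^bsub>A\<^esub> \<one>\<^bsub>A\<^esub>)"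
      using * by (simp add: assoc_algebra.smult_mult_left[OF alg_A] module.smult_assoc1[OF mod] module.smult_closed[OF mod] K_comm[of k l])
    then show "(k \<otimes>\<^bsub>K\<^esub> l) \<odot>\<^bsub>T\<^esub> f = k \<odot>\<^bsub>T\<^esub> (l \<odot>\<^bsub>T\<^esub> f)"
      using * by (intro T_eqI T_mem K_closed)
        (simp_all add: T_apply T_closed M.rsmult_assoc del: comodule_End_simps)
  qed (rule T_eqI | (simp add: T_apply T_closed T_mem M.rsmult_l_distr M.rsmult_r_distr M.rsmult_one
        module.smult_l_distr[OF mod] del: comodule_End_simps; fail))+
  then show ?thesis
    by (rule assoc_algebra.intro[OF _ ring_T assoc_algebra_axioms.intro])
      (rule T_eqI | (simp add: T_apply T_closed T_mem T_rsmult del: comodule_End_simps; fail))+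
qed

text \<open>The actions commute because endomorphisms are right linear, and \<open>K\<close> is
  centralized because \<open>k \<odot> \<one>\<close> in \<open>T\<close> was defined to be right
  multiplication by \<open>k \<odot> \<one>\<close> in \<open>A\<close>.\<close>

lemma bimodule_M\<^sub>T: "bimodule K T A M\<^sub>T"
proof (intro bimodule.intro bimodule_axioms.intro assoc_algebra_T alg_A)
  show "right_module A M\<^sub>T"
    by (rule right_module_cong[OF M.right_module_axioms]) simp_all
qed (simp_all add: T_apply T_closed T_add T_rsmult del: comodule_End_simps)

end

lemma canonical_iff: "canonical K A C M \<longleftrightarrow> right_comodule K A C M"
  by (auto simp: canonical_def right_comodule_def)

section \<open>Dual bases\<close>

theorem dual_basis_exists:
  fixes A :: "('a, 'ax) ring_scheme" and M :: "('a, 'm, 'mx) right_module_scheme"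
  assumes M: "right_module A M" and fg: "finitely_generated A M" and proj: "projective A M"
  shows "\<exists>n e' e. dual_basis A (End_bimodule M) n e' e"
proof -
  interpret A: ring A using M by (simp add: right_module_def)
  interpret M: right_module A M by fact
  obtain G where G: "finite G" "G \<subseteq> carrier M"
    and gen: "\<And>u. u \<in> carrier M \<Longrightarrow> \<exists>c \<in> G \<rightarrow> carrier A. u = (\<Oplus>\<^bsub>M\<^esub>g\<in>G. g \<triangleleft>\<^bsub>M\<^esub> c g)"
    using fg unfolding finitely_generated_def by blast
  \<comment> \<open>The free module on \<open>G\<close>: coefficient functions normalized outside
    \<open>G\<close>. Its element type is the one on which \<open>projective\<close> lets the test
    module \<open>N\<close> live.\<close>
  define F :: "('a, 'm \<Rightarrow> 'a) right_module" where
    "F = \<lparr>carrier = G \<rightarrow>\<^sub>E carrier A, monoid.mult = undefined, one = undefined,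
      ring.zero = (\<lambda>g\<in>G. \<zero>\<^bsub>A\<^esub>), ring.add = (\<lambda>c d. \<lambda>g\<in>G. c g \<oplus>\<^bsub>A\<^esub> d g),
      rsmult = (\<lambda>c a. \<lambda>g\<in>G. c g \<otimes>\<^bsub>A\<^esub> a)\<rparr>"
  have F_simps: "carrier F = G \<rightarrow>\<^sub>E carrier A" "\<zero>\<^bsub>F\<^esub> = (\<lambda>g\<in>G. \<zero>\<^bsub>A\<^esub>)"
    "c \<oplus>\<^bsub>F\<^esub> d = (\<lambda>g\<in>G. c g \<oplus>\<^bsub>A\<^esub> d g)" "c \<triangleleft>\<^bsub>F\<^esub> a = (\<lambda>g\<in>G. c g \<otimes>\<^bsub>A\<^esub> a)" for c d a
    by (simp_all add: F_def)
  have F: "right_module A F"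
  proof (intro right_module.intro right_module_axioms.intro A.ring_axioms)
    show "abelian_group F"
    proof (rule abelian_groupI)
      fix c assume "c \<in> carrier F"
      then show "\<exists>d\<in>carrier F. d \<oplus>\<^bsub>F\<^esub> c = \<zero>\<^bsub>F\<^esub>"
        by (intro bexI[of _ "\<lambda>g\<in>G. \<ominus>\<^bsub>A\<^esub> c g"])
          (auto simp: F_simps PiE_iff A.l_neg intro!: restrict_ext)
    qed (auto simp: F_simps PiE_iff A.a_ac extensional_def intro!: ext)
  qed (auto simp: F_simps PiE_iff A.l_distr A.r_distr A.m_assoc extensional_def intro!: ext)
  \<comment> \<open>\<open>M\<close> stripped of extra record fields, since
    \<open>projective\<close> quantifies over plain right module records.\<close>
  define P :: "('a, 'm) right_module" where "P = right_module.truncate M"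
  have P_simps: "carrier P = carrier M" "ring.zero P = ring.zero M" "ring.add P = ring.add M" "rsmult P = rsmult M"
    by (simp_all add: P_def right_module.truncate_def)
  have P: "right_module A P" by (rule right_module_cong[OF M]) (simp_all add: P_simps)
  define p where "p c = (\<Oplus>\<^bsub>M\<^esub>g\<in>G. g \<triangleleft>\<^bsub>M\<^esub> c g)" for c :: "'m \<Rightarrow> 'a"
  have Gc: "g \<triangleleft>\<^bsub>M\<^esub> c g \<in> carrier M" if "g \<in> G" "c \<in> carrier F" for g c
    using that G by (intro M.rsmult_closed) (auto simp: F_simps)
  have p: "p \<in> right_hom A F P"
  proof -
    have "p c \<in> carrier M" if "c \<in> carrier F" for c
      unfolding p_def using that Gc by (intro M.finsum_closed) auto
    moreover have "p (c \<oplus>\<^bsub>F\<^esub> d) = p c \<oplus>\<^bsub>M\<^esub> p d" if cd: "c \<in> carrier F" "d \<in> carrier F" for c d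
    proof -
      have "p (c \<oplus>\<^bsub>F\<^esub> d) = (\<Oplus>\<^bsub>M\<^esub>g\<in>G. g \<triangleleft>\<^bsub>M\<^esub> c g \<oplus>\<^bsub>M\<^esub> g \<triangleleft>\<^bsub>M\<^esub> d g)"
        unfolding p_def using cd G Gc[OF _ cd(1)] Gc[OF _ cd(2)]
        by (intro M.finsum_cong') (auto simp: F_simps PiE_iff subset_iff M.rsmult_r_distr)
      also have "\<dots> = p c \<oplus>\<^bsub>M\<^esub> p d"
        unfolding p_def using cd Gc by (intro M.finsum_addf) auto
      finally show ?thesis .
    qed
    moreover have "p (c \<triangleleft>\<^bsub>F\<^esub> a) = p c \<triangleleft>\<^bsub>M\<^esub> a" if ca: "c \<in> carrier F" "a \<in> carrier A" for c a
    proof -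
      have "p c \<triangleleft>\<^bsub>M\<^esub> a = (\<Oplus>\<^bsub>M\<^esub>g\<in>G. (g \<triangleleft>\<^bsub>M\<^esub> c g) \<triangleleft>\<^bsub>M\<^esub> a)"
        unfolding p_def using ca G Gc
        by (intro additive_finsum[OF M.abelian_group_axioms M.abelian_group_axioms M.rsmult_additive]) auto
      also have "\<dots> = p (c \<triangleleft>\<^bsub>F\<^esub> a)"
        unfolding p_def using ca G
        by (intro M.finsum_cong') (auto simp: F_simps PiE_iff subset_iff M.rsmult_assoc intro!: M.rsmult_closed)
      finally show ?thesis by simp
    qed
    ultimately show ?thesis by (simp add: right_hom_def P_simps)
  qed
  have surj: "p ` carrier F = carrier P"
  proof
    show "p ` carrier F \<subseteq> carrier P" using right_hom_closed[OF p] by auto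
    show "carrier P \<subseteq> p ` carrier F"
    proof
      fix u assume "u \<in> carrier P"
      then obtain c where c: "c \<in> G \<rightarrow> carrier A" "u = (\<Oplus>\<^bsub>M\<^esub>g\<in>G. g \<triangleleft>\<^bsub>M\<^esub> c g)"
        using gen by (auto simp: P_simps)
      have "p (restrict c G) = u"
        unfolding p_def c(2) using c(1) G by (intro M.finsum_cong') (auto intro!: M.rsmult_closed)
      moreover have "restrict c G \<in> carrier F" using c(1) by (auto simp: F_simps)
      ultimately show "u \<in> p ` carrier F" by blast
    qed
  qed
  have id: "(\<lambda>u. u) \<in> right_hom A M P" by (simp add: right_hom_def P_simps)
  obtain h where h: "h \<in> right_hom A M F" and ph: "\<And>u. u \<in> carrier M \<Longrightarrow> p (h u) = u"
    using proj[unfolded projective_def, rule_format, OF F P p id surj] by (elim bexE) auto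
  \<comment> \<open>\<open>dual_basis\<close> is indexed by the naturals below \<open>n\<close>, so
    the generating set is enumerated; the generators themselves become the vectors of the dual
    basis.\<close>
  obtain e where e: "bij_betw e {..<card G} G"
    using ex_bij_betw_nat_finite[OF G(1)] by (auto simp: atLeast0LessThan)
  have eG: "e i \<in> G" if "i < card G" for i using bij_betwE[OF e] that by auto
  \<comment> \<open>The coordinate functionals of the section \<open>h\<close>: expanding
    \<open>p (h u) = u\<close> over \<open>G\<close> is then the dual basis identity.\<close>
  define e' where "e' i = (\<lambda>u\<in>carrier M. h u (e i))" for i
  have hc: "h u g \<in> carrier A" if "u \<in> carrier M" "g \<in> G" for u g
    using right_hom_closed[OF h that(1)] that(2) by (auto simp: F_simps)
  have "e' i \<in> carrier (dual_bimodule A (End_bimodule M))" if "i < card G" for i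
    unfolding e'_def dual_bimodule_simps(1) using eG[OF that] hc
    by (auto simp: right_hom_def M.rsmult_closed right_hom_add[OF h] right_hom_smult[OF h] F_simps)
  moreover have "u = (\<Oplus>\<^bsub>M\<^esub>i\<in>{..<card G}. e i \<triangleleft>\<^bsub>M\<^esub> e' i u)" if u: "u \<in> carrier M" for u
  proof -
    have "u = (\<Oplus>\<^bsub>M\<^esub>g\<in>e ` {..<card G}. g \<triangleleft>\<^bsub>M\<^esub> h u g)"
      using ph[OF u] bij_betw_imp_surj_on[OF e] by (simp add: p_def)
    also have "\<dots> = (\<Oplus>\<^bsub>M\<^esub>i\<in>{..<card G}. e i \<triangleleft>\<^bsub>M\<^esub> h u (e i))"
      using bij_betw_imp_inj_on[OF e] Gc[OF _ right_hom_closed[OF h u]] eG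
      by (intro M.finsum_reindex) auto
    finally show ?thesis using u by (simp add: e'_def)
  qed
  ultimately have "dual_basis A (End_bimodule M) (card G) e' e"
    using eG G(2) unfolding dual_basis_def by (auto simp: finsum_End_bimodule)
  then show ?thesis by blast
qed

section \<open>The canonical map\<close>

context canonical
begin

interpretation MC: tensor_pair A M C by (rule pair_MC)
interpretation G: abelian_group "tensor_group A M C" by (rule MC.abelian_group_tensor)

abbreviation "M\<^sub>T' \<equiv> dual_bimodule A M\<^sub>T"

lemma abelian_group_C: "abelian_group C"
  using C.bimodule_axioms by (simp add: bimodule_def right_module_def)

lemma dual_closed: "\<lbrakk>\<phi> \<in> carrier M\<^sub>T'; u \<in> carrier M\<rbrakk> \<Longrightarrow> \<phi> u \<in> carrier A"
  using dual_apply(1)[of \<phi> A M\<^sub>T u] by simp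

lemma dual_add: "\<lbrakk>\<phi> \<in> carrier M\<^sub>T'; u \<in> carrier M; v \<in> carrier M\<rbrakk> \<Longrightarrow> \<phi> (u \<oplus>\<^bsub>M\<^esub> v) = \<phi> u \<oplus>\<^bsub>A\<^esub> \<phi> v"
  using dual_apply(2)[of \<phi> A M\<^sub>T u v] by simp

lemma dual_rsmult: "\<lbrakk>\<phi> \<in> carrier M\<^sub>T'; u \<in> carrier M; a \<in> carrier A\<rbrakk> \<Longrightarrow> \<phi> (u \<triangleleft>\<^bsub>M\<^esub> a) = \<phi> u \<otimes>\<^bsub>A\<^esub> a"
  using dual_apply(3)[of \<phi> A M\<^sub>T u a] by simp

definition
  "slice \<phi> = tensor_lift C (\<lambda>(m, c). \<phi> m \<triangleright>\<^bsub>C\<^esub> c)"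

lemma slice_balanced: "\<phi> \<in> carrier M\<^sub>T' \<Longrightarrow> balanced A M C C (\<lambda>(m, c). \<phi> m \<triangleright>\<^bsub>C\<^esub> c)"
  by (rule balancedI)
    (simp_all add: dual_closed dual_add dual_rsmult C.lsmult_closed C.lsmult_l_distr C.lsmult_r_distr
      C.lsmult_assoc del: dual_bimodule_simps)

lemma slice_tens:
  "\<lbrakk>\<phi> \<in> carrier M\<^sub>T'; m \<in> carrier M; c \<in> carrier C\<rbrakk> \<Longrightarrow> slice \<phi> (tens A M C m c) = \<phi> m \<triangleright>\<^bsub>C\<^esub> c"
  unfolding slice_def by (subst MC.tensor_lift_tens[OF abelian_group_C slice_balanced]) simp_all

lemma slice_additive: "\<phi> \<in> carrier M\<^sub>T' \<Longrightarrow> slice \<phi> \<in> additive (tensor_group A M C) C"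
  unfolding slice_def by (rule MC.tensor_lift_additive[OF abelian_group_C slice_balanced])

text \<open>Right linearity is what makes the tensor map \<open>slice \<phi> \<otimes> C\<close>
  over \<open>A\<close> well defined.\<close>

lemma slice_right_hom:
  assumes \<phi>: "\<phi> \<in> carrier M\<^sub>T'"
  shows "slice \<phi> \<in> right_hom A MC C"
proof -
  have "slice \<phi> (Y \<triangleleft>\<^bsub>MC\<^esub> a) = slice \<phi> Y \<triangleleft>\<^bsub>C\<^esub> a"
    if a: "a \<in> carrier A" and Y: "Y \<in> carrier (tensor_group A M C)" for a Y
  proof -
    have "(\<lambda>Y. Y \<triangleleft>\<^bsub>MC\<^esub> a) \<in> additive (tensor_group A M C) (tensor_group A M C)"
      using right_module.rsmult_additive[OF right_module_MC a] by (simp del: tensor_right_simps)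
    note add = additive_compose[OF this slice_additive[OF \<phi>]]
    show ?thesis
      by (rule MC.tensor_eqI[OF abelian_group_C add additive_compose[OF slice_additive[OF \<phi>]
              right_module.rsmult_additive[OF bimodule_right_module[OF C.bimodule_axioms] a]] _ Y])
        (use \<phi> a in \<open>simp add: slice_tens tens_rsmult[OF M.right_module_axioms C.bimodule_axioms]
          C.rsmult_closed C.lsmult_rsmult dual_closed del: dual_bimodule_simps tensor_right_simps\<close>)
  qed
  then show ?thesis
    using slice_additive[OF \<phi>] by (simp add: right_hom_eq del: tensor_right_simps(2-))
qed

text \<open>This map will turn out to be \<open>u \<mapsto> can (\<phi> \<otimes> u)\<close>. Its
  linearity gives that of \<open>can\<close>, and lets the dual basis coefficients be absorbed when
  the comultiplication is computed.\<close>

lemma slice_coaction_right_hom: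
  assumes \<phi>: "\<phi> \<in> carrier M\<^sub>T'"
  shows "(\<lambda>u. slice \<phi> (\<rho> u)) \<in> right_hom A M C"
  using slice_right_hom[OF \<phi>] coaction_hom unfolding right_hom_def by (auto simp: Pi_iff)

text \<open>On \<open>m \<otimes> c\<close> this is associativity of the left action of
  \<open>A\<close> on \<open>C\<close>. It supplies the left linearity of
  \<open>can\<close>.\<close>

lemma slice_lsmult:
  assumes \<phi>: "\<phi> \<in> carrier M\<^sub>T'" and a: "a \<in> carrier A" and Y: "Y \<in> carrier (tensor_group A M C)"
  shows "slice (a \<triangleright>\<^bsub>M\<^sub>T'\<^esub> \<phi>) Y = a \<triangleright>\<^bsub>C\<^esub> slice \<phi> Y"
proof -
  have a\<phi>: "a \<triangleright>\<^bsub>M\<^sub>T'\<^esub> \<phi> \<in> carrier M\<^sub>T'"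
    by (rule left_module.lsmult_closed[OF bimodule_left_module[OF bimodule_dual[OF bimodule_M\<^sub>T]] a \<phi>])
  have [simp]: "(a \<triangleright>\<^bsub>M\<^sub>T'\<^esub> \<phi>) m = a \<otimes>\<^bsub>A\<^esub> \<phi> m" if "m \<in> carrier M" for m
    using that by simp
  show ?thesis
    by (rule MC.tensor_eqI[OF abelian_group_C slice_additive[OF a\<phi>]
          additive_compose[OF slice_additive[OF \<phi>] MC.lsmult_additive[OF a]] _ Y])
      (use \<phi> a a\<phi> in \<open>simp add: slice_tens C.lsmult_assoc dual_closed del: dual_bimodule_simps\<close>)
qed

lemma counit_left_hom: "counit C \<in> left_hom A C (regular_bimodule A)"
  using C.counit_hom by (simp add: bimodule_hom_eq)

text \<open>On \<open>m \<otimes> c\<close> both sides are \<open>\<phi> m\<close> times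
  \<open>counit C c\<close>: left linearity of the counit gives one, right linearity of
  \<open>\<phi>\<close> the other. At \<open>Y = \<rho> u\<close> the argument of
  \<open>\<phi>\<close> becomes \<open>u\<close> by the counit axiom of the comodule.\<close>

lemma counit_slice:
  assumes \<phi>: "\<phi> \<in> carrier M\<^sub>T'" and Y: "Y \<in> carrier (tensor_group A M C)"
  shows "counit C (slice \<phi> Y) = \<phi> (right_unit M (tensor_map A M (regular_bimodule A) (\<lambda>x. x) (counit C) Y))"
proof -
  have \<epsilon>: "counit C \<in> additive C A"
    using left_hom_additive[OF counit_left_hom] by simp
  have A: "abelian_group A" using alg_A by (simp add: assoc_algebra_def module_def)
  have \<phi>a: "\<phi> \<in> additive M A" using \<phi> by (intro additiveI) (simp_all add: dual_closed dual_add del: dual_bimodule_simps)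
  note r = additive_compose[OF additive_compose[OF MC.tensor_map_additive[OF M.right_unit_pair right_hom_id counit_left_hom]
        M.right_unit_additive] \<phi>a]
  show ?thesis
    by (rule MC.tensor_eqI[OF A additive_compose[OF slice_additive[OF \<phi>] \<epsilon>] r _ Y])
      (use \<phi> additive_closed[OF \<epsilon>] left_hom_smult[OF counit_left_hom] in
        \<open>simp add: slice_tens MC.tensor_map_tens[OF M.right_unit_pair right_hom_id counit_left_hom]
          M.right_unit_tens dual_rsmult dual_closed del: dual_bimodule_simps\<close>)
qed

lemma pair_CC: "tensor_pair A C C"
  by (rule tensor_pairI[OF bimodule_right_module[OF C.bimodule_axioms] left_module_C])

lemma triple_MCC: "tensor_triple K A A A M C C"
  by (intro tensor_triple.intro M.right_module_axioms C.bimodule_axioms)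

lemma pair_MC_C: "tensor_pair A MC C"
  by (rule tensor_pairI[OF right_module_MC left_module_C])

lemma comult_left_hom: "comult C \<in> left_hom A C (tensor A C C)"
  using C.comult_hom by (simp add: bimodule_hom_eq)

text \<open>Valid for every \<open>Y\<close>, where only left linearity of the comultiplication
  enters. The right side is arranged so that at \<open>Y = \<rho> u\<close> its inner part is one
  side of the coassociativity of the coaction.\<close>

lemma comult_slice:
  assumes \<phi>: "\<phi> \<in> carrier M\<^sub>T'" and Y: "Y \<in> carrier (tensor_group A M C)"
  shows "comult C (slice \<phi> Y) = tensor_map A C C (slice \<phi>) (\<lambda>x. x)
    (tensor_assoc A A M C C (tensor_map A M (tensor A C C) (\<lambda>x. x) (comult C) Y))"
proof -
  interpret CC: tensor_pair A C C by (rule pair_CC)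
  interpret MCC: tensor_triple K A A A M C C by (rule triple_MCC)
  interpret MC_C: tensor_pair A MC C by (rule pair_MC_C)
  interpret M_CC: tensor_pair A M "tensor A C C" by (rule MCC.pair_L_MN)
  have CC: "abelian_group (tensor_group A C C)" by (rule CC.abelian_group_tensor)
  have \<Delta>: "comult C \<in> additive C (tensor_group A C C)"
    using left_hom_additive[OF comult_left_hom] by simp
  note s = MC_C.tensor_map_additive[OF pair_CC slice_right_hom[OF \<phi>] left_hom_id]
  \<comment> \<open>Needed at \<open>Z = comult C c\<close>, which is in general not a pure tensor;
    hence the claim for all \<open>Z\<close>, by additivity in \<open>Z\<close>.\<close>
  have inner: "tensor_map A C C (slice \<phi>) (\<lambda>x. x) (tensor_assoc A A M C C (tens A M (tensor A C C) m Z)) =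
      \<phi> m \<triangleright>\<^bsub>tensor A C C\<^esub> Z" if m: "m \<in> carrier M" and Z: "Z \<in> carrier (tensor_group A C C)" for m Z
  proof -
    have \<phi>m: "\<phi> m \<in> carrier A" by (rule dual_closed[OF \<phi> m])
    have l: "(\<lambda>Z. \<phi> m \<triangleright>\<^bsub>tensor A C C\<^esub> Z) \<in> additive (tensor_group A C C) (tensor_group A C C)"
      using left_module.lsmult_additive[OF bimodule_left_module[OF MCC.bimodule_MN] \<phi>m] by (simp del: tensor_simps)
    have r: "tens A M (tensor A C C) m \<in> additive (tensor_group A C C) (tensor_group A M (tensor A C C))"
      using M_CC.additive_tens_right[OF m] by simp
    show ?thesis
      by (rule CC.tensor_eqI[OF CC additive_compose[OF additive_compose[OF r MCC.tensor_assoc_additive] s] l _ Z])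
        (use m \<phi> \<phi>m in \<open>simp add: MCC.tensor_assoc_tens MC.tens_closed slice_tens
           MC_C.tensor_map_tens[OF pair_CC slice_right_hom[OF \<phi>] left_hom_id]
           tens_lsmult[OF C.bimodule_axioms left_module_C] del: dual_bimodule_simps tensor_simps(4-)\<close>)
  qed
  show ?thesis
    by (rule MC.tensor_eqI[OF CC additive_compose[OF slice_additive[OF \<phi>] \<Delta>]
          additive_compose[OF additive_compose[OF MC.tensor_map_additive[OF MCC.pair_L_MN right_hom_id comult_left_hom]
            MCC.tensor_assoc_additive] s] _ Y])
      (use \<phi> additive_closed[OF \<Delta>] left_hom_smult[OF comult_left_hom] in
        \<open>simp add: slice_tens MC.tensor_map_tens[OF MCC.pair_L_MN right_hom_id comult_left_hom]
          inner dual_closed del: dual_bimodule_simps tensor_simps(4-)\<close>)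
qed

text \<open>Equipping \<open>M\<close> with the action of \<open>T\<close> affects only the outer
  left side of \<open>M \<otimes> C\<close>, not the underlying group.\<close>

lemma tens_M\<^sub>T: "tens A M\<^sub>T C = tens A M C" "tensor_group A M\<^sub>T C = tensor_group A M C"
  by (rule tens_cong; simp)+

text \<open>This is the defining condition of comodule endomorphisms, reread as linearity:
  \<open>f\<close> acts on \<open>M \<otimes> C\<close> as \<open>f \<otimes> C\<close>. It makes
  the first map in the definition of \<open>can\<close> well defined over \<open>T\<close>.\<close>

lemma coaction_left_hom: "\<rho> \<in> left_hom T M\<^sub>T (tensor A M\<^sub>T C)"
proof -
  have "additive M\<^sub>T (tensor_group A M C) = additive M (tensor_group A M C)"
    by (rule additive_cong) simp_all
  then have "\<rho> \<in> additive M\<^sub>T (tensor A M\<^sub>T C)"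
    using coaction_additive by (simp add: tens_M\<^sub>T)
  moreover have "\<rho> (f \<triangleright>\<^bsub>M\<^sub>T\<^esub> u) = f \<triangleright>\<^bsub>tensor A M\<^sub>T C\<^esub> \<rho> u" if "f \<in> carrier T" "u \<in> carrier M" for f u
    using T_coaction[OF that] by (simp add: tensor_map_def tens_M\<^sub>T)
  ultimately show ?thesis unfolding left_hom_def by simp
qed

end

section \<open>Compatibility of the canonical map with the coring structures\<close>

locale canonical_comatrix = canonical K A C M
  for K (structure) and A (structure) and C (structure) and M (structure) +
  fixes n e' e
  assumes dual_basis: "dual_basis A M\<^sub>T n e' e"
begin

text \<open>The base ring of the comatrix construction becomes \<open>T\<close>. The dual basis
  enters the resulting coring only through its comultiplication.\<close>

sublocale D: comatrix K T A M\<^sub>T n e' e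
  by (intro comatrix.intro bimodule_M\<^sub>T comatrix_axioms.intro dual_basis)

abbreviation "X \<equiv> comatrix_coring T A M\<^sub>T n e' e"
abbreviation "t \<equiv> tens T M\<^sub>T' M\<^sub>T"
abbreviation "\<kappa> \<equiv> can A C M"

interpretation MC: tensor_pair A M C by (rule pair_MC)
interpretation MTM: tensor_pair T M\<^sub>T' M\<^sub>T by (rule D.pair_M'M)

lemma triple: "tensor_triple K T A A M\<^sub>T' M\<^sub>T C"
  by (intro tensor_triple.intro bimodule_right_module[OF D.bimodule_M'] bimodule_M\<^sub>T C.bimodule_axioms)

interpretation R: tensor_triple K T A A M\<^sub>T' M\<^sub>T C by (rule triple)
interpretation RL: tensor_pair T M\<^sub>T' "tensor A M\<^sub>T C" by (rule R.pair_L_MN)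
interpretation RR: tensor_pair A "tensor_right T M\<^sub>T' M\<^sub>T" C by (rule R.pair_LM_N)

text \<open>Restated for the record \<open>tensor_right\<close>, over which the associator forms its
  target.\<close>

lemma counit_right_hom: "comatrix_counit A \<in> right_hom A (tensor_right T M\<^sub>T' M\<^sub>T) (regular_bimodule A)"
  using D.counit_right_hom by (simp add: right_hom_def)

text \<open>The part of \<open>can\<close> that follows the coaction, isolated so that it can be
  evaluated at \<open>\<phi> \<otimes> Y\<close> for arbitrary \<open>Y\<close>.\<close>

abbreviation "can_tail \<equiv> \<lambda>Y. left_unit C (tensor_map A (regular_bimodule A) C (comatrix_counit A) (\<lambda>x. x)
  (tensor_assoc T A M\<^sub>T' M\<^sub>T C Y))"

lemma can_tail_additive: "can_tail \<in> additive (tensor_group T M\<^sub>T' (tensor A M\<^sub>T C)) C"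
  by (rule additive_compose[OF R.tensor_assoc_additive additive_compose[OF
        RR.tensor_map_additive[OF MC.left_unit_pair counit_right_hom left_hom_id] MC.left_unit_additive]])

lemma can_eq: "\<kappa> x = can_tail (tensor_map T M\<^sub>T' (tensor A M\<^sub>T C) (\<lambda>x. x) \<rho> x)"
  by (simp add: can_def Let_def)

lemma can_additive: "\<kappa> \<in> additive X C"
  using additive_compose[OF MTM.tensor_map_additive[OF R.pair_L_MN right_hom_id coaction_left_hom] can_tail_additive]
  unfolding can_eq[symmetric] D.additive_X .

text \<open>Instead of choosing an expression of \<open>\<rho> u\<close> by pure tensors,
  \<open>\<rho> u\<close> is replaced by a variable \<open>Y\<close> in which both sides are
  additive. At \<open>Y = m \<otimes> c\<close> the associator exposes
  \<open>\<phi> \<otimes> m\<close>, the counit turns it into \<open>\<phi> m\<close>, and the unit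
  map lets this scalar act on \<open>c\<close>.\<close>

lemma can_tens:
  assumes \<phi>: "\<phi> \<in> carrier M\<^sub>T'" and u: "u \<in> carrier M"
  shows "\<kappa> (t \<phi> u) = slice \<phi> (\<rho> u)"
proof -
  have "tens T M\<^sub>T' (tensor A M\<^sub>T C) \<phi> \<in> additive (tensor_group A M C) (tensor_group T M\<^sub>T' (tensor A M\<^sub>T C))"
    using RL.additive_tens_right[OF \<phi>] by (simp add: tens_M\<^sub>T del: dual_bimodule_simps)
  note add = additive_compose[OF this can_tail_additive]
  have "can_tail (tens T M\<^sub>T' (tensor A M\<^sub>T C) \<phi> Y) = slice \<phi> Y" if Y: "Y \<in> carrier (tensor_group A M C)" for Y
  proof (rule MC.tensor_eqI[OF abelian_group_C add slice_additive[OF \<phi>] _ Y])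
    fix m c assume m: "m \<in> carrier M" and c: "c \<in> carrier C"
    have "tensor_assoc T A M\<^sub>T' M\<^sub>T C (tens T M\<^sub>T' (tensor A M\<^sub>T C) \<phi> (tens A M C m c)) =
        tens A (tensor_right T M\<^sub>T' M\<^sub>T) C (t \<phi> m) c"
      using R.tensor_assoc_tens[OF \<phi> _ c, of m] m by (simp add: tens_M\<^sub>T)
    then show "can_tail (tens T M\<^sub>T' (tensor A M\<^sub>T C) \<phi> (tens A M C m c)) = slice \<phi> (tens A M C m c)"
      using m c \<phi> D.t_closed[OF \<phi>, of m]
      by (simp add: RR.tensor_map_tens[OF MC.left_unit_pair counit_right_hom left_hom_id]
          MC.left_unit_tens D.counit_tens dual_closed slice_tens del: dual_bimodule_simps)
  qed
  then show ?thesis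
    unfolding can_eq
    using MTM.tensor_map_tens[OF R.pair_L_MN right_hom_id coaction_left_hom \<phi>, of u] u coaction_closed[OF u]
    by simp
qed

lemma can_right_hom: "\<kappa> \<in> right_hom A X C"
proof -
  have "\<kappa> (x \<triangleleft>\<^bsub>X\<^esub> a) = \<kappa> x \<triangleleft>\<^bsub>C\<^esub> a" if x: "x \<in> carrier X" and a: "a \<in> carrier A" for x a
    by (rule D.X_eqI[OF abelian_group_C
          additive_compose[OF right_module.rsmult_additive[OF bimodule_right_module[OF D.bimodule_X] a] can_additive]
          additive_compose[OF can_additive right_module.rsmult_additive[OF bimodule_right_module[OF C.bimodule_axioms] a]] _ x])
      (use a in \<open>simp add: D.t_rsmult can_tens M.rsmult_closed right_hom_smult[OF slice_coaction_right_hom]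
         del: dual_bimodule_simps comatrix_coring_simps\<close>)
  then show ?thesis using can_additive by (simp add: right_hom_eq del: comatrix_coring_simps)
qed

lemma can_left_hom: "\<kappa> \<in> left_hom A X C"
proof -
  have "\<kappa> (a \<triangleright>\<^bsub>X\<^esub> x) = a \<triangleright>\<^bsub>C\<^esub> \<kappa> x" if x: "x \<in> carrier X" and a: "a \<in> carrier A" for x a
    by (rule D.X_eqI[OF abelian_group_C
          additive_compose[OF left_module.lsmult_additive[OF bimodule_left_module[OF D.bimodule_X] a] can_additive]
          additive_compose[OF can_additive MC.lsmult_additive[OF a]] _ x])
      (use a in \<open>simp add: D.t_lsmult can_tens left_module.lsmult_closed[OF bimodule_left_module[OF D.bimodule_M']]
         slice_lsmult coaction_closed del: dual_bimodule_simps comatrix_coring_simps\<close>)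
  then show ?thesis using can_additive by (simp add: left_hom_def del: comatrix_coring_simps)
qed

lemma can_counit:
  assumes x: "x \<in> carrier X"
  shows "counit C (\<kappa> x) = comatrix_counit A x"
proof -
  have "counit C \<in> additive C A"
    using left_hom_additive[OF counit_left_hom] by simp
  then show ?thesis
    by (intro D.X_eqI[OF D.abelian_group_A additive_compose[OF can_additive] D.counit_additive _ x])
      (simp_all add: can_tens D.counit_tens counit_slice coaction_closed coaction_counit
        del: dual_bimodule_simps comatrix_coring_simps)
qed

text \<open>\<open>\<Sum>\<^sub>i can (\<phi> \<otimes> e i) \<otimes> can (e' i \<otimes> u)\<close> is the image of \<open>\<rho> u\<close> under
  \<open>m \<otimes> c \<mapsto> \<Sum>\<^sub>i slice \<phi> (\<rho> (e i)) \<otimes> e' i m \<triangleright> c\<close>, and moving the scalar \<open>e' i m\<close> across the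
  tensor sign collapses the sum to \<open>slice \<phi> (\<rho> m) \<otimes> c\<close>.\<close>

lemma dual_basis_collapse:
  assumes \<phi>: "\<phi> \<in> carrier M\<^sub>T'" and Y: "Y \<in> carrier (tensor_group A M C)"
  shows "(\<Oplus>\<^bsub>tensor_group A C C\<^esub>i\<in>{..<n}. tens A C C (slice \<phi> (\<rho> (e i))) (slice (e' i) Y)) =
    tensor_map A C C (\<lambda>m. slice \<phi> (\<rho> m)) (\<lambda>x. x) Y"
proof -
  interpret CC: tensor_pair A C C by (rule pair_CC)
  have CC: "abelian_group (tensor_group A C C)" by (rule CC.abelian_group_tensor)
  note h = slice_coaction_right_hom[OF \<phi>]
  have db: "e' i \<in> carrier M\<^sub>T'" "e i \<in> carrier M" if "i < n" for i
    using D.dual_basis_closed[OF that] by simp_all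
  have add: "(\<lambda>Y. \<Oplus>\<^bsub>tensor_group A C C\<^esub>i\<in>{..<n}. tens A C C (slice \<phi> (\<rho> (e i))) (slice (e' i) Y))
      \<in> additive (tensor_group A M C) (tensor_group A C C)"
    by (intro additive_finsum_pointwise[OF CC] additive_compose[OF slice_additive CC.additive_tens_right])
      (auto simp: db right_hom_closed[OF h] simp del: dual_bimodule_simps)
  show ?thesis
  proof (rule MC.tensor_eqI[OF CC add MC.tensor_map_additive[OF pair_CC h left_hom_id] _ Y])
    fix m c assume m: "m \<in> carrier M" and c: "c \<in> carrier C"
    have em: "e i \<triangleleft>\<^bsub>M\<^esub> e' i m \<in> carrier M" if "i < n" for i
      by (rule M.rsmult_closed[OF db(2)[OF that] dual_closed[OF db(1)[OF that] m]])
    have "(\<Oplus>\<^bsub>tensor_group A C C\<^esub>i\<in>{..<n}. tens A C C (slice \<phi> (\<rho> (e i))) (slice (e' i) (tens A M C m c))) =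
        (\<Oplus>\<^bsub>tensor_group A C C\<^esub>i\<in>{..<n}. tens A C C (slice \<phi> (\<rho> (e i \<triangleleft>\<^bsub>M\<^esub> e' i m))) c)"
    proof (rule abelian_monoid.finsum_cong'[OF abelian_group.axioms(1)[OF CC]])
      fix i assume "i \<in> {..<n}"
      then have i: "i < n" by simp
      show "tens A C C (slice \<phi> (\<rho> (e i))) (slice (e' i) (tens A M C m c)) =
          tens A C C (slice \<phi> (\<rho> (e i \<triangleleft>\<^bsub>M\<^esub> e' i m))) c"
        using CC.tens_smult[OF right_hom_closed[OF h db(2)[OF i]] dual_closed[OF db(1)[OF i] m] c]
        by (simp only: slice_tens[OF db(1)[OF i] m c] right_hom_smult[OF h db(2)[OF i] dual_closed[OF db(1)[OF i] m]])
    qed (use em c in \<open>auto intro!: CC.tens_closed right_hom_closed[OF h]\<close>)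
    also have "\<dots> = tens A C C (slice \<phi> (\<rho> (\<Oplus>\<^bsub>M\<^esub>i\<in>{..<n}. e i \<triangleleft>\<^bsub>M\<^esub> e' i m))) c"
      by (rule additive_finsum[symmetric, OF M.abelian_group_axioms CC
            additive_compose[OF right_hom_additive[OF h] CC.additive_tens_left[OF c]]])
        (use em in auto)
    also have "(\<Oplus>\<^bsub>M\<^esub>i\<in>{..<n}. e i \<triangleleft>\<^bsub>M\<^esub> e' i m) = m"
      using D.expand[of m] m by (simp add: finsum_End_bimodule)
    finally show "(\<Oplus>\<^bsub>tensor_group A C C\<^esub>i\<in>{..<n}. tens A C C (slice \<phi> (\<rho> (e i))) (slice (e' i) (tens A M C m c))) =
        tensor_map A C C (\<lambda>m. slice \<phi> (\<rho> m)) (\<lambda>x. x) (tens A M C m c)"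
      using MC.tensor_map_tens[OF pair_CC h left_hom_id m c] by simp
  qed
qed

lemma can_comult:
  assumes x: "x \<in> carrier X"
  shows "comult C (\<kappa> x) = tensor_map A C C \<kappa> \<kappa> (comatrix_comult T A M\<^sub>T n e' e x)"
proof -
  interpret CC: tensor_pair A C C by (rule pair_CC)
  interpret XX: tensor_pair A X X by (rule D.pair_XX)
  interpret MC_C: tensor_pair A MC C by (rule pair_MC_C)
  have CC: "abelian_group (tensor_group A C C)" by (rule CC.abelian_group_tensor)
  have \<Delta>: "comult C \<in> additive C (tensor_group A C C)"
    using left_hom_additive[OF comult_left_hom] by simp
  note k = XX.tensor_map_additive[OF pair_CC can_right_hom can_left_hom]
  show ?thesis
  proof (rule D.X_eqI[OF CC additive_compose[OF can_additive \<Delta>] additive_compose[OF D.comult_additive k] _ x])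
    fix \<phi> u assume \<phi>: "\<phi> \<in> carrier M\<^sub>T'" and "u \<in> carrier M\<^sub>T"
    then have u: "u \<in> carrier M" by simp
    have db: "e' i \<in> carrier M\<^sub>T'" "e i \<in> carrier M" if "i < n" for i
      using D.dual_basis_closed[OF that] by simp_all
    have s: "slice \<psi> (\<rho> v) \<in> carrier C" if "\<psi> \<in> carrier M\<^sub>T'" "v \<in> carrier M" for \<psi> v
      using right_hom_closed[OF slice_coaction_right_hom] that .
    have coact: "\<rho> \<in> right_hom A M MC" by (rule coaction_hom)
    have "comult C (\<kappa> (t \<phi> u)) = tensor_map A C C (slice \<phi>) (\<lambda>x. x)
        (tensor_map A MC C \<rho> (\<lambda>x. x) (\<rho> u))"
      by (simp only: can_tens[OF \<phi> u] comult_slice[OF \<phi> coaction_closed[OF u]] coaction_coassoc[OF u])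
    \<comment> \<open>Functoriality in the first factor: the tensor maps of \<open>\<rho>\<close>
      and \<open>slice \<phi>\<close> compose to that of their composite.\<close>
    also have "\<dots> = tensor_map A C C (\<lambda>m. slice \<phi> (\<rho> m)) (\<lambda>x. x) (\<rho> u)"
      by (rule MC.tensor_eqI[OF CC
            additive_compose[OF MC.tensor_map_additive[OF pair_MC_C coact left_hom_id]
              MC_C.tensor_map_additive[OF pair_CC slice_right_hom[OF \<phi>] left_hom_id]]
            MC.tensor_map_additive[OF pair_CC slice_coaction_right_hom[OF \<phi>] left_hom_id] _ coaction_closed[OF u]])
        (simp add: MC.tensor_map_tens[OF pair_MC_C coact left_hom_id] coaction_closed
          MC_C.tensor_map_tens[OF pair_CC slice_right_hom[OF \<phi>] left_hom_id]
          MC.tensor_map_tens[OF pair_CC slice_coaction_right_hom[OF \<phi>] left_hom_id])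
    also have "\<dots> = (\<Oplus>\<^bsub>tensor_group A C C\<^esub>i\<in>{..<n}. tens A C C (slice \<phi> (\<rho> (e i))) (slice (e' i) (\<rho> u)))"
      by (rule dual_basis_collapse[OF \<phi> coaction_closed[OF u], symmetric])
    \<comment> \<open>Both legs are recognized as values of \<open>can\<close> by
      \<open>can_tens\<close>, which turns the sum into the image of the comatrix
      comultiplication.\<close>
    also have "\<dots> = (\<Oplus>\<^bsub>tensor_group A C C\<^esub>i\<in>{..<n}. tensor_map A C C \<kappa> \<kappa> (tens A X X (t \<phi> (e i)) (t (e' i) u)))"
      using \<phi> u db D.t_closed
      by (intro abelian_monoid.finsum_cong'[OF abelian_group.axioms(1)[OF CC]])
        (auto simp: XX.tensor_map_tens[OF pair_CC can_right_hom can_left_hom] can_tens s Pi_iff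
          intro!: CC.tens_closed simp del: dual_bimodule_simps comatrix_coring_simps)
    also have "\<dots> = tensor_map A C C \<kappa> \<kappa> (comatrix_comult T A M\<^sub>T n e' e (t \<phi> u))"
      using D.additive_comult[OF CC k \<phi>, of u] u by simp
    finally show "comult C (\<kappa> (t \<phi> u)) = tensor_map A C C \<kappa> \<kappa> (comatrix_comult T A M\<^sub>T n e' e (t \<phi> u))" .
  qed
qed

theorem coring_hom_can: "coring_hom K A X C \<kappa>"
proof (intro coring_hom.intro coring_hom_axioms.intro D.coring_comatrix C.coring_axioms)
  show "\<kappa> \<in> bimodule_hom A A X C"
    using can_right_hom can_left_hom by (simp add: bimodule_hom_eq)
qed (simp_all only: comatrix_coring_simps(6,7) can_comult can_counit)

end

text \<open>The comatrix coring is built from a dual basis, so the claim is made for every choice of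
  one; the existence part keeps this from being vacuous and is where finite generation and
  projectivity enter.\<close>

theorem proposition2p7:
  fixes K :: "('k, 'kx) ring_scheme"
    and A :: "('k, 'a, 'ax) module_scheme"
    and C :: "('a, 'c, 'cx) coring_scheme"
    and \<Sigma> :: "('a, 'c, 's, 'sx) comodule_scheme"
  assumes "assoc_algebra K A"
    and "coring K A C"
    and "right_comodule K A C \<Sigma>"
    and "finitely_generated A \<Sigma>"
    and "projective A \<Sigma>"
  shows "(\<exists>n e' e. dual_basis A (End_bimodule \<Sigma>) n e' e) \<and>
    (\<forall>n e' e. dual_basis A (End_bimodule \<Sigma>) n e' e \<longrightarrow>
      coring_hom K A (comatrix_coring (comodule_End A C \<Sigma>) A (End_bimodule \<Sigma>) n e' e) C (can A C \<Sigma>))"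
proof (intro conjI allI impI)
  have "right_module A \<Sigma>" using assms(3) by (simp add: right_comodule_def)
  then show "\<exists>n e' e. dual_basis A (End_bimodule \<Sigma>) n e' e"
    using assms(4,5) by (rule dual_basis_exists)
next
  fix n e' e assume "dual_basis A (End_bimodule \<Sigma>) n e' e"
  then have "canonical_comatrix K A C \<Sigma> n e' e"
    using assms(3) by (simp add: canonical_comatrix_def canonical_comatrix_axioms_def canonical_iff)
  then show "coring_hom K A (comatrix_coring (comodule_End A C \<Sigma>) A (End_bimodule \<Sigma>) n e' e) C (can A C \<Sigma>)"
    by (rule canonical_comatrix.coring_hom_can)
qed

end
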